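(* Let $\rho$ be the spectral function of the singular Sturm--Liouville operator $Lu=-(\Psi w u')'/w$ on $(0,\infty)$ (as defined in the context). Then the spectral density function $\rho'(\lambda)$ is real analytic for $\lambda>0$, i.e. $\rho$ is differentiable on $(0,\infty)$ and $\rho'$ is a real analytic function on $(0,\infty)$.
   Context: Let $\operatorname{erf}(x)=\frac{2}{\sqrt\pi}\int_0^x e^{-s^2}\,ds$, $\Psi(x)=\frac{1}{2x^3}\left[\operatorname{erf}(x)-\frac{2}{\sqrt\pi}xe^{-x^2}\right]$ (with $\Psi(0)=\frac{2}{3\sqrt\pi}$ by continuity), and $w(x)=x^2e^{-x^2}$. For $\lambda\in\mathbb{C}$ consider the ODE $-(\Psi w u')'=\lambda w u$ on $(0,\infty)$. To a solution $u$ associate $y(x)=xe^{-x^2/2}u(x)$ and $z(x)=\Psi(x)x^2e^{-x^2/2}u'(x)$; all such $(y,z)$ extend analytically to a neighborhood of $x=0$. Let $u_1(x;\lambda)$ be the solution that is bounded near $x=0$ with $u_1(0;\lambda)=1$ (its pair $(y_1,z_1)$ is odd in $x$), and let $u_0(x;\lambda)$ be the solution whose pair $(y_0,z_0)$ is even in $x$ with $y_0(0)=\frac{3\sqrt\pi}{2}$, $z_0(0)=-1$; then $\Psi w(u_0u_1'-u_1u_0')\equiv 1$. The operator is of limit circle type at $0$ and limit point type at $\infty$; for $\lambda\in\mathbb{C}\setminus\mathbb{R}$ the Titchmarsh--Weyl $m$-function is $m(\lambda)=-\lim_{x\to\infty}\frac{u_0(x;\lambda)}{u_1(x;\lambda)}$,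 equivalently the unique complex number such that $u_0(\cdot;\lambda)+m(\lambda)u_1(\cdot;\lambda)\in L^2((0,\infty);w\,dx)$. It is analytic on $\mathbb{C}\setminus\mathbb{R}$ with $\operatorname{Im}m(\lambda)>0$ for $\operatorname{Im}\lambda>0$. The spectral function $\rho:\mathbb{R}\to\mathbb{R}$ is the non-decreasing function (unique up to an additive constant and its values at jump points) satisfying $$\rho(\tau_1)-\rho(\tau_0)=\lim_{\varepsilon\to0^+}\frac1\pi\int_{\tau_0}^{\tau_1}\operatorname{Im}\{m(\tau+i\varepsilon)\}\,d\tau$$ at all points of continuity $\tau_0<\tau_1$ of $\rho$. *)

theory Defs
  imports "HOL-Complex_Analysis.Complex_Analysis"
begin

text \<open>The oriented interval integral makes this the (odd) error function on the whole real line.\<close>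

definition erf :: "real \<Rightarrow> real" where
  "erf x = 2 / sqrt pi * (LBINT s=ereal 0..ereal x. exp (- (s\<^sup>2)))"

definition Psi :: "real \<Rightarrow> real" where
  "Psi x = (if x = 0 then 2 / (3 * sqrt pi)
            else 1 / (2 * x ^ 3) * (erf x - 2 / sqrt pi * x * exp (- (x\<^sup>2))))"

definition weight :: "real \<Rightarrow> real" where
  "weight x = x\<^sup>2 * exp (- (x\<^sup>2))"

text \<open>\<open>- (Psi weight u')' = lam weight u\<close> on \<open>(0, \<infinity>)\<close>; only the restriction of \<open>u\<close> to
  \<open>(0, \<infinity>)\<close> is constrained.\<close>

definition sl_solution :: "complex \<Rightarrow> (real \<Rightarrow> complex) \<Rightarrow> bool" where
  "sl_solution lam u \<longleftrightarrow>
     (\<forall>x>0. u differentiable (at x) \<and>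
        ((\<lambda>t. of_real (Psi t * weight t) * vector_derivative u (at t))
           has_vector_derivative - (lam * of_real (weight x) * u x)) (at x))"

definition pair_y :: "(real \<Rightarrow> complex) \<Rightarrow> real \<Rightarrow> complex" where
  "pair_y u x = of_real (x * exp (- (x\<^sup>2) / 2)) * u x"

definition pair_z :: "(real \<Rightarrow> complex) \<Rightarrow> real \<Rightarrow> complex" where
  "pair_z u x = of_real (Psi x * x\<^sup>2 * exp (- (x\<^sup>2) / 2)) * vector_derivative u (at x)"

text \<open>The value \<open>u(0) = 1\<close> is a one-sided limit, since solutions live on \<open>(0, \<infinity>)\<close>.\<close>

definition regular_solution :: "complex \<Rightarrow> (real \<Rightarrow> complex) \<Rightarrow> bool" where
  "regular_solution lam u \<longleftrightarrow>
     sl_solution lam u \<and> Bfun u (at_right 0) \<and> (u \<longlongrightarrow> 1) (at_right 0)"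

text \<open>\<open>Y\<close> and \<open>Z\<close> are the analytic extensions of the pair \<open>(y, z)\<close> to a neighbourhood of \<open>0\<close>;
  the solution itself is singular there.\<close>

definition even_solution :: "complex \<Rightarrow> (real \<Rightarrow> complex) \<Rightarrow> bool" where
  "even_solution lam u \<longleftrightarrow>
     sl_solution lam u \<and>
     (\<exists>r>0. \<exists>Y Z. Y holomorphic_on ball 0 r \<and> Z holomorphic_on ball 0 r \<and>
        (\<forall>x. 0 < x \<and> x < r \<longrightarrow>
           Y (complex_of_real x) = pair_y u x \<and> Z (complex_of_real x) = pair_z u x) \<and>
        (\<forall>\<zeta>\<in>ball 0 r. Y (- \<zeta>) = Y \<zeta> \<and> Z (- \<zeta>) = Z \<zeta>) \<and>
        Y 0 = of_real (3 * sqrt pi / 2) \<and> Z 0 = - 1)"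

text \<open>Both solutions are unique on \<open>(0, \<infinity>)\<close>. The choice operator only fixes irrelevant values
  on \<open>(-\<infinity>, 0]\<close>.\<close>

definition u1 :: "complex \<Rightarrow> real \<Rightarrow> complex" where
  "u1 lam = (SOME u. regular_solution lam u)"

definition u0 :: "complex \<Rightarrow> real \<Rightarrow> complex" where
  "u0 lam = (SOME u. even_solution lam u)"

text \<open>Meaningful for non-real \<open>lam\<close> only.\<close>

definition weyl_m :: "complex \<Rightarrow> complex" where
  "weyl_m lam = - Lim at_top (\<lambda>x. u0 lam x / u1 lam x)"

definition is_spectral_function :: "(real \<Rightarrow> real) \<Rightarrow> bool" where
  "is_spectral_function \<rho> \<longleftrightarrow>
     mono \<rho> \<and>
     (\<forall>\<tau>0 \<tau>1. \<tau>0 < \<tau>1 \<and> isCont \<rho> \<tau>0 \<and> isCont \<rho> \<tau>1 \<longrightarrow>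
        ((\<lambda>\<epsilon>. 1 / pi * (LBINT \<tau>=ereal \<tau>0..ereal \<tau>1. Im (weyl_m (Complex \<tau> \<epsilon>))))
           \<longlongrightarrow> \<rho> \<tau>1 - \<rho> \<tau>0) (at_right 0))"

definition real_analytic_on :: "(real \<Rightarrow> real) \<Rightarrow> real set \<Rightarrow> bool" where
  "real_analytic_on f S \<longleftrightarrow>
     (\<forall>x0\<in>S. \<exists>r>0. \<exists>a. \<forall>x. \<bar>x - x0\<bar> < r \<longrightarrow> (\<lambda>n. a n * (x - x0) ^ n) sums f x)"

end

theory Submission
  imports Defs
begin

text \<open>
  The quotient \<open>u\<^sub>0/u\<^sub>1\<close> extends analytically to a sector around the positive \<open>x\<close>-axis. In the variables
  \<open>y = x e\<^bsup>-x\<^sup>2/2\<^esup> u\<close>, \<open>z = e\<^bsup>x\<^sup>2/2\<^esup> v\<close>, where \<open>v = \<Psi> w u'\<close>, the equation reads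
  \<open>y' = (1/x - x) y + z/(x \<Psi>)\<close>, \<open>z' = x z - \<lambda> x y\<close> with \<open>1/(x \<Psi>) \<sim> 2 x\<^sup>2\<close>. Hence the Hermitian form
  \<open>- Im (\<kappa> z cnj y)\<close> increases exponentially along every path in the sector on which
  \<open>Im (\<kappa> \<lambda> \<gamma> x)\<close> and \<open>Im (cnj \<kappa> \<gamma> x\<^sup>2)\<close> dominate \<open>\<bar>x\<bar>\<close> and \<open>\<bar>x\<bar>\<^sup>2\<close>, \<open>\<gamma>\<close> being the direction of the path, and
  Weyl's nested discs make \<open>u\<^sub>0/u\<^sub>1\<close> converge there. For nonreal \<open>\<lambda>\<close> the real axis is such a path for some
  \<open>\<kappa>\<close> near \<open>1\<close>; paths leaving the axis at a small positive angle are such paths for all \<open>\<lambda>\<close> near a given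
  \<open>\<tau> > 0\<close>, real or not. The two limits agree for \<open>Im \<lambda> > 0\<close>, so the second one continues \<open>- m\<close> analytically
  across the positive axis, and \<open>\<rho>' = Im m / \<pi>\<close> there.
\<close>

section \<open>Averages along rays in a star-shaped domain\<close>

text \<open>For real \<lambda> and \<kappa> = 1 the form of u1 vanishes on the whole positive axis,
  so no disc shrinks there. A direction \<gamma> slightly above the axis makes Im (\<lambda>
  \<gamma> x) and Im (\<gamma> x^2) positive together; for \<lambda> < 0 they would have opposite
  signs, and this is where \<lambda> > 0 enters. The oblique ray starts one step off the axis, where
  the form is already positive at \<lambda> = \<tau>; continuity in \<lambda> spreads one lower
  bound over a ball, which makes the limit uniform. The agreement of the two limits closes a corner:
  r + \<omega> n is reached obliquely from r and horizontally from R + \<omega> n. One \<kappa> must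
  serve both directions. A horizontal path needs Im \<kappa> < 0, paid for by Im \<lambda> > 0, so
  the oblique estimate is proved for all \<kappa> near 1. The paths have slope at most 1/20 inside a
  wedge of slope 1/10, in which elementary estimates show that \<Psi> has no zero. At the singular
  point 0, averages of r^k f(r x) over 0 \<le> r \<le> 1 replace integrals divided by powers of x,
  so that no quotient has to be continued to 0.\<close>

definition ray_mean :: "nat \<Rightarrow> (complex \<Rightarrow> complex) \<Rightarrow> complex \<Rightarrow> complex" where
  "ray_mean k f x = integral {0..1} (\<lambda>r. of_real r ^ k * f (of_real r * x))"

locale star_domain =
  fixes S :: "complex set"
  assumes open_S: "open S" and zero_mem: "0 \<in> S"
    and ray_mem: "\<And>x r. x \<in> S \<Longrightarrow> 0 \<le> r \<Longrightarrow> r \<le> 1 \<Longrightarrow> of_real r * x \<in> S"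
begin

lemma starlike_S: "starlike S"
proof -
  have "closed_segment 0 x \<subseteq> S" if "x \<in> S" for x
    using ray_mem[OF that] by (auto simp: closed_segment_def scaleR_conv_of_real)
  then show ?thesis using zero_mem by (auto simp: starlike_def)
qed

lemma ray_integrable:
  fixes f :: "complex \<Rightarrow> complex"
  assumes "continuous_on S f" "x \<in> S"
  shows "(\<lambda>r. of_real r ^ k * f (of_real r * x)) integrable_on {0..1}"
proof -
  have "continuous_on {0..1::real} (\<lambda>r. f (of_real r * x))"
    by (rule continuous_on_compose2[OF assms(1)]) (auto intro!: continuous_intros ray_mem assms)
  then have "continuous_on {0..1::real} (\<lambda>r. of_real r ^ k * f (of_real r * x))"
    by (intro continuous_intros) auto
  then show ?thesis by (rule integrable_continuous_real)
qed

text \<open>Substituting s = r x: up to the factor x^(k+1), the average is the integral of s^k f(s)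
  along the segment from 0 to x.\<close>

lemma ray_mean_eq:
  assumes f: "f holomorphic_on S" and x: "x \<in> S"
    and p: "\<And>x. x \<in> S \<Longrightarrow> (p has_field_derivative x ^ k * f x) (at x)"
  shows "x ^ Suc k * ray_mean k f x = p x - p 0"
proof -
  have "((\<lambda>x. x ^ k * f x) has_contour_integral (p (pathfinish (linepath 0 x)) - p (pathstart (linepath 0 x))))
            (linepath 0 x)"
      by (rule contour_integral_primitive[of S])
         (use p x ray_mem in \<open>auto simp: closed_segment_def scaleR_conv_of_real
            simp del: linepath_0 intro: has_field_derivative_at_within\<close>)
  then have "((\<lambda>r. x ^ Suc k * (of_real r ^ k * f (of_real r * x))) has_integral p x - p 0) {0..1}"
    unfolding has_contour_integral_linepath pathfinish_linepath pathstart_linepath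
    by (simp add: scaleR_conv_of_real power_mult_distrib mult_ac)
  moreover have "((\<lambda>r. x ^ Suc k * (of_real r ^ k * f (of_real r * x))) has_integral
        x ^ Suc k * ray_mean k f x) {0..1}"
      unfolding ray_mean_def
      by (intro has_integral_mult_right integrable_integral ray_integrable
          holomorphic_on_imp_continuous_on f x)
  ultimately show ?thesis by (rule has_integral_unique[symmetric])
qed

text \<open>Hadamard's division: the difference quotient at 0 in a form that is holomorphic there.
  The construction of \<open>seed0\<close> rests on it.\<close>

lemma ray_mean_deriv_eq:
  assumes f: "f holomorphic_on S" and x: "x \<in> S"
  shows "x * ray_mean 0 (deriv f) x = f x - f 0"
proof -
  have "x ^ Suc 0 * ray_mean 0 (deriv f) x = f x - f 0"
    by (rule ray_mean_eq[OF holomorphic_deriv[OF f open_S] x])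
       (simp add: holomorphic_derivI[OF f open_S])
  then show ?thesis by simp
qed

lemma ray_mean_deriv:
  assumes "f holomorphic_on S" "x \<in> S"
  shows "((\<lambda>x. x ^ Suc k * ray_mean k f x) has_field_derivative x ^ k * f x) (at x)"
proof -
  have hol: "(\<lambda>x. x ^ k * f x) holomorphic_on S"
    by (intro holomorphic_intros assms)
  obtain p where p: "\<And>x. x \<in> S \<Longrightarrow> (p has_field_derivative x ^ k * f x) (at x)"
    using holomorphic_starlike_primitive[OF holomorphic_on_imp_continuous_on[OF hol] starlike_S open_S
        finite.emptyI] hol open_S by (meson DiffD1 holomorphic_on_imp_differentiable_at)
  have "((\<lambda>x. p x - p 0) has_field_derivative x ^ k * f x) (at x)"
    using p[OF assms(2)] by (auto intro!: derivative_eq_intros)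
  then show ?thesis
    by (rule has_field_derivative_transform_within_open[OF _ open_S assms(2)])
       (simp only: ray_mean_eq[OF assms(1) _ p])
qed

text \<open>Away from 0 the average is a holomorphic primitive divided by x^(k+1). At 0 continuity
  of the parameter integral suffices, since the singularity is then removable.\<close>

lemma ray_mean_holomorphic:
  assumes f: "f holomorphic_on S"
  shows "ray_mean k f holomorphic_on S"
proof (rule no_isolated_singularity[where K = "{0}"])
  have "continuous_on (S \<times> cbox 0 1) (\<lambda>(x, r::real). of_real r ^ k * f (of_real r * x))"
    unfolding split_beta
    by (intro continuous_intros continuous_on_compose2[OF holomorphic_on_imp_continuous_on[OF f]])
       (auto intro: ray_mem)
  from integral_continuous_on_param[OF this] show "continuous_on S (ray_mean k f)"
    by (simp add: ray_mean_def[abs_def])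
  have "(\<lambda>x. x ^ Suc k * ray_mean k f x) holomorphic_on S"
    using ray_mean_deriv[OF f] by (meson field_differentiable_at_within field_differentiable_def holomorphic_onI)
  then have "(\<lambda>x. x ^ Suc k * ray_mean k f x) holomorphic_on S - {0}"
    by (rule holomorphic_on_subset) auto
  then have "(\<lambda>x. x ^ Suc k * ray_mean k f x / x ^ Suc k) holomorphic_on S - {0}"
    by (rule holomorphic_on_divide) (auto intro!: holomorphic_intros)
  then show "ray_mean k f holomorphic_on S - {0}"
    by (rule holomorphic_transform) auto
qed (auto simp: open_S)

text \<open>Keeping the power r^m of the bound turns each average into a gain of 1/(k+m+1); these
  gains build the factorials of the Picard series.\<close>

lemma ray_mean_bound:
  assumes f: "continuous_on S f" and x: "x \<in> S"
    and b: "\<And>r. 0 \<le> r \<Longrightarrow> r \<le> 1 \<Longrightarrow> norm (f (of_real r * x)) \<le> A * r ^ m"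
  shows "norm (ray_mean k f x) \<le> A / real (k + m + 1)"
proof -
  have hi: "((\<lambda>r. A * r ^ (k + m)) has_integral A / real (k + m + 1)) {0..1}"
  proof -
    have "((\<lambda>r. A * r ^ (k + m)) has_integral
        (A * 1 ^ (k+m+1) / real (k + m + 1) - A * 0 ^ (k+m+1) / real (k + m + 1))) {0..1}"
    proof (rule fundamental_theorem_of_calculus)
      fix r :: real
      have "((\<lambda>r. A * r ^ (k+m+1) / real (k + m + 1)) has_field_derivative A * r ^ (k + m)) (at r within {0..1})"
        by (rule DERIV_cong[OF DERIV_cdivide[OF DERIV_cmult[OF DERIV_pow]]]) simp
      then show "((\<lambda>r. A * r ^ (k+m+1) / real (k + m + 1)) has_vector_derivative A * r ^ (k + m)) (at r within {0..1})"
        by (simp only: has_real_derivative_iff_has_vector_derivative)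
    qed simp
    then show ?thesis by simp
  qed
  have "norm (ray_mean k f x) \<le> integral {0..1} (\<lambda>r. A * r ^ (k + m))"
    unfolding ray_mean_def
  proof (rule integral_norm_bound_integral)
    show "(\<lambda>r. complex_of_real r ^ k * f (complex_of_real r * x)) integrable_on {0..1}"
      by (rule ray_integrable[OF f x])
    show "(\<lambda>r. A * r ^ (k + m)) integrable_on {0..1}" using hi by blast
    fix r :: real assume r: "r \<in> {0..1}"
    have "norm (complex_of_real r ^ k * f (complex_of_real r * x)) = r ^ k * norm (f (complex_of_real r * x))"
      using r by (simp add: norm_mult norm_power)
    also have "\<dots> \<le> r ^ k * (A * r ^ m)"
      by (rule mult_left_mono) (use b r in auto)
    finally show "norm (complex_of_real r ^ k * f (complex_of_real r * x)) \<le> A * r ^ (k + m)"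
      by (simp add: power_add mult_ac)
  qed
  also have "\<dots> = A / real (k + m + 1)" using hi by (rule integral_unique)
  finally show ?thesis .
qed

text \<open>Termwise integration by domination: the average of a remainder is at most the remainder
  of the majorant series.\<close>

lemma ray_mean_sums:
  assumes cont: "\<And>n. continuous_on S (f n)" and x: "x \<in> S"
    and bound: "\<And>n r. 0 \<le> r \<Longrightarrow> r \<le> 1 \<Longrightarrow> norm (f n (of_real r * x)) \<le> B n"
    and B: "summable B" and cF: "continuous_on S (\<lambda>s. \<Sum>n. f n s)"
  shows "(\<lambda>n. ray_mean k (f n) x) sums ray_mean k (\<lambda>s. \<Sum>n. f n s) x"
proof -
  have tail: "norm (ray_mean k (\<lambda>s. \<Sum>n. f n s) x - (\<Sum>n<N. ray_mean k (f n) x)) \<le> (\<Sum>n. B (n + N))" for N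
  proof -
    have eq: "ray_mean k (\<lambda>s. (\<Sum>n. f n s) - (\<Sum>n<N. f n s)) x =
        ray_mean k (\<lambda>s. \<Sum>n. f n s) x - (\<Sum>n<N. ray_mean k (f n) x)"
    proof -
      have "ray_mean k (\<lambda>s. (\<Sum>n. f n s) - (\<Sum>n<N. f n s)) x =
         integral {0..1} (\<lambda>r. of_real r ^ k * (\<Sum>n. f n (of_real r * x)) -
            (\<Sum>n<N. of_real r ^ k * f n (of_real r * x)))"
        by (simp add: ray_mean_def sum_distrib_left algebra_simps)
      also have "\<dots> = ray_mean k (\<lambda>s. \<Sum>n. f n s) x - (\<Sum>n<N. ray_mean k (f n) x)"
        unfolding ray_mean_def
        using ray_integrable[OF cF x, of k] ray_integrable[OF cont x, of k]
        by (subst Henstock_Kurzweil_Integration.integral_diff)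
           (auto intro!: integrable_sum simp: Henstock_Kurzweil_Integration.integral_sum)
      finally show ?thesis .
    qed
    have "norm (ray_mean k (\<lambda>s. (\<Sum>n. f n s) - (\<Sum>n<N. f n s)) x) \<le> (\<Sum>n. B (n + N)) / real (k + 0 + 1)"
    proof (rule ray_mean_bound[OF _ x])
      show "continuous_on S (\<lambda>s. (\<Sum>n. f n s) - (\<Sum>n<N. f n s))"
        by (intro continuous_intros cF cont)
      fix r :: real assume r: "0 \<le> r" "r \<le> 1"
      have s: "summable (\<lambda>n. norm (f n (of_real r * x)))"
        by (rule summable_comparison_test[OF _ B]) (use bound r in auto)
      have "(\<Sum>n. f n (of_real r * x)) - (\<Sum>n<N. f n (of_real r * x)) = (\<Sum>n. f (n + N) (of_real r * x))"
        using suminf_split_initial_segment[OF summable_norm_cancel[OF s], of N] by simp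
      also have "norm \<dots> \<le> (\<Sum>n. norm (f (n + N) (of_real r * x)))"
        by (rule summable_norm[OF summable_ignore_initial_segment[OF s]])
      also have "\<dots> \<le> (\<Sum>n. B (n + N))"
        by (rule suminf_le[OF _ summable_ignore_initial_segment[OF s] summable_ignore_initial_segment[OF B]])
           (use bound r in auto)
      finally show "norm ((\<Sum>n. f n (of_real r * x)) - (\<Sum>n<N. f n (of_real r * x))) \<le> (\<Sum>n. B (n + N)) * r ^ 0"
        by simp
    qed
    also have "\<dots> \<le> (\<Sum>n. B (n + N))"
    proof -
      have "0 \<le> B n" for n using order_trans[OF norm_ge_zero bound[of 0 n]] by simp
      then have "0 \<le> (\<Sum>n. B (n + N))"
        by (intro suminf_nonneg summable_ignore_initial_segment[OF B])
      then show ?thesis by (simp add: divide_le_eq mult_right_mono distrib_left)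
    qed
    finally show ?thesis unfolding eq .
  qed
  have "(\<lambda>N. ray_mean k (\<lambda>s. \<Sum>n. f n s) x - (\<Sum>n<N. ray_mean k (f n) x)) \<longlonglongrightarrow> 0"
    by (rule Lim_null_comparison[OF _ suminf_exist_split2[OF B]]) (use tail in auto)
  from tendsto_diff[OF tendsto_const this, of "ray_mean k (\<lambda>s. \<Sum>n. f n s) x"]
  show ?thesis unfolding sums_def by simp
qed

end

lemma ray_mean_even: "(\<And>r. 0 \<le> r \<Longrightarrow> r \<le> 1 \<Longrightarrow> f (- (of_real r * x)) = f (of_real r * x)) \<Longrightarrow> ray_mean k f (- x) = ray_mean k f x"
  unfolding ray_mean_def by (rule integral_cong) auto

section \<open>Solutions as power series in the spectral parameter\<close>

text \<open>Writing \<open>F = x u\<close> and \<open>v\<close> for the flux, the equation becomes \<open>(F/x)' = g v/x\<^sup>2\<close>, \<open>v' = - \<lambda> x e\<^bsup>-x\<^sup>2\<^esup> F\<close>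
  with \<open>g = e\<^bsup>x\<^sup>2\<^esup>/\<Psi>\<close>. Its Picard iteration from the solution \<open>H\<close> for \<open>\<lambda> = 0\<close> is a power series in
  \<open>\<lambda>\<close>: \<open>sol_F\<close> is \<open>F\<close>, and \<open>v = v(0) - \<lambda> x\<^sup>2 sol_Q\<close>.\<close>

primrec ser_F :: "(complex \<Rightarrow> complex) \<Rightarrow> (complex \<Rightarrow> complex) \<Rightarrow> nat \<Rightarrow> complex \<Rightarrow> complex" where
  "ser_F g H 0 = H"
| "ser_F g H (Suc n) = (\<lambda>x. - x\<^sup>2 * ray_mean 0 (\<lambda>s. g s * ray_mean 1 (\<lambda>t. exp (- t\<^sup>2) * ser_F g H n t) s) x)"

definition ser_Q :: "(complex \<Rightarrow> complex) \<Rightarrow> (complex \<Rightarrow> complex) \<Rightarrow> nat \<Rightarrow> complex \<Rightarrow> complex" where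
  "ser_Q g H n = ray_mean 1 (\<lambda>t. exp (- t\<^sup>2) * ser_F g H n t)"

definition sol_F :: "(complex \<Rightarrow> complex) \<Rightarrow> (complex \<Rightarrow> complex) \<Rightarrow> complex \<Rightarrow> complex \<Rightarrow> complex" where
  "sol_F g H l x = (\<Sum>n. ser_F g H n x * l ^ n)"

definition sol_Q :: "(complex \<Rightarrow> complex) \<Rightarrow> (complex \<Rightarrow> complex) \<Rightarrow> complex \<Rightarrow> complex \<Rightarrow> complex" where
  "sol_Q g H l x = (\<Sum>n. ser_Q g H n x * l ^ n)"

lemma ser_F_Suc: "ser_F g H (Suc n) x = - x\<^sup>2 * ray_mean 0 (\<lambda>s. g s * ser_Q g H n s) x"
  by (simp add: ser_Q_def)

locale star_system = star_domain +
  fixes g H :: "complex \<Rightarrow> complex"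
  assumes g_hol: "g holomorphic_on S" and H_hol: "H holomorphic_on S"
begin

lemma ser_F_hol: "ser_F g H n holomorphic_on S"
proof (induction n)
  case 0
  then show ?case using H_hol by simp
next
  case (Suc n)
  then show ?case
    by (auto intro!: holomorphic_intros ray_mean_holomorphic g_hol)
qed

lemma ser_Q_hol: "ser_Q g H n holomorphic_on S"
  unfolding ser_Q_def by (intro ray_mean_holomorphic holomorphic_intros ser_F_hol)

definition ray_bounds :: "complex \<Rightarrow> real \<Rightarrow> real \<Rightarrow> real \<Rightarrow> real \<Rightarrow> bool" where
  "ray_bounds x A B G \<rho> \<longleftrightarrow> norm x \<le> \<rho> \<and> (\<forall>r. 0 \<le> r \<longrightarrow> r \<le> 1 \<longrightarrow>
     norm (H (of_real r * x)) \<le> A \<and> norm (exp (- (of_real r * x)\<^sup>2)) \<le> B \<and> norm (g (of_real r * x)) \<le> G)"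

lemma ray_bounds_nonneg:
  assumes "ray_bounds x A B G \<rho>"
  shows "0 \<le> A" "0 \<le> B" "0 \<le> G" "0 \<le> \<rho>"
proof -
  have "norm (H 0) \<le> A \<and> norm (exp (- 0\<^sup>2) :: complex) \<le> B \<and> norm (g 0) \<le> G \<and> norm x \<le> \<rho>"
    using assms unfolding ray_bounds_def by (auto dest!: spec[of _ 0])
  then show "0 \<le> A" "0 \<le> B" "0 \<le> G" "0 \<le> \<rho>"
    using norm_ge_zero order_trans by (blast, blast, blast, blast)
qed

text \<open>The bound on \<open>ser_F\<close> is a hypothesis with a free constant, so that the step
  serves inside the induction for \<open>ser_F_bound\<close> as well as after it.\<close>

lemma ser_Q_bound_step:
  assumes x: "x \<in> S" and b: "ray_bounds x A B G \<rho>"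
    and F: "\<And>r. 0 \<le> r \<Longrightarrow> r \<le> 1 \<Longrightarrow> norm (ser_F g H n (of_real r * x)) \<le> C * r ^ (2 * n)"
    and r: "0 \<le> r" "r \<le> 1"
  shows "norm (ser_Q g H n (of_real r * x)) \<le> B * C * r ^ (2 * n) / real (1 + 2 * n + 1)"
  unfolding ser_Q_def
proof (rule ray_mean_bound)
  show "continuous_on S (\<lambda>t. exp (- t\<^sup>2) * ser_F g H n t)"
    by (intro continuous_intros holomorphic_on_imp_continuous_on ser_F_hol)
  show "of_real r * x \<in> S" by (rule ray_mem[OF x r])
  fix r' :: real assume r': "0 \<le> r'" "r' \<le> 1"
  have rr: "0 \<le> r' * r" "r' * r \<le> 1" using r r' by (auto simp: mult_le_one)
  have "norm (exp (- (of_real (r' * r) * x)\<^sup>2)) \<le> B"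
    using b rr unfolding ray_bounds_def by blast
  moreover have "norm (ser_F g H n (of_real (r' * r) * x)) \<le> C * (r' * r) ^ (2 * n)"
    by (rule F[OF rr])
  ultimately have "norm (exp (- (of_real (r' * r) * x)\<^sup>2)) * norm (ser_F g H n (of_real (r' * r) * x))
      \<le> B * (C * (r' * r) ^ (2 * n))"
    using ray_bounds_nonneg[OF b] by (intro mult_mono) auto
  then show "norm (exp (- (of_real r' * (of_real r * x))\<^sup>2) * ser_F g H n (of_real r' * (of_real r * x)))
      \<le> B * C * r ^ (2 * n) * r' ^ (2 * n)"
    by (simp add: norm_mult power_mult_distrib mult_ac)
qed

text \<open>One Picard step brings x^2, hence r^2, and the two averages over r^(2n) bring
  1/((2n+2)(2n+1)), of which only 1/(n+1) is kept. That already produces n!, so the series converges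
  for every spectral parameter.\<close>

lemma ser_F_bound:
  assumes x: "x \<in> S" and b: "ray_bounds x A B G \<rho>" and r: "0 \<le> r" "r \<le> 1"
  shows "norm (ser_F g H n (of_real r * x)) \<le> A * ((G * B * \<rho>\<^sup>2) ^ n / fact n) * r ^ (2 * n)"
  using r
proof (induction n arbitrary: r)
  case 0
  then show ?case using b by (auto simp: ray_bounds_def)
next
  case (Suc n)
  note nn = ray_bounds_nonneg[OF b]
  define C where "C = A * ((G * B * \<rho>\<^sup>2) ^ n / fact n)"
  have C0: "0 \<le> C" unfolding C_def using nn by simp
  have IH: "norm (ser_F g H n (of_real r * x)) \<le> C * r ^ (2 * n)" if "0 \<le> r" "r \<le> 1" for r
    unfolding C_def by (rule Suc.IH[OF that])
  have "norm (ray_mean 0 (\<lambda>s. g s * ser_Q g H n s) (of_real r * x))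
      \<le> G * (B * C * r ^ (2 * n) / real (1 + 2 * n + 1)) / real (0 + 2 * n + 1)"
  proof (rule ray_mean_bound)
    show "continuous_on S (\<lambda>s. g s * ser_Q g H n s)"
      by (intro continuous_intros holomorphic_on_imp_continuous_on ser_Q_hol g_hol)
    show "of_real r * x \<in> S" using ray_mem x Suc.prems by blast
    fix r' :: real assume r': "0 \<le> r'" "r' \<le> 1"
    have rr: "0 \<le> r' * r" "r' * r \<le> 1" using Suc.prems r' by (auto simp: mult_le_one)
    have "norm (g (of_real (r' * r) * x)) \<le> G"
      using b rr unfolding ray_bounds_def by blast
    moreover have "norm (ser_Q g H n (of_real (r' * r) * x)) \<le> B * C * (r' * r) ^ (2 * n) / real (1 + 2 * n + 1)"
      by (rule ser_Q_bound_step[OF x b IH rr])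
    ultimately have "norm (g (of_real (r' * r) * x)) * norm (ser_Q g H n (of_real (r' * r) * x))
        \<le> G * (B * C * (r' * r) ^ (2 * n) / real (1 + 2 * n + 1))"
      using nn by (intro mult_mono) auto
    then show "norm (g (of_real r' * (of_real r * x)) * ser_Q g H n (of_real r' * (of_real r * x)))
      \<le> G * (B * C * r ^ (2 * n) / real (1 + 2 * n + 1)) * r' ^ (2 * n)"
      by (simp add: norm_mult power_mult_distrib mult_ac)
  qed
  also have "\<dots> = G * B * C * r ^ (2 * n) / (real (2 * n + 2) * real (2 * n + 1))"
    by simp
  also have "\<dots> \<le> G * B * C * r ^ (2 * n) / (real (Suc n) * 1)"
    by (rule divide_left_mono, rule mult_mono) (use nn C0 Suc.prems in auto)
  finally have q: "norm (ray_mean 0 (\<lambda>s. g s * ser_Q g H n s) (of_real r * x)) \<le> G * B * C * r ^ (2 * n) / real (Suc n)"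
    by simp
  have "norm (ser_F g H (Suc n) (of_real r * x))
      = (r * norm x)\<^sup>2 * norm (ray_mean 0 (\<lambda>s. g s * ser_Q g H n s) (of_real r * x))"
    using Suc.prems unfolding ser_F_Suc by (simp add: norm_mult norm_power)
  also have "\<dots> \<le> (r * \<rho>)\<^sup>2 * (G * B * C * r ^ (2 * n) / real (Suc n))"
    using b q Suc.prems nn unfolding ray_bounds_def
    by (intro mult_mono power_mono) auto
  also have "\<dots> = A * ((G * B * \<rho>\<^sup>2) ^ Suc n / fact (Suc n)) * r ^ (2 * Suc n)"
    by (simp add: C_def power_mult_distrib power2_eq_square mult_ac)
  finally show ?case .
qed

lemma ser_bounds:
  assumes x: "x \<in> S" and b: "ray_bounds x A B G \<rho>" and r: "0 \<le> r" "r \<le> 1"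
  shows "norm (ser_F g H n (of_real r * x)) \<le> A * ((G * B * \<rho>\<^sup>2) ^ n / fact n)"
    and "norm (ser_Q g H n (of_real r * x)) \<le> B * (A * ((G * B * \<rho>\<^sup>2) ^ n / fact n))"
proof -
  note nn = ray_bounds_nonneg[OF b]
  define C where "C = A * ((G * B * \<rho>\<^sup>2) ^ n / fact n)"
  have C0: "0 \<le> C" unfolding C_def using nn by simp
  have r1: "r ^ (2 * n) \<le> 1" using r by (simp add: power_le_one)
  have F: "norm (ser_F g H n (of_real r * x)) \<le> C * r ^ (2 * n)" if "0 \<le> r" "r \<le> 1" for r
    using ser_F_bound[OF x b that] by (simp add: C_def)
  have "C * r ^ (2 * n) \<le> C" using mult_left_mono[OF r1 C0] by simp
  then show "norm (ser_F g H n (of_real r * x)) \<le> A * ((G * B * \<rho>\<^sup>2) ^ n / fact n)"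
    using F[OF r] by (simp add: C_def)
  have "norm (ser_Q g H n (of_real r * x)) \<le> B * C * r ^ (2 * n) / real (1 + 2 * n + 1)"
    by (rule ser_Q_bound_step[OF x b F r])
  also have "\<dots> \<le> B * C * 1 / 1"
    by (intro frac_le mult_left_mono r1) (use nn C0 in auto)
  finally show "norm (ser_Q g H n (of_real r * x)) \<le> B * (A * ((G * B * \<rho>\<^sup>2) ^ n / fact n))"
    by (simp add: C_def)
qed

text \<open>The segments from 0 to the points of a closed ball fill a compact subset of S, so one
  set of constants serves the whole ball; this makes the convergence in x locally uniform.\<close>

lemma local_ray_bounds:
  assumes "x0 \<in> S"
  obtains d A B G \<rho> where "d > 0" "cball x0 d \<subseteq> S" "\<And>x. x \<in> cball x0 d \<Longrightarrow> ray_bounds x A B G \<rho>"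
proof -
  obtain d where d: "d > 0" "cball x0 d \<subseteq> S"
    using assms open_S open_contains_cball by blast
  define K where "K = (\<lambda>(r, x). of_real r * x) ` ({0..1::real} \<times> cball x0 d)"
  have K: "compact K" unfolding K_def split_beta
    by (intro compact_continuous_image continuous_intros compact_Times) auto
  have KS: "K \<subseteq> S" unfolding K_def using d ray_mem by auto
  have bd: "\<exists>C. \<forall>s\<in>K. norm (f s) \<le> C" if "continuous_on S f" for f :: "complex \<Rightarrow> complex"
    using compact_imp_bounded[OF compact_continuous_image[OF continuous_on_subset[OF that KS] K]]
    by (auto simp: bounded_iff)
  obtain A where A: "\<And>s. s \<in> K \<Longrightarrow> norm (H s) \<le> A"
    using bd[OF holomorphic_on_imp_continuous_on[OF H_hol]] by blast
  have "continuous_on S (\<lambda>s. exp (- s\<^sup>2))" by (intro continuous_intros)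
  from bd[OF this] obtain B where B: "\<And>s. s \<in> K \<Longrightarrow> norm (exp (- s\<^sup>2)) \<le> B" by blast
  obtain G where G: "\<And>s. s \<in> K \<Longrightarrow> norm (g s) \<le> G"
    using bd[OF holomorphic_on_imp_continuous_on[OF g_hol]] by blast
  have "ray_bounds x A B G (norm x0 + d)" if x: "x \<in> cball x0 d" for x
  proof -
    have "norm x \<le> norm x0 + d"
      using x norm_triangle_sub[of x x0] by (simp add: dist_norm norm_minus_commute)
    moreover have "of_real r * x \<in> K" if "0 \<le> r" "r \<le> 1" for r
      using x that unfolding K_def by auto
    ultimately show ?thesis unfolding ray_bounds_def using A B G by blast
  qed
  then show ?thesis using that d by blast
qed

lemma maj_summable: "summable (\<lambda>n. A * (c ^ n / fact n) * (l::real) ^ n)"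
proof -
  have "summable (\<lambda>n. A * (inverse (fact n) * (c * l) ^ n))"
    by (intro summable_mult summable_exp)
  then show ?thesis by (simp add: power_mult_distrib field_simps)
qed

lemma sol_uniform:
  assumes "x0 \<in> S"
  shows "\<exists>d>0. cball x0 d \<subseteq> S \<and>
     uniform_limit (cball x0 d) (\<lambda>N x. \<Sum>n<N. ser_F g H n x * l ^ n) (sol_F g H l) sequentially \<and>
     uniform_limit (cball x0 d) (\<lambda>N x. \<Sum>n<N. ser_Q g H n x * l ^ n) (sol_Q g H l) sequentially"
proof -
  obtain d A B G \<rho> where d: "d > 0" "cball x0 d \<subseteq> S" and b: "\<And>x. x \<in> cball x0 d \<Longrightarrow> ray_bounds x A B G \<rho>"
    using local_ray_bounds[OF assms] by metis
  have "uniform_limit (cball x0 d) (\<lambda>N x. \<Sum>n<N. ser_F g H n x * l ^ n) (sol_F g H l) sequentially"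
    unfolding sol_F_def[abs_def]
  proof (rule Weierstrass_m_test[OF _ maj_summable])
    fix n x assume x: "x \<in> cball x0 d"
    show "norm (ser_F g H n x * l ^ n) \<le> A * ((G * B * \<rho>\<^sup>2) ^ n / fact n) * norm l ^ n"
      unfolding norm_mult norm_power
      using ser_bounds(1)[OF _ b[OF x], of 1] x d by (intro mult_right_mono) auto
  qed
  moreover have "uniform_limit (cball x0 d) (\<lambda>N x. \<Sum>n<N. ser_Q g H n x * l ^ n) (sol_Q g H l) sequentially"
    unfolding sol_Q_def[abs_def]
  proof (rule Weierstrass_m_test[OF _ maj_summable])
    fix n x assume x: "x \<in> cball x0 d"
    show "norm (ser_Q g H n x * l ^ n) \<le> (B * A) * ((G * B * \<rho>\<^sup>2) ^ n / fact n) * norm l ^ n"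
      unfolding norm_mult norm_power
      using ser_bounds(2)[OF _ b[OF x], of 1] x d by (intro mult_right_mono) (auto simp: mult_ac)
  qed
  ultimately show ?thesis using d by blast
qed

lemma sol_F_hol: "sol_F g H l holomorphic_on S"
proof (rule holomorphic_uniform_sequence[OF open_S])
  show "(\<lambda>x. \<Sum>n<N. ser_F g H n x * l ^ n) holomorphic_on S" for N
    by (intro holomorphic_intros ser_F_hol)
  show "\<exists>d>0. cball x d \<subseteq> S \<and>
     uniform_limit (cball x d) (\<lambda>N x. \<Sum>n<N. ser_F g H n x * l ^ n) (sol_F g H l) sequentially"
    if "x \<in> S" for x using sol_uniform[OF that] by blast
qed

lemma sol_Q_hol: "sol_Q g H l holomorphic_on S"
proof (rule holomorphic_uniform_sequence[OF open_S])
  show "(\<lambda>x. \<Sum>n<N. ser_Q g H n x * l ^ n) holomorphic_on S" for N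
    by (intro holomorphic_intros ser_Q_hol)
  show "\<exists>d>0. cball x d \<subseteq> S \<and>
     uniform_limit (cball x d) (\<lambda>N x. \<Sum>n<N. ser_Q g H n x * l ^ n) (sol_Q g H l) sequentially"
    if "x \<in> S" for x using sol_uniform[OF that] by blast
qed

lemma sol_sums:
  assumes "x \<in> S"
  shows "(\<lambda>n. ser_F g H n x * l ^ n) sums sol_F g H l x"
    and "(\<lambda>n. ser_Q g H n x * l ^ n) sums sol_Q g H l x"
proof -
  obtain d where "d > 0" 
    and u: "uniform_limit (cball x d) (\<lambda>N x. \<Sum>n<N. ser_F g H n x * l ^ n) (sol_F g H l) sequentially"
     "uniform_limit (cball x d) (\<lambda>N x. \<Sum>n<N. ser_Q g H n x * l ^ n) (sol_Q g H l) sequentially"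
    using sol_uniform[OF assms] by blast
  then have x: "x \<in> cball x d" by simp
  show "(\<lambda>n. ser_F g H n x * l ^ n) sums sol_F g H l x"
    unfolding sums_def by (rule tendsto_uniform_limitI[OF u(1) x])
  show "(\<lambda>n. ser_Q g H n x * l ^ n) sums sol_Q g H l x"
    unfolding sums_def by (rule tendsto_uniform_limitI[OF u(2) x])
qed

text \<open>For fixed x the sums are power series in l that converge for every l.\<close>

lemma sol_param_hol:
  assumes "x \<in> S"
  shows "(\<lambda>l. sol_F g H l x) holomorphic_on UNIV" "(\<lambda>l. sol_Q g H l x) holomorphic_on UNIV"
proof -
  have "(\<lambda>l. sol_F g H l x) holomorphic_on ball 0 r" "(\<lambda>l. sol_Q g H l x) holomorphic_on ball 0 r" for r
    using sol_sums[OF assms] by (auto intro!: power_series_holomorphic)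
  moreover have "open (UNIV :: complex set)" by simp
  ultimately show "(\<lambda>l. sol_F g H l x) holomorphic_on UNIV" "(\<lambda>l. sol_Q g H l x) holomorphic_on UNIV"
    unfolding holomorphic_on_def
    by (metis UNIV_I at_within_open dist_0_norm less_add_one mem_ball open_ball)+
qed

section \<open>Integral and differential equations for the sums\<close>

lemma sol_Q_eq:
  assumes "x \<in> S"
  shows "sol_Q g H l x = ray_mean 1 (\<lambda>t. exp (- t\<^sup>2) * sol_F g H l t) x"
proof -
  obtain d A B G \<rho> where "d > 0" and b: "\<And>y. y \<in> cball x d \<Longrightarrow> ray_bounds y A B G \<rho>"
    using local_ray_bounds[OF assms] by metis
  then have b: "ray_bounds x A B G \<rho>" by simp
  have eq: "(\<Sum>n. exp (- s\<^sup>2) * ser_F g H n s * l ^ n) = exp (- s\<^sup>2) * sol_F g H l s" if "s \<in> S" for s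
    using sums_mult[OF sol_sums(1)[OF that], of "exp (- s\<^sup>2)"] by (simp add: sums_iff mult_ac)
  have cont: "continuous_on S (\<lambda>s. \<Sum>n. exp (- s\<^sup>2) * ser_F g H n s * l ^ n)"
    by (subst continuous_on_cong[OF refl eq])
       (auto intro!: holomorphic_intros holomorphic_on_imp_continuous_on sol_F_hol)
  have "(\<lambda>n. ray_mean 1 (\<lambda>s. exp (- s\<^sup>2) * ser_F g H n s * l ^ n) x) sums
      ray_mean 1 (\<lambda>s. \<Sum>n. exp (- s\<^sup>2) * ser_F g H n s * l ^ n) x"
  proof (rule ray_mean_sums[OF _ assms _ maj_summable cont])
    show "continuous_on S (\<lambda>s. exp (- s\<^sup>2) * ser_F g H n s * l ^ n)" for n
      by (intro continuous_intros holomorphic_on_imp_continuous_on ser_F_hol)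
    fix n and r :: real assume r: "0 \<le> r" "r \<le> 1"
    have "norm (exp (- (of_real r * x)\<^sup>2)) \<le> B" using b r unfolding ray_bounds_def by blast
    then have "norm (exp (- (of_real r * x)\<^sup>2)) * norm (ser_F g H n (of_real r * x)) \<le>
         B * (A * ((G * B * \<rho>\<^sup>2) ^ n / fact n))"
      using ser_bounds(1)[OF assms b r, of n] ray_bounds_nonneg[OF b] by (intro mult_mono) auto
    then show "norm (exp (- (of_real r * x)\<^sup>2) * ser_F g H n (of_real r * x) * l ^ n) \<le>
         (B * A) * ((G * B * \<rho>\<^sup>2) ^ n / fact n) * norm l ^ n"
      unfolding norm_mult norm_power by (intro mult_right_mono) (auto simp: mult_ac)
  qed
  moreover have "ray_mean 1 (\<lambda>s. exp (- s\<^sup>2) * ser_F g H n s * l ^ n) x = ser_Q g H n x * l ^ n" for n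
    unfolding ser_Q_def ray_mean_def
    by (simp add: mult.assoc[symmetric] del: integral_mult_right flip: integral_mult_left)
  moreover have "ray_mean 1 (\<lambda>s. \<Sum>n. exp (- s\<^sup>2) * ser_F g H n s * l ^ n) x =
       ray_mean 1 (\<lambda>t. exp (- t\<^sup>2) * sol_F g H l t) x"
    unfolding ray_mean_def by (rule integral_cong) (use eq ray_mem assms in auto)
  ultimately show ?thesis using sol_sums(2)[OF assms] sums_unique2 by (metis (no_types, lifting) sums_cong)
qed

text \<open>Applying the Picard operator term by term shifts the index by one; the zeroth term
  \<open>H\<close> completes the integral equation.\<close>

lemma sol_F_eq:
  assumes "x \<in> S"
  shows "sol_F g H l x = H x - l * x\<^sup>2 * ray_mean 0 (\<lambda>t. g t * sol_Q g H l t) x"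
proof -
  obtain d A B G \<rho> where "d > 0" and b: "\<And>y. y \<in> cball x d \<Longrightarrow> ray_bounds y A B G \<rho>"
    using local_ray_bounds[OF assms] by metis
  then have b: "ray_bounds x A B G \<rho>" by simp
  have eq: "(\<Sum>n. g s * ser_Q g H n s * l ^ n) = g s * sol_Q g H l s" if "s \<in> S" for s
    using sums_mult[OF sol_sums(2)[OF that], of "g s"] by (simp add: sums_iff mult_ac)
  have cont: "continuous_on S (\<lambda>s. \<Sum>n. g s * ser_Q g H n s * l ^ n)"
    by (subst continuous_on_cong[OF refl eq])
       (auto intro!: holomorphic_intros holomorphic_on_imp_continuous_on sol_Q_hol g_hol)
  have "(\<lambda>n. ray_mean 0 (\<lambda>s. g s * ser_Q g H n s * l ^ n) x) sums
      ray_mean 0 (\<lambda>s. \<Sum>n. g s * ser_Q g H n s * l ^ n) x"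
  proof (rule ray_mean_sums[OF _ assms _ maj_summable cont])
    show "continuous_on S (\<lambda>s. g s * ser_Q g H n s * l ^ n)" for n
      by (intro continuous_intros holomorphic_on_imp_continuous_on ser_Q_hol g_hol)
    fix n and r :: real assume r: "0 \<le> r" "r \<le> 1"
    have "norm (g (of_real r * x)) \<le> G" using b r unfolding ray_bounds_def by blast
    then have "norm (g (of_real r * x)) * norm (ser_Q g H n (of_real r * x)) \<le>
         G * (B * (A * ((G * B * \<rho>\<^sup>2) ^ n / fact n)))"
      using ser_bounds(2)[OF assms b r, of n] ray_bounds_nonneg[OF b] by (intro mult_mono) auto
    then show "norm (g (of_real r * x) * ser_Q g H n (of_real r * x) * l ^ n) \<le>
         (G * B * A) * ((G * B * \<rho>\<^sup>2) ^ n / fact n) * norm l ^ n"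
      unfolding norm_mult norm_power by (intro mult_right_mono) (auto simp: mult_ac)
  qed
  moreover have "ray_mean 0 (\<lambda>s. g s * ser_Q g H n s * l ^ n) x = ray_mean 0 (\<lambda>s. g s * ser_Q g H n s) x * l ^ n" for n
    unfolding ray_mean_def
    by (simp add: mult.assoc[symmetric] del: integral_mult_right flip: integral_mult_left)
  moreover have "ray_mean 0 (\<lambda>s. \<Sum>n. g s * ser_Q g H n s * l ^ n) x =
       ray_mean 0 (\<lambda>t. g t * sol_Q g H l t) x"
    unfolding ray_mean_def by (rule integral_cong) (use eq ray_mem assms in auto)
  ultimately have "(\<lambda>n. ray_mean 0 (\<lambda>s. g s * ser_Q g H n s) x * l ^ n) sums
       ray_mean 0 (\<lambda>t. g t * sol_Q g H l t) x" by simp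
  from sums_mult[OF this, of "- x\<^sup>2 * l"]
  have "(\<lambda>n. ser_F g H (Suc n) x * l ^ Suc n) sums (- l * x\<^sup>2 * ray_mean 0 (\<lambda>t. g t * sol_Q g H l t) x)"
    unfolding ser_F_Suc by (simp add: mult_ac)
  then have "(\<lambda>n. ser_F g H n x * l ^ n) sums
      (- l * x\<^sup>2 * ray_mean 0 (\<lambda>t. g t * sol_Q g H l t) x + ser_F g H 0 x * l ^ 0)"
    by (rule sums_Suc)
  then have "(\<lambda>n. ser_F g H n x * l ^ n) sums (- l * x\<^sup>2 * ray_mean 0 (\<lambda>t. g t * sol_Q g H l t) x + H x)"
    by simp
  from sums_unique2[OF sol_sums(1)[OF assms] this] show ?thesis by simp
qed

lemma sol_Q_deriv:
  assumes "x \<in> S"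
  shows "((\<lambda>x. x\<^sup>2 * sol_Q g H l x) has_field_derivative x * exp (- x\<^sup>2) * sol_F g H l x) (at x)"
proof -
  have "((\<lambda>x. x ^ Suc 1 * ray_mean 1 (\<lambda>t. exp (- t\<^sup>2) * sol_F g H l t) x) has_field_derivative
      x ^ 1 * (exp (- x\<^sup>2) * sol_F g H l x)) (at x)"
    by (rule ray_mean_deriv[OF _ assms]) (intro holomorphic_intros sol_F_hol)
  then have "((\<lambda>x. x ^ Suc 1 * ray_mean 1 (\<lambda>t. exp (- t\<^sup>2) * sol_F g H l t) x) has_field_derivative
      x * exp (- x\<^sup>2) * sol_F g H l x) (at x)" by (simp add: mult.assoc)
  then show ?thesis
    by (rule has_field_derivative_transform_within_open[OF _ open_S assms])
       (simp add: sol_Q_eq power2_eq_square)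
qed

text \<open>The hypothesis on \<open>H\<close> is the equation for l = 0 with constant flux
  \<open>v0\<close>; the Picard correction turns this flux into the one in the conclusion.\<close>

lemma sol_F_deriv:
  assumes x: "x \<in> S" "x \<noteq> 0" and H: "(H has_field_derivative (H x + g x * v0) / x) (at x)"
  shows "(sol_F g H l has_field_derivative
     (sol_F g H l x + g x * (v0 - l * x\<^sup>2 * sol_Q g H l x)) / x) (at x)"
proof -
  define R where "R = (\<lambda>x. x ^ Suc 0 * ray_mean 0 (\<lambda>t. g t * sol_Q g H l t) x)"
  have R: "(R has_field_derivative x ^ 0 * (g x * sol_Q g H l x)) (at x)"
    unfolding R_def by (rule ray_mean_deriv[OF _ x(1)]) (intro holomorphic_intros sol_Q_hol g_hol)
  have F: "sol_F g H l s = H s - l * s * R s" if "s \<in> S" for s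
    using sol_F_eq[OF that] by (simp add: R_def power2_eq_square mult_ac)
  have "((\<lambda>s. H s - l * s * R s) has_field_derivative
     (sol_F g H l x + g x * (v0 - l * x\<^sup>2 * sol_Q g H l x)) / x) (at x)"
    using x by (auto intro!: derivative_eq_intros H R simp: F field_simps power2_eq_square)
  then show ?thesis
    by (rule has_field_derivative_transform_within_open[OF _ open_S x(1)]) (simp add: F)
qed

text \<open>Averages along rays commute with the reflection x to -x, so every iterate inherits the
  symmetry of \<open>g\<close> and \<open>H\<close>.\<close>

lemma ser_even:
  assumes g: "\<And>x. x \<in> S \<Longrightarrow> g (- x) = g x" and H: "\<And>x. x \<in> S \<Longrightarrow> H (- x) = H x" and x: "x \<in> S"
  shows "ser_F g H n (- x) = ser_F g H n x" "ser_Q g H n (- x) = ser_Q g H n x"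
proof -
  have Q: "ser_Q g H n (- x) = ser_Q g H n x"
    if "\<And>x. x \<in> S \<Longrightarrow> ser_F g H n (- x) = ser_F g H n x" "x \<in> S" for n x
    unfolding ser_Q_def by (rule ray_mean_even) (use that ray_mem in auto)
  have F: "ser_F g H n (- x) = ser_F g H n x" if "x \<in> S" for n x
    using that
  proof (induction n arbitrary: x)
    case 0
    then show ?case using H by simp
  next
    case (Suc n)
    have "ray_mean 0 (\<lambda>s. g s * ser_Q g H n s) (- x) = ray_mean 0 (\<lambda>s. g s * ser_Q g H n s) x"
      by (rule ray_mean_even) (use Suc Q g ray_mem in auto)
    then show ?case unfolding ser_F_Suc by simp
  qed
  show "ser_F g H n (- x) = ser_F g H n x" "ser_Q g H n (- x) = ser_Q g H n x"
    using F Q x by auto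
qed

lemma sol_even:
  assumes "\<And>x. x \<in> S \<Longrightarrow> g (- x) = g x" "\<And>x. x \<in> S \<Longrightarrow> H (- x) = H x" "x \<in> S"
  shows "sol_F g H l (- x) = sol_F g H l x" "sol_Q g H l (- x) = sol_Q g H l x"
  unfolding sol_F_def sol_Q_def using ser_even[OF assms] by auto

end

section \<open>The complexified coefficient\<close>

lemma erf_deriv: "(erf has_real_derivative 2 / sqrt pi * exp (- x\<^sup>2)) (at x)"
proof -
  \<comment> \<open>The margin 1 makes x an interior point of an interval that also contains 0, so
    the derivative within the interval is the full one.\<close>
  define a b where "a = min 0 x - 1" and "b = max 0 x + 1"
  have ab: "a \<le> 0" "0 \<le> b" "a < x" "x < b" by (auto simp: a_def b_def)
  have "((\<lambda>u. LBINT s=ereal 0..ereal u. exp (- s\<^sup>2)) has_vector_derivative exp (- x\<^sup>2)) (at x within {a..b})"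
    by (rule interval_integral_FTC2[OF ab(1,2)]) (use ab in \<open>auto intro!: continuous_intros\<close>)
  moreover have "at x within {a..b} = at x" using ab by (intro at_within_interior) simp
  ultimately have "((\<lambda>u. LBINT s=ereal 0..ereal u. exp (- s\<^sup>2)) has_real_derivative exp (- x\<^sup>2)) (at x)"
    by (simp add: has_real_derivative_iff_has_vector_derivative)
  from DERIV_cmult[OF this, of "2 / sqrt pi"] show ?thesis
    by (simp add: erf_def[abs_def])
qed

text \<open>The integral of \<open>s\<^sup>2 e\<^bsup>-s\<^sup>2\<^esup>\<close> from \<open>0\<close> to \<open>x\<close>.\<close>

definition gauss2 :: "real \<Rightarrow> real" where
  "gauss2 x = sqrt pi / 4 * (erf x - 2 / sqrt pi * x * exp (- (x\<^sup>2)))"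

lemma gauss2_deriv: "(gauss2 has_real_derivative x\<^sup>2 * exp (- x\<^sup>2)) (at x)"
proof -
  have "((\<lambda>x. s / 4 * (erf x - 2 / s * x * exp (- (x\<^sup>2)))) has_real_derivative x\<^sup>2 * exp (- x\<^sup>2)) (at x)"
    if "s \<noteq> 0" and "(erf has_real_derivative 2 / s * exp (- x\<^sup>2)) (at x)" for s
    using that by (auto intro!: derivative_eq_intros simp: field_simps power2_eq_square)
  from this[OF _ erf_deriv] show ?thesis
    unfolding gauss2_def[abs_def] by simp
qed

lemma gauss2_0 [simp]: "gauss2 0 = 0"
  by (simp add: gauss2_def erf_def)

lemma Psi_gauss2: "x \<noteq> 0 \<Longrightarrow> Psi x = 2 / sqrt pi * gauss2 x / x ^ 3"
  by (simp add: Psi_def gauss2_def field_simps)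

text \<open>Integration by parts: the difference of the two sides has the derivative (2/3) t^4
  e^(-t^2).\<close>

lemma gauss2_lower: "0 \<le> x \<Longrightarrow> x ^ 3 * exp (- x\<^sup>2) / 3 \<le> gauss2 x"
proof -
  assume x: "0 \<le> x"
  let ?h = "\<lambda>x::real. gauss2 x - x ^ 3 * exp (- x\<^sup>2) / 3"
  have "\<exists>y. (?h has_real_derivative y) (at t) \<and> 0 \<le> y" for t
  proof (intro exI conjI)
    show "(?h has_real_derivative 2 / 3 * (t\<^sup>2)\<^sup>2 * exp (- t\<^sup>2)) (at t)"
      by (auto intro!: derivative_eq_intros gauss2_deriv simp: field_simps power2_eq_square eval_nat_numeral)
  qed simp
  from DERIV_nonneg_imp_nondecreasing[OF x, of ?h] this show ?thesis by simp
qed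

lemma gauss2_mono: "x \<le> y \<Longrightarrow> gauss2 x \<le> gauss2 y"
  by (rule DERIV_nonneg_imp_nondecreasing[where f = gauss2]) (auto intro!: exI gauss2_deriv)

lemma gauss2_pos: "0 < x \<Longrightarrow> 0 < gauss2 x"
  using gauss2_lower[of x] by (smt (verit) divide_pos_pos exp_gt_zero mult_pos_pos zero_less_power)

lemma gauss2_ge: "1 \<le> x \<Longrightarrow> 1 / 9 \<le> gauss2 x"
proof -
  assume x: "1 \<le> x"
  have "exp 1 \<le> (3::real)" by (rule exp_le)
  then have "1 / 9 \<le> exp (- 1) / (3::real)" by (simp add: exp_minus field_simps)
  also have "\<dots> \<le> gauss2 1" using gauss2_lower[of 1] by simp
  also have "\<dots> \<le> gauss2 x" by (rule gauss2_mono[OF x])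
  finally show ?thesis .
qed

text \<open>Compares the integrand with 4 e^(-t), whose integral over the half-line is 4. This bound
  keeps 1/(x \<Psi>) above a fixed multiple of x^2.\<close>

lemma gauss2_le: "0 \<le> x \<Longrightarrow> gauss2 x \<le> 4"
proof -
  assume x: "0 \<le> x"
  let ?h = "\<lambda>x::real. - 4 * exp (- x) - gauss2 x"
  have "\<exists>y. (?h has_real_derivative y) (at t) \<and> 0 \<le> y" for t
  proof (intro exI conjI)
    show "(?h has_real_derivative 4 * exp (- t) - t\<^sup>2 * exp (- t\<^sup>2)) (at t)"
      by (auto intro!: derivative_eq_intros gauss2_deriv)
    have "t\<^sup>2 \<le> 4 * (1 + (t\<^sup>2 - t))"
    proof -
      \<comment> \<open>Three times the gap between the two sides is (3 t - 2)^2 + 8.\<close>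
      have "0 \<le> (3 * t - 2)\<^sup>2" by simp
      then show ?thesis by (simp add: power2_eq_square algebra_simps)
    qed
    also have "\<dots> \<le> 4 * exp (t\<^sup>2 - t)"
      by (intro mult_left_mono exp_ge_add_one_self) simp
    finally have "t\<^sup>2 \<le> 4 * exp (t\<^sup>2 - t)" .
    then have "t\<^sup>2 * exp (- t\<^sup>2) \<le> 4 * exp (t\<^sup>2 - t) * exp (- t\<^sup>2)"
      by (intro mult_right_mono) auto
    also have "\<dots> = 4 * exp (- t)" by (simp add: mult_exp_exp mult.assoc)
    finally show "0 \<le> 4 * exp (- t) - t\<^sup>2 * exp (- t\<^sup>2)" by simp
  qed
  from DERIV_nonneg_imp_nondecreasing[OF x, of ?h] this have "- 4 \<le> ?h x" by simp
  moreover have "0 < exp (- x)" by simp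
  ultimately show ?thesis by linarith
qed

lemma Psi_pos: "0 < x \<Longrightarrow> 0 < Psi x"
  by (simp add: Psi_gauss2 gauss2_pos)

section \<open>The entire extension of \<Psi> and its zero-free wedge\<close>

lemma star_UNIV: "star_domain UNIV"
  by unfold_locales auto

text \<open>The integral of s^2 e^(-s^2) divided by x^3, written as an average so that the removable
  singularity of \<Psi> at 0 is filled from the start.\<close>

definition CPsi :: "complex \<Rightarrow> complex" where
  "CPsi x = of_real (2 / sqrt pi) * ray_mean 2 (\<lambda>s. exp (- s\<^sup>2)) x"

definition CI :: "complex \<Rightarrow> complex" where
  "CI x = x ^ 3 * ray_mean 2 (\<lambda>s. exp (- s\<^sup>2)) x"

lemma CI_deriv: "(CI has_field_derivative x\<^sup>2 * exp (- x\<^sup>2)) (at x)"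
  using star_domain.ray_mean_deriv[OF star_UNIV, of "\<lambda>s. exp (- s\<^sup>2)" x 2]
  by (simp add: CI_def[abs_def] holomorphic_intros eval_nat_numeral)

lemma CPsi_CI: "x \<noteq> 0 \<Longrightarrow> CPsi x = of_real (2 / sqrt pi) * CI x / x ^ 3"
  by (simp add: CPsi_def CI_def)

lemma CPsi_hol: "CPsi holomorphic_on A"
proof -
  have "CPsi holomorphic_on UNIV" unfolding CPsi_def[abs_def]
    by (intro holomorphic_intros star_domain.ray_mean_holomorphic[OF star_UNIV])
  then show ?thesis by (rule holomorphic_on_subset) simp
qed

lemma CPsi_even: "CPsi (- x) = CPsi x"
  unfolding CPsi_def by (subst ray_mean_even) auto

text \<open>Both sides have the same derivative on the real line and vanish at 0.\<close>

lemma CI_of_real: "CI (of_real x) = of_real (gauss2 x)"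
proof -
  have "((\<lambda>x. CI (of_real x) - of_real (gauss2 x)) has_vector_derivative 0) (at x within UNIV)" for x
  proof -
    have "((\<lambda>x. CI (of_real x)) has_vector_derivative of_real (x\<^sup>2 * exp (- x\<^sup>2))) (at x)"
      using has_vector_derivative_real_field[of CI "(of_real x)\<^sup>2 * exp (- (of_real x)\<^sup>2)" x UNIV] CI_deriv
      by (simp add: exp_of_real[symmetric])
    moreover have "((\<lambda>x. complex_of_real (gauss2 x)) has_vector_derivative of_real (x\<^sup>2 * exp (- x\<^sup>2))) (at x)"
      by (rule has_vector_derivative_of_real) (use gauss2_deriv has_real_derivative_iff_has_vector_derivative in blast)
    ultimately show ?thesis
      using has_vector_derivative_diff by fastforce
  qed
  then obtain c where c: "\<And>x. CI (of_real x) - of_real (gauss2 x) = c"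
    using has_vector_derivative_zero_constant[of UNIV "\<lambda>x. CI (of_real x) - of_real (gauss2 x)"] by auto
  from c[of 0] have "c = 0" by (simp add: CI_def)
  with c[of x] show ?thesis by simp
qed

lemma CPsi_of_real: "0 < x \<Longrightarrow> CPsi (of_real x) = of_real (Psi x)"
  by (simp add: CPsi_CI CI_of_real Psi_gauss2)

lemma CPsi_0_eq: "CPsi 0 = of_real (2 / (3 * sqrt pi))"
proof -
  have "1 ^ Suc 2 * ray_mean 2 (\<lambda>_. 1) 1 = 1 ^ 3 / 3 - 0 ^ 3 / (3::complex)"
    by (rule star_domain.ray_mean_eq[OF star_UNIV, where p = "\<lambda>x. x ^ 3 / 3"])
       (auto intro!: derivative_eq_intros)
  then have "ray_mean 2 (\<lambda>s. exp (- s\<^sup>2)) 0 = 1 / 3" by (simp add: ray_mean_def)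
  then have "CPsi 0 = of_real (2 / sqrt pi) * (1 / 3)" unfolding CPsi_def by (simp only:)
  then show ?thesis by simp
qed

lemma CPsi_0: "CPsi 0 \<noteq> 0"
  by (simp add: CPsi_0_eq)

text \<open>Integrates z^2 e^(-z^2) along the vertical segment from a = Re x to x = a + i b. There
  |z|^2 \<le> 1.01 a^2 and |e^(-z^2)| \<le> e^(b^2 - a^2), and the length is at most a/10; hence
  101/1000.\<close>

lemma CI_diff:
  assumes "0 < Re x" "\<bar>Im x\<bar> \<le> Re x / 10"
  shows "norm (CI x - of_real (gauss2 (Re x))) \<le> 101 / 1000 * Re x ^ 3 * exp ((Im x)\<^sup>2 - (Re x)\<^sup>2)"
proof -
  define a b where "a = Re x" and "b = Im x"
  have ab: "0 < a" "\<bar>b\<bar> \<le> a / 10" using assms by (auto simp: a_def b_def)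
  have b2: "b\<^sup>2 \<le> a\<^sup>2 / 100" using power_mono[OF ab(2), of 2] by (simp add: power_divide)
  have xeq: "x = Complex a b" by (simp add: a_def b_def)
  have "norm (CI x - CI (of_real a)) \<le> ((1 + 1 / 100) * a\<^sup>2 * exp (b\<^sup>2 - a\<^sup>2)) * norm (x - of_real a)"
  proof (rule field_differentiable_bound[OF convex_closed_segment])
    show "(CI has_field_derivative z\<^sup>2 * exp (- z\<^sup>2)) (at z within closed_segment (of_real a) x)" for z
      using CI_deriv has_field_derivative_at_within by blast
    fix z assume "z \<in> closed_segment (of_real a) x"
    then obtain u where u: "0 \<le> u" "u \<le> 1" "z = (1 - u) *\<^sub>R of_real a + u *\<^sub>R x"
      by (auto simp: closed_segment_def)
    have z: "Re z = a" "Im z = u * b" unfolding u xeq by (auto simp: algebra_simps)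
    have "\<bar>u * b\<bar> \<le> \<bar>b\<bar>" using u by (simp add: abs_mult mult_left_le_one_le)
    then have ub: "(u * b)\<^sup>2 \<le> b\<^sup>2" by (rule abs_le_square_iff[THEN iffD1])
    have "(cmod z)\<^sup>2 \<le> (1 + 1 / 100) * a\<^sup>2"
      using ub b2 unfolding cmod_power2 z by (simp add: algebra_simps)
    moreover have "Re (- z\<^sup>2) \<le> b\<^sup>2 - a\<^sup>2"
      using ub by (simp add: Re_power2 z)
    ultimately show "norm (z\<^sup>2 * exp (- z\<^sup>2)) \<le> (1 + 1 / 100) * a\<^sup>2 * exp (b\<^sup>2 - a\<^sup>2)"
      unfolding norm_mult norm_power norm_exp_eq_Re by (intro mult_mono) auto
  qed auto
  also have "norm (x - of_real a) = \<bar>b\<bar>" by (simp add: xeq cmod_def)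
  also have "((1 + 1 / 100) * a\<^sup>2 * exp (b\<^sup>2 - a\<^sup>2)) * \<bar>b\<bar> \<le> ((1 + 1 / 100) * a\<^sup>2 * exp (b\<^sup>2 - a\<^sup>2)) * (a / 10)"
    using ab by (intro mult_left_mono) auto
  also have "\<dots> = 101 / 1000 * a ^ 3 * exp (b\<^sup>2 - a\<^sup>2)"
    by (simp add: power2_eq_square power3_eq_cube)
  finally show ?thesis by (simp add: a_def b_def CI_of_real)
qed

text \<open>The exponent is at most -0.99 a^2, and the quadratic Taylor term of exp already bounds
  the exponential by 4/a^4, which beats the cube.\<close>

lemma CI_diff_far:
  assumes "10 \<le> Re x" "\<bar>Im x\<bar> \<le> Re x / 10"
  shows "norm (CI x - of_real (gauss2 (Re x))) \<le> 1 / (2 * Re x)"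
proof -
  define a b where "a = Re x" and "b = Im x"
  have ab: "10 \<le> a" "\<bar>b\<bar> \<le> a / 10" using assms by (auto simp: a_def b_def)
  have b2: "b\<^sup>2 \<le> a\<^sup>2 / 100" using power_mono[OF ab(2), of 2] by (simp add: power_divide)
  define t where "t = 99 / 100 * a\<^sup>2"
  have t0: "0 \<le> t" by (simp add: t_def)
  have "t\<^sup>2 = 9801 / 10000 * a ^ 4" unfolding t_def power_mult_distrib by (simp add: power2_eq_square eval_nat_numeral)
  moreover have "0 \<le> a ^ 4" by simp
  ultimately have "a ^ 4 / 4 \<le> t\<^sup>2 / 2" by linarith
  also have "\<dots> \<le> exp t" using exp_lower_Taylor_quadratic[OF t0] t0 by linarith
  finally have "a ^ 4 / 4 \<le> exp t" .
  then have e: "exp (- t) \<le> 4 / a ^ 4" using ab by (simp add: exp_minus field_simps)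
  have "exp (b\<^sup>2 - a\<^sup>2) \<le> exp (- t)" using b2 by (simp add: t_def)
  then have "exp (b\<^sup>2 - a\<^sup>2) \<le> 4 / a ^ 4" using e by linarith
  then have "101 / 1000 * a ^ 3 * exp (b\<^sup>2 - a\<^sup>2) \<le> 101 / 1000 * a ^ 3 * (4 / a ^ 4)"
    using ab by (intro mult_left_mono) auto
  also have "\<dots> \<le> 1 / (2 * a)" using ab by (simp add: field_simps eval_nat_numeral)
  finally have *: "101 / 1000 * a ^ 3 * exp (b\<^sup>2 - a\<^sup>2) \<le> 1 / (2 * a)" .
  show ?thesis using CI_diff[of x] assms * unfolding a_def b_def by linarith
qed

text \<open>Perturbation from the real axis, where the integral is positive. For a \<le> 10 the
  slope 1/10 forces b^2 \<le> 1, so the error is at most 303/1000 of a^3 e^(-a^2), below the 1/3 of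
  \<open>gauss2_lower\<close>; beyond 10 the error 1/(2a) is below the fixed 1/9.\<close>

lemma CI_nonzero:
  assumes "0 < Re x" "\<bar>Im x\<bar> \<le> Re x / 10"
  shows "CI x \<noteq> 0"
proof
  assume z: "CI x = 0"
  define a b where "a = Re x" and "b = Im x"
  have ab: "0 < a" "\<bar>b\<bar> \<le> a / 10" using assms by (auto simp: a_def b_def)
  have b2: "b\<^sup>2 \<le> a\<^sup>2 / 100" using power_mono[OF ab(2), of 2] by (simp add: power_divide)
  show False
  proof (cases "a \<le> 10")
    case True
    then have "a\<^sup>2 \<le> 10\<^sup>2" using ab by (intro power_mono) auto
    then have "b\<^sup>2 \<le> 1" using b2 by simp
    have "exp (b\<^sup>2 - a\<^sup>2) \<le> exp (1 - a\<^sup>2)" using \<open>b\<^sup>2 \<le> 1\<close> by simp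
    also have "\<dots> = exp 1 * exp (- a\<^sup>2)" by (simp add: mult_exp_exp)
    also have "\<dots> \<le> 3 * exp (- a\<^sup>2)" using exp_le by (intro mult_right_mono) auto
    finally have "101 / 1000 * a ^ 3 * exp (b\<^sup>2 - a\<^sup>2) \<le> 101 / 1000 * a ^ 3 * (3 * exp (- a\<^sup>2))"
      using ab by (intro mult_left_mono) auto
    also have "\<dots> < a ^ 3 * exp (- a\<^sup>2) / 3" using ab by simp
    also have "\<dots> \<le> gauss2 a" using gauss2_lower ab by simp
    also have "gauss2 a = norm (CI x - of_real (gauss2 a))" using z gauss2_pos[OF ab(1)] by simp
    also have "\<dots> \<le> 101 / 1000 * a ^ 3 * exp (b\<^sup>2 - a\<^sup>2)"
      using CI_diff[OF assms] by (simp add: a_def b_def)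
    finally show False by simp
  next
    case False
    then have "norm (CI x - of_real (gauss2 a)) \<le> 1 / (2 * a)"
      using CI_diff_far[of x] assms by (simp add: a_def)
    moreover have "norm (CI x - of_real (gauss2 a)) = gauss2 a" using z gauss2_pos[OF ab(1)] by simp
    moreover have "1 / 9 \<le> gauss2 a" using gauss2_ge False by simp
    moreover have "1 / (2 * a) < 1 / 9" using False by (simp add: field_simps)
    ultimately show False by linarith
  qed
qed

section \<open>The star-shaped domain of the solutions\<close>

definition wedge :: "complex set" where
  "wedge = {x. 0 < Re x \<and> \<bar>Im x\<bar> < Re x / 10}"

definition core_radius :: real where
  "core_radius = (SOME r. 0 < r \<and> (\<forall>x\<in>ball 0 r. CPsi x \<noteq> 0))"

text \<open>The disc joins the wedge to 0, so that rays from 0 stay inside; the reflected wedge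
  makes the domain symmetric, as the parity arguments require.\<close>

definition sl_domain :: "complex set" where
  "sl_domain = ball 0 core_radius \<union> wedge \<union> uminus ` wedge"

lemma core_radius: "0 < core_radius" "x \<in> ball 0 core_radius \<Longrightarrow> CPsi x \<noteq> 0"
proof -
  have "\<forall>\<^sub>F x in nhds 0. CPsi x \<noteq> 0"
    using CPsi_0 holomorphic_on_imp_continuous_on[OF CPsi_hol[of UNIV]]
    by (intro tendsto_imp_eventually_ne[of _ "CPsi 0"])
       (auto simp: continuous_on_eq_continuous_at isCont_def tendsto_nhds_iff)
  then have "\<exists>r. 0 < r \<and> (\<forall>x\<in>ball 0 r. CPsi x \<noteq> 0)"
    by (auto simp: eventually_nhds_metric dist_commute)
  then have "0 < core_radius \<and> (\<forall>x\<in>ball 0 core_radius. CPsi x \<noteq> 0)"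
    unfolding core_radius_def by (rule someI_ex)
  then show "0 < core_radius" "x \<in> ball 0 core_radius \<Longrightarrow> CPsi x \<noteq> 0" by auto
qed

lemma CPsi_nonzero: "x \<in> sl_domain \<Longrightarrow> CPsi x \<noteq> 0"
proof -
  have w: "CPsi x \<noteq> 0" if "x \<in> wedge" for x
  proof -
    have "x \<noteq> 0" using that by (auto simp: wedge_def)
    then show ?thesis using that CI_nonzero[of x] by (simp add: CPsi_CI wedge_def)
  qed
  assume "x \<in> sl_domain"
  then show ?thesis using core_radius(2) w CPsi_even unfolding sl_domain_def by force
qed

lemma open_wedge: "open wedge"
proof -
  have "wedge = {x. 0 < Re x} \<inter> {x. \<bar>Im x\<bar> < Re x / 10}" by (auto simp: wedge_def)
  also have "open \<dots>"
    by (intro open_Int open_Collect_less) (auto intro!: continuous_intros)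
  finally show ?thesis .
qed

lemma convex_wedge: "convex wedge"
proof -
  have "wedge = {x. Im x - Re x / 10 < 0} \<inter> {x. - Im x - Re x / 10 < 0}"
    by (auto simp: wedge_def)
  moreover have "{x. Im x - Re x / 10 < 0} = {x. inner (Complex (- 1 / 10) 1) x < 0}"
    "{x. - Im x - Re x / 10 < 0} = {x. inner (Complex (- 1 / 10) (- 1)) x < 0}"
    by (auto simp: inner_complex_def)
  ultimately have eq: "wedge = {x. inner (Complex (- 1 / 10) 1) x < 0} \<inter> {x. inner (Complex (- 1 / 10) (- 1)) x < 0}"
    by (simp only:)
  show ?thesis unfolding eq by (intro convex_Int convex_halfspace_lt)
qed

lemma star_dom: "star_domain sl_domain"
proof
  show "open sl_domain" unfolding sl_domain_def
    by (intro open_Un open_ball open_wedge open_negations)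
  show "0 \<in> sl_domain" using core_radius(1) by (simp add: sl_domain_def)
  fix x and r :: real assume x: "x \<in> sl_domain" and r: "0 \<le> r" "r \<le> 1"
  show "of_real r * x \<in> sl_domain"
  proof (cases "r = 0")
    case True
    then show ?thesis using core_radius(1) by (simp add: sl_domain_def)
  next
    case False
    then have r0: "0 < r" using r by simp
    have w: "of_real r * x \<in> wedge" if "x \<in> wedge" for x :: complex
      using that r0 by (auto simp: wedge_def abs_mult)
    have b: "of_real r * x \<in> ball 0 core_radius" if "x \<in> ball 0 core_radius" for x :: complex
    proof -
      have "r * norm x \<le> 1 * norm x" using r by (intro mult_right_mono) auto
      then show ?thesis using that r by (simp add: norm_mult)
    qed
    show ?thesis using x w b unfolding sl_domain_def
      by (auto simp: image_iff)
  qed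
qed

lemma uminus_dom: "x \<in> sl_domain \<Longrightarrow> - x \<in> sl_domain"
  by (auto simp: sl_domain_def)

lemma wedge_dom: "x \<in> wedge \<Longrightarrow> x \<in> sl_domain"
  by (simp add: sl_domain_def)

lemma of_real_wedge: "0 < x \<Longrightarrow> of_real x \<in> wedge"
  by (simp add: wedge_def)

section \<open>The two normalised solutions\<close>

definition cg :: "complex \<Rightarrow> complex" where
  "cg x = exp (x\<^sup>2) / CPsi x"

text \<open>\<open>seed0 x / x\<close> is the primitive of \<open>- cg x / x\<^sup>2\<close> obtained by integrating by parts; it contains no
  logarithm because \<open>cg\<close> is even.\<close>

definition seed0 :: "complex \<Rightarrow> complex" where
  "seed0 x = cg x - x * (x * ray_mean 0 (ray_mean 0 (deriv (deriv cg))) x)"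

text \<open>The seed x means u = 1 with zero flux, the bounded solution for \<lambda> = 0.\<close>

definition F1 :: "complex \<Rightarrow> complex \<Rightarrow> complex" where
  "F1 l = sol_F cg (\<lambda>x. x) l"

definition V1 :: "complex \<Rightarrow> complex \<Rightarrow> complex" where
  "V1 l x = - (l * x\<^sup>2 * sol_Q cg (\<lambda>x. x) l x)"

definition F0 :: "complex \<Rightarrow> complex \<Rightarrow> complex" where
  "F0 l = sol_F cg seed0 l"

text \<open>The constant -1 is the flux of \<open>seed0\<close> and matches the normalisation z0(0)
  = -1.\<close>

definition V0 :: "complex \<Rightarrow> complex \<Rightarrow> complex" where
  "V0 l x = - 1 - l * x\<^sup>2 * sol_Q cg seed0 l x"

interpretation sl_domain: star_domain sl_domain by (rule star_dom)

lemma cg_hol: "cg holomorphic_on sl_domain"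
  unfolding cg_def[abs_def] by (intro holomorphic_intros CPsi_hol) (simp add: CPsi_nonzero)

lemma cg_even: "cg (- x) = cg x"
  by (simp add: cg_def CPsi_even)

text \<open>The factor c treats even and odd functions together: \<open>cg\<close> is even, its
  derivative odd, its second derivative even again.\<close>

lemma deriv_minus_arg:
  assumes f: "f holomorphic_on sl_domain" and x: "x \<in> sl_domain" and sym: "\<And>x. x \<in> sl_domain \<Longrightarrow> f (- x) = c * f x" and c: "c * c = 1"
  shows "deriv f (- x) = - c * deriv f x"
proof -
  have "(f has_field_derivative deriv f x) (at (- (- x)))"
    using holomorphic_derivI[OF f sl_domain.open_S x] by simp
  then have "((\<lambda>x. f (- x)) has_field_derivative deriv f x * - 1) (at (- x))"
    by (rule DERIV_chain2) (auto intro!: derivative_eq_intros)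
  then have "((\<lambda>x. f (- x)) has_field_derivative - deriv f x) (at (- x))" by simp
  from DERIV_cmult[OF this, of c]
  have d: "((\<lambda>x. c * f (- x)) has_field_derivative - c * deriv f x) (at (- x))" by simp
  have "f y = c * f (- y)" if "y \<in> sl_domain" for y
    using sym[OF that] c by (simp flip: mult.assoc)
  with d have "(f has_field_derivative - c * deriv f x) (at (- x))"
    by (rule_tac has_field_derivative_transform_within_open[OF d sl_domain.open_S uminus_dom[OF x]]) simp
  then show ?thesis by (rule DERIV_imp_deriv)
qed

lemma deriv_cg_hol: "deriv cg holomorphic_on sl_domain" "deriv (deriv cg) holomorphic_on sl_domain"
  by (intro holomorphic_deriv cg_hol sl_domain.open_S)+

lemma deriv_cg_even:
  assumes "x \<in> sl_domain"
  shows "deriv cg (- x) = - deriv cg x" "deriv (deriv cg) (- x) = deriv (deriv cg) x"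
proof -
  have 1: "deriv cg (- x) = - deriv cg x" if "x \<in> sl_domain" for x
    using deriv_minus_arg[OF cg_hol that, of 1] by (simp add: cg_even)
  show "deriv cg (- x) = - deriv cg x" using 1 assms .
  show "deriv (deriv cg) (- x) = deriv (deriv cg) x"
    using deriv_minus_arg[OF deriv_cg_hol(1) assms, of "- 1"] 1 by simp
qed

lemma deriv_cg_0: "deriv cg 0 = 0"
  using deriv_cg_even(1)[OF sl_domain.zero_mem] by simp

lemma seed0_hol: "seed0 holomorphic_on sl_domain"
  unfolding seed0_def[abs_def]
  by (intro holomorphic_intros cg_hol sl_domain.ray_mean_holomorphic deriv_cg_hol)

lemma seed0_even: "x \<in> sl_domain \<Longrightarrow> seed0 (- x) = seed0 x"
proof -
  assume x: "x \<in> sl_domain"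
  have 1: "ray_mean 0 (deriv (deriv cg)) (- x) = ray_mean 0 (deriv (deriv cg)) x" if "x \<in> sl_domain" for x
    by (rule ray_mean_even) (use that sl_domain.ray_mem deriv_cg_even(2) in blast)
  have "ray_mean 0 (ray_mean 0 (deriv (deriv cg))) (- x) = ray_mean 0 (ray_mean 0 (deriv (deriv cg))) x"
    by (rule ray_mean_even) (use x sl_domain.ray_mem 1 in blast)
  then show ?thesis by (simp add: seed0_def cg_even)
qed

lemma seed0_deriv:
  assumes x: "x \<in> sl_domain" "x \<noteq> 0"
  shows "(seed0 has_field_derivative (seed0 x + cg x * - 1) / x) (at x)"
proof -
  define R where "R = (\<lambda>x. x * ray_mean 0 (ray_mean 0 (deriv (deriv cg))) x)"
  have R: "(R has_field_derivative ray_mean 0 (deriv (deriv cg)) x) (at x)"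
    using sl_domain.ray_mean_deriv[OF sl_domain.ray_mean_holomorphic[OF deriv_cg_hol(2)] x(1), of 0 0]
    by (simp add: R_def)
  have seed0_R: "seed0 = (\<lambda>x. cg x - x * R x)" by (simp add: seed0_def[abs_def] R_def)
  have "x * ray_mean 0 (deriv (deriv cg)) x = deriv cg x"
    using sl_domain.ray_mean_deriv_eq[OF deriv_cg_hol(1) x(1)] deriv_cg_0 by simp
  then show ?thesis unfolding seed0_R
    using x(2)
    by (auto intro!: derivative_eq_intros R holomorphic_derivI[OF cg_hol sl_domain.open_S x(1)]
        simp: field_simps)
qed

interpretation S1: star_system sl_domain cg "\<lambda>x. x"
  by unfold_locales (auto intro: cg_hol holomorphic_intros)

interpretation S0: star_system sl_domain cg seed0
  by unfold_locales (auto intro: cg_hol seed0_hol)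

lemma F_hol: "F1 l holomorphic_on sl_domain" "F0 l holomorphic_on sl_domain"
  unfolding F1_def F0_def by (rule S1.sol_F_hol S0.sol_F_hol)+

lemma V_hol: "V1 l holomorphic_on sl_domain" "V0 l holomorphic_on sl_domain"
  unfolding V1_def[abs_def] V0_def[abs_def]
  by (intro holomorphic_intros S1.sol_Q_hol S0.sol_Q_hol)+

lemma F_param_hol:
  assumes "x \<in> sl_domain"
  shows "(\<lambda>l. F1 l x) holomorphic_on A" "(\<lambda>l. F0 l x) holomorphic_on A"
    "(\<lambda>l. V1 l x) holomorphic_on A" "(\<lambda>l. V0 l x) holomorphic_on A"
proof -
  have "(\<lambda>l. F1 l x) holomorphic_on UNIV" "(\<lambda>l. F0 l x) holomorphic_on UNIV"
    "(\<lambda>l. V1 l x) holomorphic_on UNIV" "(\<lambda>l. V0 l x) holomorphic_on UNIV"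
    unfolding F1_def F0_def V1_def V0_def
    by (intro holomorphic_intros S1.sol_param_hol[OF assms] S0.sol_param_hol[OF assms])+
  then show "(\<lambda>l. F1 l x) holomorphic_on A" "(\<lambda>l. F0 l x) holomorphic_on A"
    "(\<lambda>l. V1 l x) holomorphic_on A" "(\<lambda>l. V0 l x) holomorphic_on A"
    using holomorphic_on_subset by blast+
qed

lemma F_deriv:
  assumes "x \<in> sl_domain" "x \<noteq> 0"
  shows "(F1 l has_field_derivative (F1 l x + cg x * V1 l x) / x) (at x)"
    "(F0 l has_field_derivative (F0 l x + cg x * V0 l x) / x) (at x)"
  using S1.sol_F_deriv[OF assms, of 0 l] S0.sol_F_deriv[OF assms seed0_deriv[OF assms], of l] assms
  by (simp_all add: F1_def F0_def V1_def V0_def)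

lemma V_deriv:
  assumes "x \<in> sl_domain"
  shows "(V1 l has_field_derivative - (l * x * exp (- x\<^sup>2) * F1 l x)) (at x)"
    "(V0 l has_field_derivative - (l * x * exp (- x\<^sup>2) * F0 l x)) (at x)"
proof -
  show "(V1 l has_field_derivative - (l * x * exp (- x\<^sup>2) * F1 l x)) (at x)"
    unfolding V1_def[abs_def] F1_def mult.assoc
    by (rule DERIV_minus DERIV_cmult S1.sol_Q_deriv[OF assms, unfolded mult.assoc])+
  have "((\<lambda>x. - 1 - l * (x\<^sup>2 * sol_Q cg seed0 l x)) has_field_derivative
      0 - l * (x * exp (- x\<^sup>2) * sol_F cg seed0 l x)) (at x)"
    by (intro DERIV_diff DERIV_const DERIV_cmult S0.sol_Q_deriv[OF assms])
  then show "(V0 l has_field_derivative - (l * x * exp (- x\<^sup>2) * F0 l x)) (at x)"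
    by (simp add: V0_def[abs_def] F0_def mult.assoc)
qed

lemma F1_0: "F1 l 0 = 0" and V1_0: "V1 l 0 = 0" and V0_0: "V0 l 0 = - 1"
  and F0_0: "F0 l 0 = cg 0"
  using S1.sol_F_eq[OF sl_domain.zero_mem] S0.sol_F_eq[OF sl_domain.zero_mem]
  by (simp_all add: F1_def V1_def V0_def F0_def seed0_def)

lemma even_F0_V0:
  assumes "x \<in> sl_domain"
  shows "F0 l (- x) = F0 l x" "V0 l (- x) = V0 l x"
  using S0.sol_even[OF _ _ assms, of l] by (simp_all add: F0_def V0_def cg_even seed0_even)

text \<open>This is F1 divided by x, that is u1 itself, extended holomorphically to 0.\<close>

definition ratio1 :: "complex \<Rightarrow> complex \<Rightarrow> complex" where
  "ratio1 l x = 1 - l * x * ray_mean 0 (\<lambda>t. cg t * sol_Q cg (\<lambda>x. x) l t) x"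

lemma F1_ratio: "x \<in> sl_domain \<Longrightarrow> F1 l x = x * ratio1 l x"
  using S1.sol_F_eq[of x l] by (simp add: F1_def ratio1_def power2_eq_square algebra_simps)

lemma ratio1_hol: "ratio1 l holomorphic_on sl_domain"
  unfolding ratio1_def[abs_def]
  by (intro holomorphic_intros sl_domain.ray_mean_holomorphic cg_hol S1.sol_Q_hol)

lemma ratio1_0: "ratio1 l 0 = 1"
  by (simp add: ratio1_def)

lemma tendsto_dom_at_right:
  assumes "f holomorphic_on sl_domain"
  shows "((\<lambda>t. f (complex_of_real t)) \<longlongrightarrow> f 0) (at_right 0)"
proof -
  have "isCont f 0"
    using holomorphic_on_imp_continuous_on[OF assms] sl_domain.open_S sl_domain.zero_mem
    by (simp add: continuous_on_eq_continuous_at)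
  moreover have "((\<lambda>t. complex_of_real t) \<longlongrightarrow> 0) (at_right 0)"
    by (auto intro!: tendsto_eq_intros)
  ultimately show ?thesis by (rule isCont_tendsto_compose)
qed

text \<open>The Wronskian divided by x is constant on the wedge. Its value is known at 0, which is
  only a boundary point; so the quotient is rewritten as the holomorphic \<open>K\<close>, and the
  constant is read off in the limit along the positive axis.\<close>

lemma wronskian:
  assumes x: "x \<in> wedge"
  shows "F0 l x * V1 l x - V0 l x * F1 l x = x"
proof -
  define K where "K = (\<lambda>x. F0 l x * - (l * x * sol_Q cg (\<lambda>x. x) l x) - V0 l x * ratio1 l x)"
  have K: "x * K x = F0 l x * V1 l x - V0 l x * F1 l x" if "x \<in> sl_domain" for x
    using F1_ratio[OF that] by (simp add: K_def V1_def power2_eq_square algebra_simps)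
  have hol: "K holomorphic_on sl_domain" unfolding K_def
    by (intro holomorphic_intros F_hol V_hol ratio1_hol S1.sol_Q_hol)
  have "(K has_field_derivative 0) (at x within wedge)" if "x \<in> wedge" for x
  proof -
    have x: "x \<in> sl_domain" "x \<noteq> 0" using wedge_dom that by (auto simp: wedge_def)
    have "((\<lambda>x. (F0 l x * V1 l x - V0 l x * F1 l x) / x) has_field_derivative 0) (at x)"
      using x(2) by (auto intro!: derivative_eq_intros F_deriv V_deriv x simp: field_simps)
    then have "(K has_field_derivative 0) (at x)"
      by (rule has_field_derivative_transform_within_open[OF _ open_wedge that])
         (use K wedge_dom in \<open>auto simp: wedge_def simp flip: K\<close>)
    then show ?thesis by (rule has_field_derivative_at_within)
  qed
  from has_field_derivative_zero_constant[OF convex_wedge this]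
  obtain c where c: "\<And>x. x \<in> wedge \<Longrightarrow> K x = c" by blast
  have "((\<lambda>t. K (complex_of_real t)) \<longlongrightarrow> K 0) (at_right 0)"
    by (rule tendsto_dom_at_right[OF hol])
  moreover have "((\<lambda>t. K (complex_of_real t)) \<longlongrightarrow> c) (at_right 0)"
    by (rule tendsto_eventually) (auto simp: eventually_at_right_less eventually_at_filter c of_real_wedge)
  ultimately have "c = K 0" using tendsto_unique by (metis trivial_limit_at_right_real)
  also have "\<dots> = 1" by (simp add: K_def V0_0 ratio1_0)
  finally show ?thesis using c[OF x] K[OF wedge_dom[OF x]] by simp
qed

section \<open>Identification of u0 and u1 on the positive axis\<close>

definition flux :: "(real \<Rightarrow> complex) \<Rightarrow> real \<Rightarrow> complex" where
  "flux u x = of_real (Psi x * weight x) * vector_derivative u (at x)"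

lemma weight_pos: "0 < x \<Longrightarrow> 0 < weight x"
  by (simp add: weight_def)

lemma sl_solution_flux:
  assumes "sl_solution l u" "0 < x"
  shows "(u has_vector_derivative flux u x / of_real (Psi x * weight x)) (at x)"
    "(flux u has_vector_derivative - (l * of_real (weight x) * u x)) (at x)"
proof -
  have "u differentiable at x" using assms unfolding sl_solution_def by blast
  then show "(u has_vector_derivative flux u x / of_real (Psi x * weight x)) (at x)"
    using Psi_pos[OF assms(2)] weight_pos[OF assms(2)]
    by (simp add: flux_def flip: vector_derivative_works)
  show "(flux u has_vector_derivative - (l * of_real (weight x) * u x)) (at x)"
    using assms unfolding sl_solution_def flux_def[abs_def] by blast
qed

text \<open>On the positive axis the coefficient of the flux cancels against \<open>cg\<close>, so
  \<open>V\<close> restricts exactly to the flux of u = F/x.\<close>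

lemma sl_solutionI:
  assumes F: "\<And>x. x \<in> wedge \<Longrightarrow> (F has_field_derivative (F x + cg x * V x) / x) (at x)"
    and V: "\<And>x. x \<in> wedge \<Longrightarrow> (V has_field_derivative - (l * x * exp (- x\<^sup>2) * F x)) (at x)"
  defines "u \<equiv> \<lambda>t. F (complex_of_real t) / of_real t"
  shows "sl_solution l u" and "\<And>t. 0 < t \<Longrightarrow> flux u t = V (of_real t)"
proof -
  have du: "(u has_vector_derivative cg (of_real t) * V (of_real t) / (of_real t)\<^sup>2) (at t)" if t: "0 < t" for t
  proof -
    have "((\<lambda>x. F x / x) has_field_derivative cg (of_real t) * V (of_real t) / (of_real t)\<^sup>2) (at (of_real t))"
      using t by (auto intro!: derivative_eq_intros F of_real_wedge simp: field_simps power2_eq_square)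
    then show ?thesis unfolding u_def by (rule has_vector_derivative_real_field)
  qed
  show fl: "flux u t = V (of_real t)" if t: "0 < t" for t
    using vector_derivative_at[OF du[OF t]] t Psi_pos[OF t]
    by (simp add: flux_def cg_def CPsi_of_real weight_def exp_of_real[symmetric] mult_exp_exp)
  have dv: "(flux u has_vector_derivative - (l * of_real (weight t) * u t)) (at t)" if t: "0 < t" for t
  proof -
    have "((\<lambda>t. V (of_real t)) has_vector_derivative - (l * of_real t * exp (- (of_real t)\<^sup>2) * F (of_real t))) (at t)"
      by (rule has_vector_derivative_real_field[OF V[OF of_real_wedge[OF t]]])
    also have "- (l * of_real t * exp (- (of_real t)\<^sup>2) * F (of_real t)) = - (l * of_real (weight t) * u t)"
      using t by (simp add: u_def weight_def exp_of_real[symmetric] power2_eq_square)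
    finally show ?thesis
      by (rule has_vector_derivative_transform_within_open[of _ _ _ "{0<..}"]) (use t fl in auto)
  qed
  show "sl_solution l u"
    unfolding sl_solution_def
  proof (intro allI impI conjI)
    fix t :: real assume t: "0 < t"
    show "u differentiable at t" using du[OF t] by (auto simp: differentiable_def has_vector_derivative_def)
    show "((\<lambda>t. of_real (Psi t * weight t) * vector_derivative u (at t)) has_vector_derivative
         - (l * of_real (weight t) * u t)) (at t)"
      using dv[OF t] by (simp add: flux_def[abs_def])
  qed
qed

definition reg_u :: "complex \<Rightarrow> real \<Rightarrow> complex" where
  "reg_u l t = F1 l (of_real t) / of_real t"

definition ev_u :: "complex \<Rightarrow> real \<Rightarrow> complex" where
  "ev_u l t = F0 l (of_real t) / of_real t"

lemma wedge_nonzero: "x \<in> wedge \<Longrightarrow> x \<noteq> 0"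
  by (auto simp: wedge_def)

lemma reg_u_sl: "sl_solution l (reg_u l)" "0 < t \<Longrightarrow> flux (reg_u l) t = V1 l (of_real t)"
  using sl_solutionI[of "F1 l" "V1 l" l, OF F_deriv(1) V_deriv(1)] wedge_dom wedge_nonzero
  unfolding reg_u_def[abs_def] by blast+

lemma ev_u_sl: "sl_solution l (ev_u l)" "0 < t \<Longrightarrow> flux (ev_u l) t = V0 l (of_real t)"
  using sl_solutionI[of "F0 l" "V0 l" l, OF F_deriv(2) V_deriv(2)] wedge_dom wedge_nonzero
  unfolding ev_u_def[abs_def] by blast+

lemma flux_wronskian_const:
  assumes a: "sl_solution l a" and b: "sl_solution l b"
  shows "\<exists>c. \<forall>t>0. a t * flux b t - flux a t * b t = c"
proof -
  have "((\<lambda>t. a t * flux b t - flux a t * b t) has_vector_derivative 0) (at t within {0<..})" if "t \<in> {0<..}" for t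
  proof -
    from that have t: "0 < t" by simp
    have "((\<lambda>t. a t * flux b t - flux a t * b t) has_vector_derivative
       (a t * - (l * of_real (weight t) * b t) + flux a t / of_real (Psi t * weight t) * flux b t) -
       (flux a t * (flux b t / of_real (Psi t * weight t)) + - (l * of_real (weight t) * a t) * b t)) (at t)"
      by (intro has_vector_derivative_diff has_vector_derivative_mult
          sl_solution_flux[OF a t] sl_solution_flux[OF b t])
    then have "((\<lambda>t. a t * flux b t - flux a t * b t) has_vector_derivative 0) (at t)" by simp
    then show ?thesis by (rule has_vector_derivative_at_within)
  qed
  from has_vector_derivative_zero_constant[OF _ this] show ?thesis
    by (metis convex_real_interval(3) greaterThan_iff)
qed

text \<open>Cramer's rule: the Wronskians of u with the two known solutions are constant, and the
  Wronskian of those two is 1.\<close>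

lemma sl_solution_span:
  assumes u: "sl_solution l u"
  obtains \<alpha> \<beta> where "\<And>t. 0 < t \<Longrightarrow> u t = \<alpha> * ev_u l t - \<beta> * reg_u l t"
    "\<And>t. 0 < t \<Longrightarrow> flux u t = \<alpha> * V0 l (of_real t) - \<beta> * V1 l (of_real t)"
proof -
  obtain \<alpha> where \<alpha>: "\<And>t. 0 < t \<Longrightarrow> u t * V1 l (of_real t) - flux u t * reg_u l t = \<alpha>"
    using flux_wronskian_const[OF u reg_u_sl(1)] reg_u_sl(2) by metis
  obtain \<beta> where \<beta>: "\<And>t. 0 < t \<Longrightarrow> u t * V0 l (of_real t) - flux u t * ev_u l t = \<beta>"
    using flux_wronskian_const[OF u ev_u_sl(1)] ev_u_sl(2) by metis
  have W: "ev_u l t * V1 l (of_real t) - V0 l (of_real t) * reg_u l t = 1" if t: "0 < t" for t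
    using wronskian[OF of_real_wedge[OF t], of l] t
    by (simp add: ev_u_def reg_u_def field_simps)
  have "u t = \<alpha> * ev_u l t - \<beta> * reg_u l t" if t: "0 < t" for t
  proof -
    have "\<alpha> * ev_u l t - \<beta> * reg_u l t = u t * (ev_u l t * V1 l (of_real t) - V0 l (of_real t) * reg_u l t)"
      unfolding \<alpha>[OF t, symmetric] \<beta>[OF t, symmetric] by (simp add: algebra_simps)
    then show ?thesis using W[OF t] by simp
  qed
  moreover have "flux u t = \<alpha> * V0 l (of_real t) - \<beta> * V1 l (of_real t)" if t: "0 < t" for t
  proof -
    have "\<alpha> * V0 l (of_real t) - \<beta> * V1 l (of_real t) =
        flux u t * (ev_u l t * V1 l (of_real t) - V0 l (of_real t) * reg_u l t)"
      unfolding \<alpha>[OF t, symmetric] \<beta>[OF t, symmetric] by (simp add: algebra_simps)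
    then show ?thesis using W[OF t] by simp
  qed
  ultimately show ?thesis using that by blast
qed

lemma eventually_at_right_pos: "(\<And>t. 0 < t \<Longrightarrow> P t) \<Longrightarrow> eventually P (at_right (0::real))"
  by (auto simp: eventually_at_filter)

lemma reg_u_ratio: "0 < t \<Longrightarrow> reg_u l t = ratio1 l (of_real t)"
  using F1_ratio[OF wedge_dom[OF of_real_wedge]] by (simp add: reg_u_def)

lemma reg_u_tendsto: "(reg_u l \<longlongrightarrow> 1) (at_right 0)"
proof -
  have "((\<lambda>t. ratio1 l (of_real t)) \<longlongrightarrow> 1) (at_right 0)"
    using tendsto_dom_at_right[OF ratio1_hol, of l] by (simp add: ratio1_0)
  then show ?thesis
    by (rule Lim_transform_eventually) (auto intro!: eventually_at_right_pos simp: reg_u_ratio)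
qed

lemma reg_u_regular: "regular_solution l (reg_u l)"
proof -
  have "((\<lambda>t. norm (reg_u l t)) \<longlongrightarrow> norm (1 :: complex)) (at_right 0)"
    by (rule tendsto_norm[OF reg_u_tendsto])
  then have "\<forall>\<^sub>F t in at_right 0. norm (reg_u l t) < 2"
    by (rule order_tendstoD) simp
  then have "Bfun (reg_u l) (at_right 0)"
    by (intro BfunI[of _ 2]) (auto elim: eventually_mono)
  then show ?thesis using reg_u_sl(1) reg_u_tendsto by (simp add: regular_solution_def)
qed

lemma cg_0: "cg 0 \<noteq> 0"
  using CPsi_0 by (simp add: cg_def)

text \<open>Multiplied by t, the solution u tends to 0 whereas \<open>ev_u\<close> tends to
  \<open>cg 0\<close>, which is nonzero; this removes the singular part. The limit 1 then fixes the
  other coefficient.\<close>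

lemma regular_unique:
  assumes "regular_solution l u" and t: "0 < t"
  shows "u t = reg_u l t"
proof -
  have sl: "sl_solution l u" and lim: "(u \<longlongrightarrow> 1) (at_right 0)"
    using assms by (auto simp: regular_solution_def)
  obtain \<alpha> \<beta> where u: "\<And>t. 0 < t \<Longrightarrow> u t = \<alpha> * ev_u l t - \<beta> * reg_u l t"
    using sl_solution_span[OF sl] by metis
  have id0: "(complex_of_real \<longlongrightarrow> 0) (at_right 0)"
    by (auto intro!: tendsto_eq_intros)
  have "((\<lambda>t. of_real t * u t) \<longlongrightarrow> 0 * 1) (at_right 0)"
    by (intro tendsto_mult id0 lim)
  moreover have "((\<lambda>t. of_real t * u t) \<longlongrightarrow> \<alpha> * cg 0 - \<beta> * 0) (at_right 0)"
  proof (rule Lim_transform_eventually)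
    show "((\<lambda>t. \<alpha> * F0 l (of_real t) - \<beta> * F1 l (of_real t)) \<longlongrightarrow> \<alpha> * cg 0 - \<beta> * 0) (at_right 0)"
      using tendsto_dom_at_right[OF F_hol(1), of l] tendsto_dom_at_right[OF F_hol(2), of l]
      by (intro tendsto_intros) (auto simp: F0_0 F1_0)
    show "\<forall>\<^sub>F t in at_right 0. \<alpha> * F0 l (of_real t) - \<beta> * F1 l (of_real t) = of_real t * u t"
      by (rule eventually_at_right_pos) (simp add: u ev_u_def reg_u_def field_simps)
  qed
  ultimately have "\<alpha> * cg 0 - \<beta> * 0 = 0 * 1" using tendsto_unique trivial_limit_at_right_real by blast
  then have \<alpha>: "\<alpha> = 0" using cg_0 by simp
  have "((\<lambda>t. - \<beta> * reg_u l t) \<longlongrightarrow> - \<beta> * 1) (at_right 0)"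
    by (intro tendsto_intros reg_u_tendsto)
  then have "(u \<longlongrightarrow> - \<beta> * 1) (at_right 0)"
    by (rule Lim_transform_eventually) (auto intro!: eventually_at_right_pos simp: u \<alpha>)
  with lim have "- \<beta> * 1 = 1" using tendsto_unique trivial_limit_at_right_real by blast
  then have "\<beta> = - 1" by (metis minus_minus mult.right_neutral)
  then show ?thesis using u[OF t] \<alpha> by simp
qed

lemma u1_eq: "0 < t \<Longrightarrow> u1 l t = reg_u l t"
proof (rule regular_unique)
  show "regular_solution l (u1 l)"
    unfolding u1_def by (rule someI[of "regular_solution l", OF reg_u_regular])
qed

lemma pair_eq:
  assumes "0 < t"
  shows "pair_y u t = exp (- (of_real t)\<^sup>2 / 2) * (of_real t * u t)"
    "pair_z u t = exp ((of_real t)\<^sup>2 / 2) * flux u t"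
proof -
  show "pair_y u t = exp (- (of_real t)\<^sup>2 / 2) * (of_real t * u t)"
    by (simp add: pair_y_def exp_of_real[symmetric])
  have "exp (- t\<^sup>2 / 2) = exp (t\<^sup>2 / 2) * exp (- t\<^sup>2)"
    by (simp add: mult_exp_exp)
  then show "pair_z u t = exp ((of_real t)\<^sup>2 / 2) * flux u t"
    unfolding pair_z_def flux_def weight_def by (simp add: exp_of_real[symmetric])
qed

lemma ev_u_even: "even_solution l (ev_u l)"
  unfolding even_solution_def
proof (intro conjI exI ballI allI impI)
  have b: "x \<in> ball 0 core_radius \<Longrightarrow> x \<in> sl_domain" for x by (simp add: sl_domain_def)
  show "sl_solution l (ev_u l)" by (rule ev_u_sl)
  show "0 < core_radius" by (rule core_radius)
  let ?Y = "\<lambda>x. exp (- x\<^sup>2 / 2) * F0 l x" and ?Z = "\<lambda>x. exp (x\<^sup>2 / 2) * V0 l x"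
  have "?Y holomorphic_on sl_domain" "?Z holomorphic_on sl_domain"
    by (intro holomorphic_intros F_hol V_hol; simp)+
  then show "?Y holomorphic_on ball 0 core_radius" "?Z holomorphic_on ball 0 core_radius"
    using b by (meson holomorphic_on_subset subsetI)+
  show "?Y (of_real x) = pair_y (ev_u l) x" "?Z (of_real x) = pair_z (ev_u l) x"
    if "0 < x \<and> x < core_radius" for x
    using that by (simp_all add: pair_eq ev_u_sl(2)) (simp add: ev_u_def)
  show "?Y (- x) = ?Y x" "?Z (- x) = ?Z x" if "x \<in> ball 0 core_radius" for x
    using even_F0_V0[OF b[OF that]] by simp_all
  show "?Y 0 = of_real (3 * sqrt pi / 2)" by (simp add: F0_0 cg_def CPsi_0_eq)
  show "?Z 0 = - 1" by (simp add: V0_0)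
qed

text \<open>The value of Z at 0 fixes the coefficient of \<open>ev_u\<close>. A remaining multiple
  of \<open>reg_u\<close> would give \<open>D\<close> a nonzero derivative at 0, which is impossible
  for an even function.\<close>

lemma even_unique:
  assumes "even_solution l u" and t: "0 < t"
  shows "u t = ev_u l t"
proof -
  from assms obtain r Y Z where sl: "sl_solution l u" and r: "0 < r"
    and hol: "Y holomorphic_on ball 0 r" "Z holomorphic_on ball 0 r"
    and eq: "\<And>x. 0 < x \<Longrightarrow> x < r \<Longrightarrow> Y (of_real x) = pair_y u x \<and> Z (of_real x) = pair_z u x"
    and ev: "\<And>x. x \<in> ball 0 r \<Longrightarrow> Y (- x) = Y x" and Z0: "Z 0 = - 1"
    and Y0: "Y 0 = of_real (3 * sqrt pi / 2)"
    unfolding even_solution_def by blast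
  obtain \<alpha> \<beta> where u: "\<And>t. 0 < t \<Longrightarrow> u t = \<alpha> * ev_u l t - \<beta> * reg_u l t"
    and fu: "\<And>t. 0 < t \<Longrightarrow> flux u t = \<alpha> * V0 l (of_real t) - \<beta> * V1 l (of_real t)"
    using sl_solution_span[OF sl] by metis
  have id0: "(complex_of_real \<longlongrightarrow> 0) (at_right 0)"
    by (auto intro!: tendsto_eq_intros)
  have small: "\<forall>\<^sub>F x in at_right 0. 0 < x \<and> x < r"
    using r by (auto simp: eventually_at_right_field)
  have "isCont Z 0" using hol(2) r holomorphic_on_imp_continuous_on
    by (metis centre_in_ball continuous_on_eq_continuous_at open_ball)
  from isCont_tendsto_compose[OF this id0] have "((\<lambda>x. Z (of_real x)) \<longlongrightarrow> - 1) (at_right 0)"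
    by (simp add: Z0)
  moreover have "((\<lambda>x. Z (of_real x)) \<longlongrightarrow> exp (0\<^sup>2 / 2) * (\<alpha> * - 1 - \<beta> * 0)) (at_right 0)"
  proof (rule Lim_transform_eventually)
    show "((\<lambda>x. exp ((of_real x)\<^sup>2 / 2) * (\<alpha> * V0 l (of_real x) - \<beta> * V1 l (of_real x))) \<longlongrightarrow>
       exp (0\<^sup>2 / 2) * (\<alpha> * - 1 - \<beta> * 0)) (at_right 0)"
      using tendsto_dom_at_right[OF V_hol(1), of l] tendsto_dom_at_right[OF V_hol(2), of l]
      by (intro tendsto_intros id0) (auto simp: V0_0 V1_0)
    show "\<forall>\<^sub>F x in at_right 0. exp ((of_real x)\<^sup>2 / 2) * (\<alpha> * V0 l (of_real x) - \<beta> * V1 l (of_real x)) = Z (of_real x)"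
      using small by eventually_elim (simp add: eq pair_eq fu)
  qed
  ultimately have "- 1 = exp (0\<^sup>2 / 2) * (\<alpha> * - 1 - \<beta> * 0)"
    using tendsto_unique trivial_limit_at_right_real by blast
  then have \<alpha>: "\<alpha> = 1" by simp
  define r' where "r' = min r core_radius"
  have r': "0 < r'" using r core_radius(1) by (simp add: r'_def)
  define D where "D = (\<lambda>x. Y x - exp (- x\<^sup>2 / 2) * F0 l x)"
  have sub: "ball 0 r' \<subseteq> ball 0 r" "ball 0 r' \<subseteq> sl_domain" by (auto simp: r'_def sl_domain_def)
  have D: "D holomorphic_on ball 0 r'"
    unfolding D_def
    by (intro holomorphic_intros holomorphic_on_subset[OF hol(1) sub(1)] holomorphic_on_subset[OF F_hol(2) sub(2)]) simp
  have D0: "D 0 = 0" by (simp add: D_def Y0 F0_0 cg_def CPsi_0_eq)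
  have Dev: "D (- x) = D x" if "x \<in> ball 0 r'" for x
  proof -
    have "x \<in> ball 0 r" "x \<in> sl_domain" using that sub by blast+
    then show ?thesis by (simp add: D_def ev even_F0_V0(1))
  qed
  have D': "(D has_field_derivative deriv D 0) (at 0)"
    by (rule holomorphic_derivI[OF D]) (use r' in auto)
  have "((\<lambda>x. D (- x)) has_field_derivative deriv D 0 * - 1) (at 0)"
    by (rule DERIV_chain2[of D _ uminus]) (use D' in \<open>auto intro!: derivative_eq_intros\<close>)
  then have "(D has_field_derivative deriv D 0 * - 1) (at 0)"
    by (rule has_field_derivative_transform_within_open[where S = "ball 0 r'"]) (use r' Dev in auto)
  from DERIV_unique[OF D' this] have d0: "deriv D 0 = 0" by simp
  have "((\<lambda>h. (D (0 + h) - D 0) / h) \<longlongrightarrow> 0) (at 0)"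
    using D' d0 by (simp add: DERIV_def)
  moreover have "filterlim complex_of_real (at 0) (at_right 0)"
    using id0 by (auto simp: filterlim_at intro!: eventually_at_right_pos)
  ultimately have "((\<lambda>x. (D (0 + of_real x) - D 0) / of_real x) \<longlongrightarrow> 0) (at_right 0)"
    by (rule filterlim_compose)
  moreover have "((\<lambda>x. (D (0 + of_real x) - D 0) / of_real x) \<longlongrightarrow> exp (- 0\<^sup>2 / 2) * (- \<beta> * 1)) (at_right 0)"
  proof (rule Lim_transform_eventually)
    show "((\<lambda>x. exp (- (of_real x)\<^sup>2 / 2) * (- \<beta> * reg_u l x)) \<longlongrightarrow> exp (- 0\<^sup>2 / 2) * (- \<beta> * 1)) (at_right 0)"
      by (intro tendsto_intros id0 reg_u_tendsto) simp
    show "\<forall>\<^sub>F x in at_right 0. exp (- (of_real x)\<^sup>2 / 2) * (- \<beta> * reg_u l x) = (D (0 + of_real x) - D 0) / of_real x"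
      using small
    proof eventually_elim
      case (elim x)
      then have "D (of_real x) = exp (- (of_real x)\<^sup>2 / 2) * (of_real x * u x) - exp (- (of_real x)\<^sup>2 / 2) * F0 l (of_real x)"
        by (simp add: D_def eq pair_eq)
      also have "F0 l (of_real x) = of_real x * ev_u l x" using elim by (simp add: ev_u_def)
      finally show ?case using elim by (simp add: D0 u \<alpha> field_simps)
    qed
  qed
  ultimately have "exp (- 0\<^sup>2 / 2) * (- \<beta> * 1) = 0" using tendsto_unique trivial_limit_at_right_real by blast
  then have "\<beta> = 0" by simp
  then show ?thesis using u[OF t] \<alpha> by simp
qed

lemma u0_eq: "0 < t \<Longrightarrow> u0 l t = ev_u l t"
proof (rule even_unique)
  show "even_solution l (u0 l)"
    unfolding u0_def by (rule someI[of "even_solution l", OF ev_u_even])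
qed

lemma u0_u1_quotient: "0 < t \<Longrightarrow> u0 l t / u1 l t = F0 l (of_real t) / F1 l (of_real t)"
  by (simp add: u0_eq u1_eq ev_u_def reg_u_def)

section \<open>The flux form along complex paths\<close>

text \<open>Quantitative dominance of the two diagonal terms in the derivative of the form. The
  condition with 43 is what completing the square in \<open>flux_form_bound\<close> demands.\<close>

definition coercive :: "complex \<Rightarrow> complex \<Rightarrow> complex \<Rightarrow> complex \<Rightarrow> bool" where
  "coercive \<kappa> l \<gamma> x \<longleftrightarrow> x \<in> wedge \<and> 1 \<le> cmod x \<and> cmod \<kappa> \<le> 2 \<and> cmod \<gamma> \<le> 2 \<and>
     (\<exists>a>0. 43 \<le> a\<^sup>2 * cmod x \<and> a * cmod x \<le> Im (\<kappa> * l * \<gamma> * x) \<and>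
        a * (cmod x)\<^sup>2 \<le> Im (cnj \<kappa> * \<gamma> / (x * CPsi x)))"

lemma Im_mult_real: "Im (z * of_real r) = Im z * r" "Im (of_real r * z) = r * Im z"
  by simp_all

text \<open>\<open>D\<close> is the derivative of \<open>- Im (\<kappa> z cnj y)\<close> in direction \<open>\<gamma>\<close>, with \<open>P = 1/(x \<Psi>)\<close>; for large \<open>\<bar>x\<bar>\<close>
  the diagonal terms absorb the cross term by completing the square.\<close>

lemma flux_form_bound:
  fixes x y z \<kappa> \<gamma> l P :: complex
  assumes x: "1 \<le> cmod x" and \<kappa>: "cmod \<kappa> \<le> 2" and \<gamma>: "cmod \<gamma> \<le> 2" and a: "0 < a"
    and ax: "43 \<le> a\<^sup>2 * cmod x" and A: "a * cmod x \<le> Im (\<kappa> * l * \<gamma> * x)"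
    and B: "a * (cmod x)\<^sup>2 \<le> Im (cnj \<kappa> * \<gamma> * P)"
  defines "D \<equiv> - Im (\<kappa> * (\<gamma> * (x * z - l * x * y) * cnj y + z * cnj (\<gamma> * ((1 / x - x) * y + P * z))))"
  shows "cmod y * cmod z \<le> D" and "y \<noteq> 0 \<or> z \<noteq> 0 \<Longrightarrow> 0 < D"
proof -
  \<comment> \<open>Collects the coefficients of \<open>z * cnj y\<close>; only \<gamma> x and
    \<gamma>/x occur, so the cross term is of order |x|.\<close>
  define c where "c = \<gamma> * x - cnj (\<gamma> * x) + cnj (\<gamma> / x)"
  have "\<kappa> * (\<gamma> * (x * z - l * x * y) * cnj y + z * cnj (\<gamma> * ((1 / x - x) * y + P * z))) =
      - (\<kappa> * l * \<gamma> * x) * (y * cnj y) + \<kappa> * cnj (\<gamma> * P) * (z * cnj z) + \<kappa> * c * (z * cnj y)"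
    by (simp add: c_def algebra_simps)
  also have "\<dots> = - (\<kappa> * l * \<gamma> * x) * of_real ((cmod y)\<^sup>2) + cnj (cnj \<kappa> * \<gamma> * P) * of_real ((cmod z)\<^sup>2) + \<kappa> * c * (z * cnj y)"
    by (simp add: complex_norm_square[symmetric] mult.assoc)
  finally have D: "D = Im (\<kappa> * l * \<gamma> * x) * (cmod y)\<^sup>2 + Im (cnj \<kappa> * \<gamma> * P) * (cmod z)\<^sup>2 - Im (\<kappa> * c * (z * cnj y))"
    unfolding D_def by (simp only: plus_complex.simps Im_mult_real uminus_complex.simps mult_minus_left cnj.simps)
  have "cmod c \<le> cmod (\<gamma> * x) + cmod (\<gamma> * x) + cmod (\<gamma> / x)"
    unfolding c_def using norm_triangle_ineq[of "\<gamma> * x - cnj (\<gamma> * x)" "cnj (\<gamma> / x)"]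
      norm_triangle_ineq4[of "\<gamma> * x" "cnj (\<gamma> * x)"]
    unfolding complex_mod_cnj by linarith
  also have "cmod (\<gamma> * x) \<le> 2 * cmod x" unfolding norm_mult by (rule mult_right_mono[OF \<gamma>]) simp
  also have "cmod (\<gamma> / x) \<le> 2 * cmod x"
  proof -
    have "cmod (\<gamma> / x) \<le> 2 / 1" unfolding norm_divide using \<gamma> x by (intro frac_le) auto
    then show ?thesis using x by linarith
  qed
  finally have c: "cmod c \<le> 6 * cmod x" by simp
  have "Im (\<kappa> * c * (z * cnj y)) \<le> cmod (\<kappa> * c * (z * cnj y))" using abs_Im_le_cmod abs_le_D1 by blast
  also have "\<dots> = cmod \<kappa> * cmod c * (cmod y * cmod z)" by (simp add: norm_mult mult_ac)
  also have "\<dots> \<le> 2 * (6 * cmod x) * (cmod y * cmod z)"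
    using \<kappa> c by (intro mult_right_mono mult_mono) auto
  finally have cr: "Im (\<kappa> * c * (z * cnj y)) \<le> 12 * cmod x * (cmod y * cmod z)" by simp
  have 1: "a * cmod x * (cmod y)\<^sup>2 \<le> Im (\<kappa> * l * \<gamma> * x) * (cmod y)\<^sup>2"
    by (rule mult_right_mono[OF A]) simp
  have 2: "a * (cmod x)\<^sup>2 * (cmod z)\<^sup>2 \<le> Im (cnj \<kappa> * \<gamma> * P) * (cmod z)\<^sup>2"
    by (rule mult_right_mono[OF B]) simp
  \<comment> \<open>The cross term is at most 12 |x| |y| |z|. Completing the square with 13 instead
    leaves |x| |y| |z| over. It costs 169/4, and 3/4 more for a strict remainder in z makes
    43.\<close>
  have sq: "0 \<le> a * cmod x * (cmod y - 13 / (2 * a) * cmod z)\<^sup>2" using a by simp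
  have sqe: "a * cmod x * (cmod y - 13 / (2 * a) * cmod z)\<^sup>2 =
     a * cmod x * (cmod y)\<^sup>2 - 13 * cmod x * (cmod y * cmod z) + 169 / (4 * a) * cmod x * (cmod z)\<^sup>2"
    using a by (simp add: power2_eq_square field_simps)
  have "169 / (4 * a) * cmod x + 3 / (4 * a) * cmod x = 43 * (cmod x / a)" using a by (simp add: field_simps)
  also have "\<dots> \<le> (a\<^sup>2 * cmod x) * (cmod x / a)" using ax a by (intro mult_right_mono) auto
  also have "\<dots> = a * (cmod x)\<^sup>2" using a by (simp add: power2_eq_square)
  finally have "(169 / (4 * a) * cmod x + 3 / (4 * a) * cmod x) * (cmod z)\<^sup>2 \<le> a * (cmod x)\<^sup>2 * (cmod z)\<^sup>2"
    by (rule mult_right_mono) simp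
  then have 3: "169 / (4 * a) * cmod x * (cmod z)\<^sup>2 + 3 / (4 * a) * cmod x * (cmod z)\<^sup>2 \<le> a * (cmod x)\<^sup>2 * (cmod z)\<^sup>2"
    by (simp only: distrib_right)
  have 4: "D \<ge> cmod x * (cmod y * cmod z) + 3 / (4 * a) * cmod x * (cmod z)\<^sup>2"
    using D cr 1 2 sq sqe 3 by linarith
  have 5: "cmod y * cmod z \<le> cmod x * (cmod y * cmod z)" using mult_right_mono[OF x, of "cmod y * cmod z"] by simp
  have 6: "0 \<le> 3 / (4 * a) * cmod x * (cmod z)\<^sup>2" using a by simp
  show "cmod y * cmod z \<le> D" using 4 5 6 by linarith
  show "0 < D" if "y \<noteq> 0 \<or> z \<noteq> 0"
  proof (cases "z = 0")
    case True
    then have "y \<noteq> 0" using that by simp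
    moreover have "0 < cmod x" using x by linarith
    ultimately have "0 < a * cmod x * (cmod y)\<^sup>2" using a by simp
    then show ?thesis using D 1 True by simp
  next
    case False
    moreover have "0 < cmod x" using x by linarith
    ultimately have "0 < 3 / (4 * a) * cmod x * (cmod z)\<^sup>2" using a by simp
    moreover have "0 \<le> cmod x * (cmod y * cmod z)" by simp
    ultimately show ?thesis using 4 by linarith
  qed
qed

text \<open>Off the real axis the two exponentials do not cancel, because one of them is conjugated;
  on the axis they do.\<close>

definition form :: "complex \<Rightarrow> (complex \<Rightarrow> complex) \<Rightarrow> (complex \<Rightarrow> complex) \<Rightarrow> complex \<Rightarrow> real" where
  "form \<kappa> F V x = - Im (\<kappa> * (exp (x\<^sup>2 / 2) * V x) * cnj (exp (- x\<^sup>2 / 2) * F x))"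

definition is_pair :: "complex \<Rightarrow> (complex \<Rightarrow> complex) \<Rightarrow> (complex \<Rightarrow> complex) \<Rightarrow> bool" where
  "is_pair l F V \<longleftrightarrow> (\<forall>x\<in>wedge. (F has_field_derivative (F x + cg x * V x) / x) (at x) \<and>
     (V has_field_derivative - (l * x * exp (- x\<^sup>2) * F x)) (at x))"

lemma is_pair_combination: "is_pair l (\<lambda>x. F0 l x + c * F1 l x) (\<lambda>x. V0 l x + c * V1 l x)"
  unfolding is_pair_def
proof
  fix x assume "x \<in> wedge"
  then have x: "x \<in> sl_domain" "x \<noteq> 0" using wedge_dom wedge_nonzero by auto
  have "((\<lambda>x. F0 l x + c * F1 l x) has_field_derivative
      (F0 l x + cg x * V0 l x) / x + c * ((F1 l x + cg x * V1 l x) / x)) (at x)"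
    by (intro DERIV_add DERIV_cmult F_deriv x)
  moreover have "((\<lambda>x. V0 l x + c * V1 l x) has_field_derivative
      - (l * x * exp (- x\<^sup>2) * F0 l x) + c * (- (l * x * exp (- x\<^sup>2) * F1 l x))) (at x)"
    by (intro DERIV_add DERIV_cmult V_deriv x)
  ultimately show "((\<lambda>x. F0 l x + c * F1 l x) has_field_derivative
      (F0 l x + c * F1 l x + cg x * (V0 l x + c * V1 l x)) / x) (at x) \<and>
    ((\<lambda>x. V0 l x + c * V1 l x) has_field_derivative - (l * x * exp (- x\<^sup>2) * (F0 l x + c * F1 l x))) (at x)"
    by (simp add: add_divide_distrib algebra_simps)
qed

lemma is_pair_1: "is_pair l (F1 l) (V1 l)"
  unfolding is_pair_def using F_deriv(1) V_deriv(1) wedge_dom wedge_nonzero by blast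

lemma form_deriv:
  assumes p: "is_pair l F V" and w: "x0 + \<gamma> * of_real t \<in> wedge"
  defines "x \<equiv> x0 + \<gamma> * of_real t"
  defines "y \<equiv> exp (- x\<^sup>2 / 2) * F x" and "z \<equiv> exp (x\<^sup>2 / 2) * V x"
  shows "((\<lambda>t. form \<kappa> F V (x0 + \<gamma> * of_real t)) has_real_derivative
     - Im (\<kappa> * (\<gamma> * (x * z - l * x * y) * cnj y + z * cnj (\<gamma> * ((1 / x - x) * y + 1 / (x * CPsi x) * z))))) (at t)"
proof -
  have x: "x \<in> wedge" "x \<noteq> 0" "CPsi x \<noteq> 0"
    using w wedge_nonzero CPsi_nonzero wedge_dom unfolding x_def by auto
  have F: "(F has_field_derivative (F x + cg x * V x) / x) (at x)"
    and V: "(V has_field_derivative - (l * x * exp (- x\<^sup>2) * F x)) (at x)"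
    using p x(1) by (auto simp: is_pair_def)
  have "((\<lambda>x. exp (- x\<^sup>2 / 2) * F x) has_field_derivative
     - x * exp (- x\<^sup>2 / 2) * F x + exp (- x\<^sup>2 / 2) * ((F x + cg x * V x) / x)) (at x)"
    by (auto intro!: derivative_eq_intros F)
  also have "exp (- x\<^sup>2 / 2) * ((F x + cg x * V x) / x) = y / x + (exp (- x\<^sup>2 / 2) * exp (x\<^sup>2)) * V x / (x * CPsi x)"
    using x by (simp add: y_def cg_def field_simps)
  also have "exp (- x\<^sup>2 / 2) * exp (x\<^sup>2) = exp (x\<^sup>2 / 2)" by (simp add: mult_exp_exp)
  finally have "((\<lambda>x. exp (- x\<^sup>2 / 2) * F x) has_field_derivative
     (1 / x - x) * y + 1 / (x * CPsi x) * z) (at x)"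
    by (simp add: y_def z_def algebra_simps)
  moreover have lin: "((\<lambda>t. x0 + \<gamma> * of_real t) has_vector_derivative \<gamma>) (at t)"
    by (auto intro!: derivative_eq_intros)
  ultimately have dy: "((\<lambda>t. exp (- (x0 + \<gamma> * of_real t)\<^sup>2 / 2) * F (x0 + \<gamma> * of_real t)) has_vector_derivative
     \<gamma> * ((1 / x - x) * y + 1 / (x * CPsi x) * z)) (at t)"
    using field_vector_diff_chain_at[of "\<lambda>t. x0 + \<gamma> * of_real t" \<gamma> t "\<lambda>x. exp (- x\<^sup>2 / 2) * F x"]
    by (simp add: x_def o_def)
  have "((\<lambda>x. exp (x\<^sup>2 / 2) * V x) has_field_derivative
     x * exp (x\<^sup>2 / 2) * V x + exp (x\<^sup>2 / 2) * - (l * x * exp (- x\<^sup>2) * F x)) (at x)"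
    by (auto intro!: derivative_eq_intros V)
  also have "exp (x\<^sup>2 / 2) * - (l * x * exp (- x\<^sup>2) * F x) = - (l * x * ((exp (x\<^sup>2 / 2) * exp (- x\<^sup>2)) * F x))"
    by simp
  also have "exp (x\<^sup>2 / 2) * exp (- x\<^sup>2) = exp (- x\<^sup>2 / 2)" by (simp add: mult_exp_exp)
  finally have "((\<lambda>x. exp (x\<^sup>2 / 2) * V x) has_field_derivative x * z - l * x * y) (at x)"
    by (simp add: y_def z_def algebra_simps)
  with lin have dz: "((\<lambda>t. exp ((x0 + \<gamma> * of_real t)\<^sup>2 / 2) * V (x0 + \<gamma> * of_real t)) has_vector_derivative
     \<gamma> * (x * z - l * x * y)) (at t)"
    using field_vector_diff_chain_at[of "\<lambda>t. x0 + \<gamma> * of_real t" \<gamma> t "\<lambda>x. exp (x\<^sup>2 / 2) * V x"]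
    by (simp add: x_def o_def)
  have dyc: "((\<lambda>t. cnj (exp (- (x0 + \<gamma> * of_real t)\<^sup>2 / 2) * F (x0 + \<gamma> * of_real t))) has_vector_derivative
     cnj (\<gamma> * ((1 / x - x) * y + 1 / (x * CPsi x) * z))) (at t)"
    by (rule bounded_linear.has_vector_derivative[OF bounded_linear_cnj dy])
  have "((\<lambda>t. \<kappa> * ((exp ((x0 + \<gamma> * of_real t)\<^sup>2 / 2) * V (x0 + \<gamma> * of_real t)) *
        cnj (exp (- (x0 + \<gamma> * of_real t)\<^sup>2 / 2) * F (x0 + \<gamma> * of_real t)))) has_vector_derivative
     \<kappa> * (z * cnj (\<gamma> * ((1 / x - x) * y + 1 / (x * CPsi x) * z)) + \<gamma> * (x * z - l * x * y) * cnj y)) (at t)"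
    using has_vector_derivative_mult_right[OF has_vector_derivative_mult[OF dz dyc], of \<kappa>]
    by (simp only: x_def y_def z_def)
  from has_vector_derivative_minus[OF bounded_linear.has_vector_derivative[OF bounded_linear_Im this]]
  show ?thesis
    unfolding has_real_derivative_iff_has_vector_derivative form_def
    by (simp only: mult.assoc add.commute)
qed

text \<open>With |\<kappa>| \<le> 2 the form is at most 2 |y| |z|, hence at most twice its
  derivative; this is the origin of the growth rate 1/2.\<close>

lemma form_deriv_bounds:
  assumes p: "is_pair l F V" and co: "coercive \<kappa> l \<gamma> (x0 + \<gamma> * of_real t)"
  obtains D where "((\<lambda>t. form \<kappa> F V (x0 + \<gamma> * of_real t)) has_real_derivative D) (at t)"
    "0 \<le> D" "form \<kappa> F V (x0 + \<gamma> * of_real t) / 2 \<le> D"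
    "F (x0 + \<gamma> * of_real t) \<noteq> 0 \<or> V (x0 + \<gamma> * of_real t) \<noteq> 0 \<Longrightarrow> 0 < D"
proof -
  define x where "x = x0 + \<gamma> * of_real t"
  define y z where "y = exp (- x\<^sup>2 / 2) * F x" and "z = exp (x\<^sup>2 / 2) * V x"
  define D where "D = - Im (\<kappa> * (\<gamma> * (x * z - l * x * y) * cnj y + z * cnj (\<gamma> * ((1 / x - x) * y + 1 / (x * CPsi x) * z))))"
  from co obtain a where w: "x \<in> wedge" and c: "1 \<le> cmod x" "cmod \<kappa> \<le> 2" "cmod \<gamma> \<le> 2" "0 < a"
     "43 \<le> a\<^sup>2 * cmod x" "a * cmod x \<le> Im (\<kappa> * l * \<gamma> * x)" "a * (cmod x)\<^sup>2 \<le> Im (cnj \<kappa> * \<gamma> * (1 / (x * CPsi x)))"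
    unfolding coercive_def x_def by auto
  have d: "((\<lambda>t. form \<kappa> F V (x0 + \<gamma> * of_real t)) has_real_derivative D) (at t)"
    unfolding D_def y_def z_def x_def by (rule form_deriv[OF p w[unfolded x_def]])
  have b: "cmod y * cmod z \<le> D" and pos: "y \<noteq> 0 \<or> z \<noteq> 0 \<Longrightarrow> 0 < D"
    unfolding D_def by (rule flux_form_bound[OF c]; assumption)+
  have "form \<kappa> F V x \<le> cmod (\<kappa> * z * cnj y)"
    unfolding form_def y_def z_def using abs_Im_le_cmod abs_le_D2 by blast
  also have "\<dots> = cmod \<kappa> * (cmod y * cmod z)" by (simp add: norm_mult)
  also have "\<dots> \<le> 2 * (cmod y * cmod z)" using c(2) by (intro mult_right_mono) auto
  also have "\<dots> \<le> 2 * D" using b by simp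
  finally have "form \<kappa> F V x / 2 \<le> D" by simp
  moreover have "0 \<le> D" using b by (meson mult_nonneg_nonneg norm_ge_zero order_trans)
  moreover have "F x \<noteq> 0 \<or> V x \<noteq> 0 \<Longrightarrow> 0 < D" using pos by (simp add: y_def z_def)
  ultimately show ?thesis using that d unfolding x_def by blast
qed

lemma form_mono:
  assumes p: "is_pair l F V" and T: "0 \<le> T"
    and co: "\<And>t. 0 \<le> t \<Longrightarrow> t \<le> T \<Longrightarrow> coercive \<kappa> l \<gamma> (x0 + \<gamma> * of_real t)"
  shows "form \<kappa> F V x0 \<le> form \<kappa> F V (x0 + \<gamma> * of_real T)"
proof -
  have "(\<lambda>t. form \<kappa> F V (x0 + \<gamma> * of_real t)) 0 \<le> (\<lambda>t. form \<kappa> F V (x0 + \<gamma> * of_real t)) T"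
    by (rule DERIV_nonneg_imp_nondecreasing[OF T]) (metis co form_deriv_bounds[OF p])
  then show ?thesis by simp
qed

text \<open>Integrating factor e^(-t/2), applied to the rate from
  \<open>form_deriv_bounds\<close>.\<close>

lemma form_growth:
  assumes p: "is_pair l F V" and T: "0 \<le> T"
    and co: "\<And>t. 0 \<le> t \<Longrightarrow> t \<le> T \<Longrightarrow> coercive \<kappa> l \<gamma> (x0 + \<gamma> * of_real t)"
  shows "form \<kappa> F V x0 * exp (T / 2) \<le> form \<kappa> F V (x0 + \<gamma> * of_real T)"
proof -
  let ?h = "\<lambda>t. form \<kappa> F V (x0 + \<gamma> * of_real t) * exp (- t / 2)"
  have "?h 0 \<le> ?h T"
  proof (rule DERIV_nonneg_imp_nondecreasing[OF T])
    fix t assume "0 \<le> t" "t \<le> T"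
    then obtain D where D: "((\<lambda>t. form \<kappa> F V (x0 + \<gamma> * of_real t)) has_real_derivative D) (at t)"
      "form \<kappa> F V (x0 + \<gamma> * of_real t) / 2 \<le> D"
      using form_deriv_bounds[OF p co] by metis
    have "(?h has_real_derivative (D - form \<kappa> F V (x0 + \<gamma> * of_real t) / 2) * exp (- t / 2)) (at t)"
      by (auto intro!: derivative_eq_intros D(1) simp: algebra_simps)
    then show "\<exists>y. (?h has_real_derivative y) (at t) \<and> 0 \<le> y" using D(2) by fastforce
  qed
  then have "form \<kappa> F V x0 \<le> form \<kappa> F V (x0 + \<gamma> * of_real T) * exp (- (T / 2))" by simp
  then show ?thesis by (simp add: exp_minus field_simps)
qed

lemma pair1_nonzero: "x \<in> wedge \<Longrightarrow> F1 l x \<noteq> 0 \<or> V1 l x \<noteq> 0"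
  using wronskian[of x l] wedge_nonzero by auto

text \<open>By the Wronskian the pair (F1, V1) never vanishes, so the derivative of its form is
  strictly positive. This lifts a start value 0 on the axis to a positive one.\<close>

lemma form_strict:
  assumes T: "0 < T" and co: "\<And>t. 0 \<le> t \<Longrightarrow> t \<le> T \<Longrightarrow> coercive \<kappa> l \<gamma> (x0 + \<gamma> * of_real t)"
  shows "form \<kappa> (F1 l) (V1 l) x0 < form \<kappa> (F1 l) (V1 l) (x0 + \<gamma> * of_real T)"
proof -
  have "(\<lambda>t. form \<kappa> (F1 l) (V1 l) (x0 + \<gamma> * of_real t)) 0 < (\<lambda>t. form \<kappa> (F1 l) (V1 l) (x0 + \<gamma> * of_real t)) T"
  proof (rule DERIV_pos_imp_increasing[OF T])
    fix t assume t: "0 \<le> t" "t \<le> T"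
    have "x0 + \<gamma> * of_real t \<in> wedge" using co[OF t] by (simp add: coercive_def)
    then show "\<exists>y. ((\<lambda>t. form \<kappa> (F1 l) (V1 l) (x0 + \<gamma> * of_real t)) has_real_derivative y) (at t) \<and> 0 < y"
      using form_deriv_bounds[OF is_pair_1 co[OF t]] pair1_nonzero by metis
  qed
  then show ?thesis by simp
qed

section \<open>Weyl discs for the quotient of the solutions\<close>

definition quot :: "complex \<Rightarrow> complex \<Rightarrow> complex" where
  "quot l x = F0 l x / F1 l x"

lemma form_pos_nonzero: "0 < form \<kappa> F V x \<Longrightarrow> F x \<noteq> 0"
  by (auto simp: form_def)

text \<open>The Weyl-disc argument: the solution \<open>F0 + c F1\<close> that vanishes at the end of the path has
  nonpositive form at its start, which confines \<open>c\<close> to a disc whose radius is controlled by the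
  form of \<open>F1\<close>.\<close>

lemma quot_diff:
  assumes T: "0 \<le> T" and co: "\<And>t. 0 \<le> t \<Longrightarrow> t \<le> T \<Longrightarrow> coercive \<kappa> l \<gamma> (x0 + \<gamma> * of_real t)"
    and pos: "0 < form \<kappa> (F1 l) (V1 l) x0"
  shows "cmod (quot l (x0 + \<gamma> * of_real T) - quot l x0) \<le> 2 * cmod x0 / form \<kappa> (F1 l) (V1 l) x0"
proof -
  define xT where "xT = x0 + \<gamma> * of_real T"
  define \<phi> where "\<phi> = form \<kappa> (F1 l) (V1 l) x0"
  have w: "x0 \<in> wedge" and k: "cmod \<kappa> \<le> 2" using co[of 0] T by (auto simp: coercive_def)
  have nz0: "F1 l x0 \<noteq> 0" using form_pos_nonzero[OF pos] .
  have "0 < form \<kappa> (F1 l) (V1 l) xT"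
    using form_mono[OF is_pair_1 T co] pos unfolding xT_def by linarith
  then have nzT: "F1 l xT \<noteq> 0" by (rule form_pos_nonzero)
  define c where "c = - quot l xT"
  define d where "d = c + quot l x0"
  have "form \<kappa> (\<lambda>x. F0 l x + c * F1 l x) (\<lambda>x. V0 l x + c * V1 l x) xT = 0"
    using nzT by (simp add: form_def c_def quot_def)
  then have neg: "form \<kappa> (\<lambda>x. F0 l x + c * F1 l x) (\<lambda>x. V0 l x + c * V1 l x) x0 \<le> 0"
    using form_mono[OF is_pair_combination T co, of c] by (simp add: xT_def)
  define e where "e = exp (x0\<^sup>2 / 2)"
  define e' where "e' = exp (- x0\<^sup>2 / 2)"
  have ee: "e * e' = 1" by (simp add: e_def e'_def mult_exp_exp)
  have Fd: "F0 l x0 + c * F1 l x0 = d * F1 l x0"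
    using nz0 by (simp add: d_def quot_def field_simps)
  \<comment> \<open>The Wronskian splits the flux into d V1 and a term free of d, so the form
    becomes |d|^2 \<phi> plus a term linear in d.\<close>
  have Vd: "V0 l x0 + c * V1 l x0 = d * V1 l x0 - x0 / F1 l x0"
  proof -
    have "x0 / F1 l x0 = quot l x0 * V1 l x0 - V0 l x0"
      using wronskian[OF w, of l] nz0 by (simp add: quot_def field_simps)
    then show ?thesis by (simp add: d_def algebra_simps)
  qed
  have "\<kappa> * (e * (d * V1 l x0 - x0 / F1 l x0)) * cnj (e' * (d * F1 l x0)) =
      (d * cnj d) * (\<kappa> * (e * V1 l x0) * cnj (e' * F1 l x0)) - \<kappa> * (e * (x0 / F1 l x0)) * cnj (e' * (d * F1 l x0))"
    by (simp add: algebra_simps)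
  also have "d * cnj d = of_real ((cmod d)\<^sup>2)" by (simp add: complex_norm_square[symmetric])
  finally have "form \<kappa> (\<lambda>x. F0 l x + c * F1 l x) (\<lambda>x. V0 l x + c * V1 l x) x0 =
      (cmod d)\<^sup>2 * \<phi> + Im (\<kappa> * (e * (x0 / F1 l x0)) * cnj (e' * (d * F1 l x0)))"
    unfolding form_def \<phi>_def Fd Vd e_def[symmetric] e'_def[symmetric]
    by (simp only: Im_mult_real minus_complex.simps)
  with neg have "(cmod d)\<^sup>2 * \<phi> \<le> \<bar>Im (\<kappa> * (e * (x0 / F1 l x0)) * cnj (e' * (d * F1 l x0)))\<bar>" by linarith
  also have "\<dots> \<le> cmod (\<kappa> * (e * (x0 / F1 l x0)) * cnj (e' * (d * F1 l x0)))" by (rule abs_Im_le_cmod)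
  \<comment> \<open>\<open>e\<close> and \<open>cnj e'\<close> need not cancel, but their moduli do,
    because e e' = 1.\<close>
  also have "\<dots> = cmod \<kappa> * cmod (e * e') * cmod x0 * cmod d"
    using nz0 unfolding norm_mult complex_mod_cnj norm_divide by simp
  also have "\<dots> = cmod \<kappa> * (cmod x0 * cmod d)" by (simp add: ee)
  also have "\<dots> \<le> 2 * (cmod x0 * cmod d)" using k by (intro mult_right_mono) auto
  finally have "cmod d * (cmod d * \<phi>) \<le> cmod d * (2 * cmod x0)" by (simp add: power2_eq_square mult_ac)
  then have "cmod d * \<phi> \<le> 2 * cmod x0"
    by (cases "d = 0") (auto simp: mult_le_cancel_left)
  then have "cmod d \<le> 2 * cmod x0 / \<phi>" using pos by (simp add: \<phi>_def field_simps)
  moreover have "d = - (quot l xT - quot l x0)" by (simp add: d_def c_def)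
  ultimately show ?thesis by (simp add: \<phi>_def xT_def norm_minus_commute)
qed

text \<open>On the real axis the form divided by \<open>x\<close> is monotone from \<open>0\<close> onwards, since its
  derivative contains no cross term.\<close>

lemma real_form_nonneg:
  assumes k: "0 \<le> Im (\<kappa> * l)" "Im \<kappa> \<le> 0" and t: "0 < t"
  shows "0 \<le> form \<kappa> (F1 l) (V1 l) (of_real t)"
    and "0 < Im (\<kappa> * l) \<Longrightarrow> Im \<kappa> < 0 \<Longrightarrow> 0 < form \<kappa> (F1 l) (V1 l) (of_real t)"
proof -
  define G where "G = (\<lambda>t. - Im (\<kappa> * (V1 l (of_real t) * cnj (reg_u l t))))"
  have form_G: "form \<kappa> (F1 l) (V1 l) (of_real t) = t * G t" if "0 < t" for t
  proof -
    have ee: "exp ((complex_of_real t)\<^sup>2 / 2) * cnj (exp (- (complex_of_real t)\<^sup>2 / 2)) = 1"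
      by (simp add: exp_cnj mult_exp_exp)
    have "\<kappa> * (e * V) * cnj (e' * F) = \<kappa> * (V * cnj F)" if "e * cnj e' = 1" for e e' V F
    proof -
      have "\<kappa> * (e * V) * cnj (e' * F) = \<kappa> * (V * cnj F) * (e * cnj e')" by simp
      then show ?thesis using that by simp
    qed
    from this[OF ee] have *: "\<kappa> * (exp ((of_real t)\<^sup>2 / 2) * V1 l (of_real t)) * cnj (exp (- (of_real t)\<^sup>2 / 2) * F1 l (of_real t))
       = \<kappa> * (V1 l (of_real t) * cnj (F1 l (of_real t)))" .
    have Fr: "F1 l (of_real t) = of_real t * reg_u l t" using that by (simp add: reg_u_def)
    have "\<kappa> * (V1 l (of_real t) * cnj (F1 l (of_real t))) = of_real t * (\<kappa> * (V1 l (of_real t) * cnj (reg_u l t)))"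
      unfolding Fr by (simp only: complex_cnj_mult complex_cnj_complex_of_real mult_ac)
    with * have "\<kappa> * (exp ((of_real t)\<^sup>2 / 2) * V1 l (of_real t)) * cnj (exp (- (of_real t)\<^sup>2 / 2) * F1 l (of_real t))
       = of_real t * (\<kappa> * (V1 l (of_real t) * cnj (reg_u l t)))"
      by (rule trans)
    then show ?thesis unfolding form_def G_def by (simp only: Im_mult_real)
  qed
  define G' where "G' = (\<lambda>t. Im (\<kappa> * l) * weight t * (cmod (reg_u l t))\<^sup>2 + - Im \<kappa> / (Psi t * weight t) * (cmod (V1 l (of_real t)))\<^sup>2)"
  have dG: "(G has_real_derivative G' t) (at t)" if t: "0 < t" for t
  proof -
    let ?u' = "V1 l (of_real t) / of_real (Psi t * weight t)"
    have u: "(reg_u l has_vector_derivative ?u') (at t)"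
      using sl_solution_flux(1)[OF reg_u_sl(1) t] reg_u_sl(2)[OF t] by simp
    have V: "((\<lambda>t. V1 l (of_real t)) has_vector_derivative - (l * of_real (weight t) * reg_u l t)) (at t)"
      by (rule has_vector_derivative_transform_within_open[OF sl_solution_flux(2)[OF reg_u_sl(1) t], of "{0<..}"])
         (use t reg_u_sl(2) in auto)
    have uc: "((\<lambda>t. cnj (reg_u l t)) has_vector_derivative cnj ?u') (at t)"
      by (rule bounded_linear.has_vector_derivative[OF bounded_linear_cnj u])
    have "((\<lambda>t. \<kappa> * (V1 l (of_real t) * cnj (reg_u l t))) has_vector_derivative
       \<kappa> * (V1 l (of_real t) * cnj ?u' + - (l * of_real (weight t) * reg_u l t) * cnj (reg_u l t))) (at t)"
      by (intro has_vector_derivative_mult_right has_vector_derivative_mult V uc)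
    also have "\<kappa> * (V1 l (of_real t) * cnj ?u' + - (l * of_real (weight t) * reg_u l t) * cnj (reg_u l t)) =
       \<kappa> * of_real (1 / (Psi t * weight t)) * (V1 l (of_real t) * cnj (V1 l (of_real t))) -
       \<kappa> * l * of_real (weight t) * (reg_u l t * cnj (reg_u l t))"
      by (simp add: algebra_simps)
    also have "\<dots> = \<kappa> * of_real ((cmod (V1 l (of_real t)))\<^sup>2 / (Psi t * weight t)) -
       \<kappa> * l * of_real (weight t * (cmod (reg_u l t))\<^sup>2)"
      by (simp only: complex_norm_square[symmetric] of_real_mult of_real_divide) (simp add: mult_ac)
    finally have "((\<lambda>t. \<kappa> * (V1 l (of_real t) * cnj (reg_u l t))) has_vector_derivative
      \<kappa> * of_real ((cmod (V1 l (of_real t)))\<^sup>2 / (Psi t * weight t)) -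
       \<kappa> * l * of_real (weight t * (cmod (reg_u l t))\<^sup>2)) (at t)" .
    from has_vector_derivative_minus[OF bounded_linear.has_vector_derivative[OF bounded_linear_Im this]]
    have "(G has_real_derivative - Im (\<kappa> * of_real ((cmod (V1 l (of_real t)))\<^sup>2 / (Psi t * weight t)) -
       \<kappa> * l * of_real (weight t * (cmod (reg_u l t))\<^sup>2))) (at t)"
      unfolding G_def has_real_derivative_iff_has_vector_derivative .
    also have "- Im (\<kappa> * of_real ((cmod (V1 l (of_real t)))\<^sup>2 / (Psi t * weight t)) -
       \<kappa> * l * of_real (weight t * (cmod (reg_u l t))\<^sup>2)) = G' t"
      unfolding G'_def minus_complex.simps Im_mult_real by simp
    finally show ?thesis .
  qed
  have pw: "0 < Psi t * weight t" "0 < weight t" if "0 < t" for t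
    using Psi_pos weight_pos that by auto
  have G'0: "0 \<le> G' t" if "0 < t" for t
  proof -
    have "0 \<le> Im (\<kappa> * l) * weight t"
      by (rule mult_nonneg_nonneg[OF k(1)]) (use pw[OF that] in simp)
    moreover have "0 \<le> - Im \<kappa> / (Psi t * weight t)"
      by (rule divide_nonneg_pos[OF _ pw(1)[OF that]]) (use k in simp)
    ultimately show ?thesis unfolding G'_def
      by (intro add_nonneg_nonneg mult_nonneg_nonneg[OF _ zero_le_power2])
  qed
  have mono: "G s \<le> G t" if "0 < s" "s \<le> t" for s t
  proof (rule DERIV_nonneg_imp_nondecreasing[where f = G, OF that(2)])
    fix r assume "s \<le> r" "r \<le> t"
    then have "0 < r" using that by simp
    then show "\<exists>y. (G has_real_derivative y) (at r) \<and> 0 \<le> y" using dG G'0 by blast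
  qed
  \<comment> \<open>Start value at 0: the flux vanishes there while \<open>reg_u\<close> tends to
    1.\<close>
  have "((\<lambda>t. V1 l (of_real t)) \<longlongrightarrow> 0) (at_right 0)"
    using tendsto_dom_at_right[OF V_hol(1), of l] by (simp add: V1_0)
  then have "(G \<longlongrightarrow> - Im (\<kappa> * (0 * cnj 1))) (at_right 0)"
    unfolding G_def by (intro tendsto_intros reg_u_tendsto)
  then have G0: "(G \<longlongrightarrow> 0) (at_right 0)" by simp
  have Gnn: "0 \<le> G t" if t: "0 < t" for t
  proof (rule tendsto_upperbound[OF G0])
    show "\<forall>\<^sub>F s in at_right 0. G s \<le> G t"
      using t mono by (auto simp: eventually_at_right_field intro!: exI[of _ t])
  qed simp
  show "0 \<le> form \<kappa> (F1 l) (V1 l) (of_real t)" using form_G[OF t] Gnn[OF t] t by simp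
  assume st: "0 < Im (\<kappa> * l)" "Im \<kappa> < 0"
  \<comment> \<open>G is already nonnegative at t/2, so a strict increase from there to t gives
    positivity.\<close>
  have "G (t / 2) < G t"
  proof (rule DERIV_pos_imp_increasing[where f = G])
    fix s assume "t / 2 \<le> s" "s \<le> t"
    then have s: "0 < s" using t by simp
    have "reg_u l s \<noteq> 0 \<or> V1 l (of_real s) \<noteq> 0"
      using pair1_nonzero[OF of_real_wedge[OF s], of l] s by (auto simp: reg_u_def)
    moreover have "0 < Im (\<kappa> * l) * weight s"
      by (rule mult_pos_pos[OF st(1) pw(2)[OF s]])
    moreover have "0 < - Im \<kappa> / (Psi s * weight s)"
      by (rule divide_pos_pos[OF _ pw(1)[OF s]]) (use st in simp)
    moreover have "0 < A * (cmod u)\<^sup>2 + B * (cmod v)\<^sup>2" if "u \<noteq> 0 \<or> v \<noteq> 0" "0 < A" "0 < B" for A B u v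
      using that by (auto intro: add_pos_nonneg add_nonneg_pos)
    ultimately have "0 < G' s" unfolding G'_def by blast
    then show "\<exists>y. (G has_real_derivative y) (at s) \<and> 0 < y" using dG[OF s] by blast
  qed (use t in simp)
  then have "0 < G t" using Gnn[of "t / 2"] t by simp
  then show "0 < form \<kappa> (F1 l) (V1 l) (of_real t)" using form_G[OF t] t by simp
qed

section \<open>Coercive directions in a sector\<close>

text \<open>The slope 1/20 keeps it inside the wedge of slope 1/10. Its lower edge runs along the
  axis and its upper edge has the direction \<omega>, so horizontal and oblique paths stay
  inside.\<close>

definition sector :: "real \<Rightarrow> complex set" where
  "sector R = {x. R \<le> Re x \<and> 0 \<le> Im x \<and> Im x \<le> Re x / 20}"

lemma sector_bounds:
  assumes "x \<in> sector R" "1 \<le> R"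
  shows "x \<in> wedge" "Re x \<le> cmod x" "cmod x \<le> 2 * Re x" "(cmod x)\<^sup>2 \<le> 401 / 400 * (Re x)\<^sup>2" "1 \<le> Re x"
proof -
  have r: "1 \<le> Re x" "0 \<le> Im x" "Im x \<le> Re x / 20" using assms by (auto simp: sector_def)
  show "1 \<le> Re x" by (rule r)
  show "x \<in> wedge" using r by (auto simp: wedge_def)
  show "Re x \<le> cmod x" by (rule complex_Re_le_cmod)
  show "cmod x \<le> 2 * Re x" using cmod_le[of x] r by linarith
  have "(Im x)\<^sup>2 \<le> (Re x / 20)\<^sup>2" using r by (intro power_mono) auto
  then show "(cmod x)\<^sup>2 \<le> 401 / 400 * (Re x)\<^sup>2" by (simp add: cmod_power2 power_divide)
qed

text \<open>1/(x \<open>CPsi\<close>) equals (sqrt pi / 2) x^2 / \<open>CI\<close>, and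
  \<open>CI\<close> is close to its value at Re x. The factor s varies with x but is real and
  bounded below, which is all that a sign condition on imaginary parts needs.\<close>

lemma Psi_asymptotics:
  assumes x: "x \<in> sector 18"
  shows "\<exists>s\<ge>1/8. cmod (1 / (x * CPsi x) - of_real s * x\<^sup>2) \<le> 200 / Re x * (cmod x)\<^sup>2"
proof -
  have r: "18 \<le> Re x" "0 \<le> Im x" "Im x \<le> Re x / 20" using x by (auto simp: sector_def)
  define G where "G = gauss2 (Re x)"
  define k where "k = sqrt pi / 2"
  have sp: "1 \<le> sqrt pi" "sqrt pi \<le> 2" using pi_ge_two pi_less_4
    by (auto intro!: real_le_lsqrt)
  have k: "1 / 2 \<le> k" "k \<le> 1" using sp by (auto simp: k_def)
  have G: "1 / 9 \<le> G" "G \<le> 4" using gauss2_ge gauss2_le r by (auto simp: G_def)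
  have diff: "cmod (CI x - of_real G) \<le> 1 / (2 * Re x)"
    unfolding G_def by (rule CI_diff_far) (use r in auto)
  \<comment> \<open>The bound 18 enters here: 1/9 - 1/36 = 1/12 bounds |\<open>CI x\<close>| from
    below.\<close>
  have "1 / (2 * Re x) \<le> 1 / 36" using r by (simp add: field_simps)
  then have CIn: "1 / 12 \<le> cmod (CI x)"
    using diff G norm_triangle_ineq2[of "of_real G" "of_real G - CI x"]
    by (simp add: norm_minus_commute)
  have nz: "CI x \<noteq> 0" using CIn by auto
  have x0: "x \<noteq> 0" using r by auto
  have e: "1 / (x * CPsi x) = of_real k * x\<^sup>2 / CI x"
    using x0 nz by (simp add: CPsi_CI k_def field_simps power2_eq_square power3_eq_cube)
  have "1 / (x * CPsi x) - of_real (k / G) * x\<^sup>2 = of_real k * x\<^sup>2 * ((of_real G - CI x) / (CI x * of_real G))"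
    unfolding e using nz G by (simp add: field_simps)
  then have "cmod (1 / (x * CPsi x) - of_real (k / G) * x\<^sup>2) =
      k * (cmod x)\<^sup>2 * (cmod (CI x - of_real G) / (cmod (CI x) * G))"
    using k G by (simp add: norm_mult norm_divide norm_power norm_minus_commute)
  \<comment> \<open>These constants give 54/Re x, generously rounded up to 200/Re x.\<close>
  also have "\<dots> \<le> 1 * (cmod x)\<^sup>2 * ((1 / (2 * Re x)) / ((1 / 12) * (1 / 9)))"
    using k G CIn diff r by (intro mult_mono frac_le) auto
  also have "\<dots> \<le> 200 / Re x * (cmod x)\<^sup>2"
    using r by (simp add: divide_simps)
  finally have "cmod (1 / (x * CPsi x) - of_real (k / G) * x\<^sup>2) \<le> 200 / Re x * (cmod x)\<^sup>2" .
  moreover have "1 / 8 \<le> k / G" using k G by (simp add: field_simps)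
  ultimately show ?thesis by blast
qed

text \<open>Replaces the coefficient 1/(x \<Psi>) by x^2: since s \<ge> 1/8 the main part keeps at
  least a0/8, the error takes at most a0/16, and coercivity holds with a = a0/16.\<close>

lemma coercive_criterion:
  assumes a0: "0 < a0"
  shows "\<exists>R\<ge>1. \<forall>\<kappa> l \<gamma> x. x \<in> sector R \<longrightarrow> cmod \<kappa> \<le> 2 \<longrightarrow> cmod \<gamma> \<le> 2 \<longrightarrow>
     a0 * cmod x \<le> Im (\<kappa> * l * \<gamma> * x) \<longrightarrow> a0 * (cmod x)\<^sup>2 \<le> Im (cnj \<kappa> * \<gamma> * x\<^sup>2) \<longrightarrow> coercive \<kappa> l \<gamma> x"
proof -
  \<comment> \<open>12800/a0 makes 200/Re x at most a0/64, which |\<kappa>| |\<gamma>| \<le> 4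
    raises to a0/16; 43 * 256/a0^2 is 43 (16/a0)^2; 18 is the range of
    \<open>Psi_asymptotics\<close>.\<close>
  define R where "R = max 18 (max (12800 / a0) (43 * 256 / a0\<^sup>2))"
  have R: "18 \<le> R" "12800 / a0 \<le> R" "43 * 256 / a0\<^sup>2 \<le> R" by (auto simp: R_def)
  have "coercive \<kappa> l \<gamma> x" if x: "x \<in> sector R" and \<kappa>: "cmod \<kappa> \<le> 2" and \<gamma>: "cmod \<gamma> \<le> 2"
    and A: "a0 * cmod x \<le> Im (\<kappa> * l * \<gamma> * x)" and B: "a0 * (cmod x)\<^sup>2 \<le> Im (cnj \<kappa> * \<gamma> * x\<^sup>2)" for \<kappa> l \<gamma> x
  proof -
    have R1: "1 \<le> R" using R by linarith
    note sb = sector_bounds[OF x R1]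
    have rx: "R \<le> Re x" using x by (simp add: sector_def)
    have "x \<in> sector 18" using x R by (auto simp: sector_def)
    from Psi_asymptotics[OF this] obtain s where s: "1 / 8 \<le> s"
      and ds: "cmod (1 / (x * CPsi x) - of_real s * x\<^sup>2) \<le> 200 / Re x * (cmod x)\<^sup>2" by blast
    define E where "E = 1 / (x * CPsi x) - of_real s * x\<^sup>2"
    have "cmod (cnj \<kappa> * \<gamma> * E) \<le> 2 * 2 * (200 / Re x * (cmod x)\<^sup>2)"
      unfolding norm_mult complex_mod_cnj E_def by (intro mult_mono \<kappa> \<gamma> ds) auto
    moreover have "200 / Re x * (cmod x)\<^sup>2 \<le> a0 / 64 * (cmod x)\<^sup>2"
    proof -
      have "12800 / a0 \<le> Re x" using rx R by linarith
      then have "200 / Re x \<le> a0 / 64" using a0 sb(5) by (simp add: field_simps)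
      then show ?thesis by (rule mult_right_mono) simp
    qed
    ultimately have "cmod (cnj \<kappa> * \<gamma> * E) \<le> 2 * 2 * (a0 / 64 * (cmod x)\<^sup>2)" by linarith
    then have E: "- (a0 / 16 * (cmod x)\<^sup>2) \<le> Im (cnj \<kappa> * \<gamma> * E)"
      using abs_Im_le_cmod[of "cnj \<kappa> * \<gamma> * E"] by linarith
    have "cnj \<kappa> * \<gamma> / (x * CPsi x) = of_real s * (cnj \<kappa> * \<gamma> * x\<^sup>2) + cnj \<kappa> * \<gamma> * E"
      by (simp add: E_def algebra_simps)
    then have eq: "Im (cnj \<kappa> * \<gamma> / (x * CPsi x)) = s * Im (cnj \<kappa> * \<gamma> * x\<^sup>2) + Im (cnj \<kappa> * \<gamma> * E)"
      by (simp only: plus_complex.simps Im_mult_real)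
    have "1 / 8 * (a0 * (cmod x)\<^sup>2) \<le> s * Im (cnj \<kappa> * \<gamma> * x\<^sup>2)"
      using s B a0 by (intro mult_mono) auto
    then have B': "a0 / 16 * (cmod x)\<^sup>2 \<le> Im (cnj \<kappa> * \<gamma> / (x * CPsi x))"
      unfolding eq using E by linarith
    have "43 * 256 / a0\<^sup>2 \<le> cmod x" using rx R sb(2) by linarith
    then have C: "43 \<le> (a0 / 16)\<^sup>2 * cmod x" using a0 by (simp add: field_simps power2_eq_square)
    have "0 \<le> a0 * cmod x" using a0 by simp
    then have A': "a0 / 16 * cmod x \<le> Im (\<kappa> * l * \<gamma> * x)" using A by linarith
    have "1 \<le> cmod x" using sb by linarith
    then show ?thesis unfolding coercive_def using sb(1) \<kappa> \<gamma> A' B' C a0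
      by (intro conjI exI[of _ "a0 / 16"]) auto
  qed
  then show ?thesis using R by (intro exI[of _ R]) auto
qed

definition \<omega> :: complex where
  "\<omega> = Complex 1 (1 / 20)"

lemma norm_\<omega>: "cmod \<omega> \<le> 2"
  using cmod_le[of \<omega>] by (simp add: \<omega>_def)

lemma Im_perturb:
  assumes "cmod (w - v) * cmod x \<le> e"
  shows "Im (v * x) - e \<le> Im (w * x)"
proof -
  have "Im (v * x) - Im (w * x) = - Im ((w - v) * x)" by (simp add: algebra_simps)
  also have "\<dots> \<le> cmod ((w - v) * x)" using abs_Im_le_cmod[of "(w - v) * x"] by linarith
  also have "\<dots> \<le> e" using assms by (simp add: norm_mult)
  finally show ?thesis by simp
qed

text \<open>At l = \<tau> and \<kappa> = 1 both quantities are positive, as Im (\<omega> x) \<ge>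
  |x|/40 and Im (\<omega> x^2) \<ge> |x|^2/25, and this survives small changes of l and \<kappa>.
  The freedom in \<kappa> is spent in \<open>quot_real_limit\<close>.\<close>

lemma coercive_oblique:
  assumes \<tau>: "0 < \<tau>"
  shows "\<exists>\<epsilon>>0. \<exists>R\<ge>1. \<forall>\<kappa> l x. cmod (l - of_real \<tau>) < \<epsilon> \<longrightarrow> cmod (\<kappa> - 1) < \<epsilon> \<longrightarrow> x \<in> sector R \<longrightarrow> coercive \<kappa> l \<omega> x"
proof -
  \<comment> \<open>Half of the available \<tau>/40 and 1/25; the other half is left for the
    perturbation that \<epsilon> allows.\<close>
  define a0 where "a0 = min (\<tau> / 80) (1 / 50)"
  have a0: "0 < a0" "a0 \<le> \<tau> / 80" "a0 \<le> 1 / 50" using \<tau> by (auto simp: a0_def)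
  define \<epsilon> where "\<epsilon> = min (1 / 100) (\<tau> / (160 * (\<tau> + 2)))"
  have \<epsilon>: "0 < \<epsilon>" "\<epsilon> \<le> 1 / 100" "\<epsilon> \<le> \<tau> / (160 * (\<tau> + 2))" using \<tau> by (auto simp: \<epsilon>_def)
  obtain R where R: "1 \<le> R" and co: "\<And>\<kappa> l \<gamma> x. x \<in> sector R \<Longrightarrow> cmod \<kappa> \<le> 2 \<Longrightarrow> cmod \<gamma> \<le> 2 \<Longrightarrow>
     a0 * cmod x \<le> Im (\<kappa> * l * \<gamma> * x) \<Longrightarrow> a0 * (cmod x)\<^sup>2 \<le> Im (cnj \<kappa> * \<gamma> * x\<^sup>2) \<Longrightarrow> coercive \<kappa> l \<gamma> x"
    using coercive_criterion[OF a0(1)] by metis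
  have "coercive \<kappa> l \<omega> x" if l: "cmod (l - of_real \<tau>) < \<epsilon>" and k: "cmod (\<kappa> - 1) < \<epsilon>" and x: "x \<in> sector R" for \<kappa> l x
  proof (rule co[OF x _ norm_\<omega>])
    note sb = sector_bounds[OF x R]
    have r: "0 \<le> Im x" "Im x \<le> Re x / 20" using x by (auto simp: sector_def)
    show "cmod \<kappa> \<le> 2" using k \<epsilon>(2) norm_triangle_sub[of \<kappa> 1] by simp
    have "Re x / 20 \<le> Im (\<omega> * x)" using r by (simp add: \<omega>_def)
    then have i1: "cmod x / 40 \<le> Im (\<omega> * x)" using sb(3) by linarith
    have "\<kappa> * l - of_real \<tau> = (\<kappa> - 1) * l + (l - of_real \<tau>)" by (simp add: algebra_simps)
    then have "cmod (\<kappa> * l - of_real \<tau>) \<le> cmod (\<kappa> - 1) * cmod l + cmod (l - of_real \<tau>)"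
      by (metis norm_mult norm_triangle_ineq)
    also have "cmod (\<kappa> - 1) * cmod l \<le> \<epsilon> * (\<tau> + 1)"
    proof (rule mult_mono)
      show "cmod l \<le> \<tau> + 1" using norm_triangle_sub[of l "of_real \<tau>"] l \<epsilon>(2) \<tau> by simp
    qed (use k \<epsilon> in auto)
    finally have "cmod (\<kappa> * l - of_real \<tau>) \<le> \<epsilon> * (\<tau> + 2)"
      using l by (simp add: algebra_simps)
    also have "\<dots> \<le> \<tau> / 160" using \<epsilon>(3) \<tau> by (simp add: field_simps)
    finally have d: "cmod (\<kappa> * l - of_real \<tau>) \<le> \<tau> / 160" by (simp add: mult_left_mono)
    have "cmod (\<kappa> * l - of_real \<tau>) * cmod (\<omega> * x) \<le> \<tau> / 160 * (2 * cmod x)"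
      unfolding norm_mult[of \<omega>] by (intro mult_mono d mult_right_mono norm_\<omega>) (use \<tau> in auto)
    from Im_perturb[OF this] have "\<tau> * Im (\<omega> * x) - \<tau> / 160 * (2 * cmod x) \<le> Im (\<kappa> * l * \<omega> * x)"
      by (simp only: Im_mult_real mult.assoc)
    moreover have "\<tau> * (cmod x / 40) \<le> \<tau> * Im (\<omega> * x)" using i1 \<tau> by (intro mult_left_mono) auto
    moreover have "a0 * cmod x \<le> \<tau> / 80 * cmod x" using a0 by (intro mult_right_mono) auto
    ultimately show "a0 * cmod x \<le> Im (\<kappa> * l * \<omega> * x)" by (simp add: field_simps)
    have "(Im x)\<^sup>2 \<le> (Re x / 20)\<^sup>2" using r by (intro power_mono) auto
    then have im2: "(Im x)\<^sup>2 \<le> (Re x)\<^sup>2 / 400" by (simp add: power_divide)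
    have "0 \<le> Re x * Im x" using r sb by simp
    moreover have "Im (\<omega> * x\<^sup>2) = 2 * (Re x * Im x) + ((Re x)\<^sup>2 - (Im x)\<^sup>2) / 20"
      by (simp add: \<omega>_def power2_eq_square)
    moreover have "n / 25 \<le> 2 * p + (q - s) / 20"
      if "0 \<le> p" "s \<le> q / 400" "n \<le> 401 / 400 * q" "0 \<le> q" for n p q s :: real
    proof -
      have "(q - s) / 20 = q / 20 - s / 20" by (rule diff_divide_distrib)
      then show ?thesis using that by linarith
    qed
    ultimately have i2: "(cmod x)\<^sup>2 / 25 \<le> Im (\<omega> * x\<^sup>2)" using im2 sb(4) zero_le_power2[of "Re x"] by presburger
    have "cmod (cnj \<kappa> - 1) = cmod (\<kappa> - 1)" by (metis complex_cnj_diff complex_cnj_one complex_mod_cnj)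
    then have "cmod (cnj \<kappa> - 1) * cmod (\<omega> * x\<^sup>2) \<le> 1 / 100 * (2 * (cmod x)\<^sup>2)"
      unfolding norm_mult[of \<omega>] norm_power by (intro mult_mono mult_right_mono norm_\<omega>) (use k \<epsilon> in auto)
    from Im_perturb[OF this] have "Im (\<omega> * x\<^sup>2) - 1 / 100 * (2 * (cmod x)\<^sup>2) \<le> Im (cnj \<kappa> * \<omega> * x\<^sup>2)"
      by (simp only: mult_1_left mult.assoc)
    moreover have "a0 * (cmod x)\<^sup>2 \<le> 1 / 50 * (cmod x)\<^sup>2" using a0 by (intro mult_right_mono) auto
    ultimately show "a0 * (cmod x)\<^sup>2 \<le> Im (cnj \<kappa> * \<omega> * x\<^sup>2)" using i2 by linarith
  qed
  then show ?thesis using \<epsilon>(1) R by blast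
qed

text \<open>On the real axis \<kappa> = 1 gives Im (cnj \<kappa> x^2) = 0, so the tilt -\<beta> must
  supply the second condition. It costs \<beta> Re (l x) in the first, at most half of Im l Re x by
  the last bound on \<beta>.\<close>

lemma coercive_horizontal:
  assumes l: "0 < Re l" "0 < Im l" and b: "0 < \<beta>" "\<beta> \<le> 1" "\<beta> \<le> Im l / (4 * cmod l)"
  shows "\<exists>R\<ge>1. \<forall>x\<in>sector R. coercive (Complex 1 (- \<beta>)) l 1 x"
proof -
  define a0 where "a0 = min (Im l / 4) (\<beta> / 2)"
  have a0: "0 < a0" "a0 \<le> Im l / 4" "a0 \<le> \<beta> / 2" using l b by (auto simp: a0_def)
  obtain R where R: "1 \<le> R" and co: "\<And>\<kappa> l \<gamma> x. x \<in> sector R \<Longrightarrow> cmod \<kappa> \<le> 2 \<Longrightarrow> cmod \<gamma> \<le> 2 \<Longrightarrow>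
     a0 * cmod x \<le> Im (\<kappa> * l * \<gamma> * x) \<Longrightarrow> a0 * (cmod x)\<^sup>2 \<le> Im (cnj \<kappa> * \<gamma> * x\<^sup>2) \<Longrightarrow> coercive \<kappa> l \<gamma> x"
    using coercive_criterion[OF a0(1)] by metis
  have "coercive (Complex 1 (- \<beta>)) l 1 x" if x: "x \<in> sector R" for x
  proof (rule co[OF x])
    let ?\<kappa> = "Complex 1 (- \<beta>)"
    note sb = sector_bounds[OF x R]
    have r: "0 \<le> Im x" "Im x \<le> Re x / 20" using x by (auto simp: sector_def)
    show "cmod ?\<kappa> \<le> 2" using cmod_le[of ?\<kappa>] b by simp
    have l0: "0 < cmod l" using l by auto
    have "\<bar>Re (l * x)\<bar> \<le> cmod l * (2 * Re x)"
      using abs_Re_le_cmod[of "l * x"] sb(3) mult_left_mono[OF sb(3), of "cmod l"] by (simp add: norm_mult del: times_complex.sel)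
    then have "\<beta> * Re (l * x) \<le> \<beta> * (cmod l * (2 * Re x))"
      using b by (intro mult_left_mono) auto
    also have "\<dots> \<le> Im l / (4 * cmod l) * (cmod l * (2 * Re x))"
      using b sb by (intro mult_right_mono) auto
    also have "\<dots> = Im l * Re x / 2" using l0 by simp
    finally have 1: "\<beta> * Re (l * x) \<le> Im l * Re x / 2" .
    have "Im l * Re x \<le> Im (l * x)" using l r by simp
    moreover have "Im (?\<kappa> * l * 1 * x) = Im (l * x) - \<beta> * Re (l * x)" by (simp add: algebra_simps)
    moreover have "a0 * cmod x \<le> Im l / 4 * (2 * Re x)"
      using a0 sb l by (intro mult_mono) auto
    ultimately show "a0 * cmod x \<le> Im (?\<kappa> * l * 1 * x)" using 1 by simp
    have "(Im x)\<^sup>2 \<le> (Re x / 20)\<^sup>2" using r by (intro power_mono) auto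
    then have im2: "(Im x)\<^sup>2 \<le> (Re x)\<^sup>2 / 400" by (simp add: power_divide)
    have "(cmod x)\<^sup>2 / 2 \<le> (Re x)\<^sup>2 - (Im x)\<^sup>2" using im2 sb(4) zero_le_power2[of "Re x"] by linarith
    then have "\<beta> * ((cmod x)\<^sup>2 / 2) \<le> \<beta> * ((Re x)\<^sup>2 - (Im x)\<^sup>2)" using b by (intro mult_left_mono) auto
    moreover have "Im (cnj ?\<kappa> * 1 * x\<^sup>2) = 2 * (Re x * Im x) + \<beta> * ((Re x)\<^sup>2 - (Im x)\<^sup>2)"
      by (simp add: power2_eq_square algebra_simps)
    moreover have "0 \<le> Re x * Im x" using r sb by simp
    moreover have "a0 * (cmod x)\<^sup>2 \<le> \<beta> / 2 * (cmod x)\<^sup>2" using a0 by (intro mult_right_mono) auto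
    ultimately show "a0 * (cmod x)\<^sup>2 \<le> Im (cnj ?\<kappa> * 1 * x\<^sup>2)" by simp
  qed simp
  then show ?thesis using R by blast
qed

lemma sector_oblique: "x \<in> sector R \<Longrightarrow> 0 \<le> t \<Longrightarrow> x + \<omega> * of_real t \<in> sector R"
  by (auto simp: sector_def \<omega>_def)

lemma sector_horizontal: "x \<in> sector R \<Longrightarrow> 0 \<le> t \<Longrightarrow> x + 1 * of_real t \<in> sector R"
  by (auto simp: sector_def)

lemma of_real_sector: "1 \<le> R \<Longrightarrow> R \<le> r \<Longrightarrow> of_real r \<in> sector R"
  by (auto simp: sector_def)

section \<open>Continuation of the m-function across the positive axis\<close>

lemma affine_div_exp_tendsto: "((\<lambda>s::real. (A + B * s) / exp (s / 2)) \<longlongrightarrow> 0) at_top"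
proof -
  have half: "filterlim (\<lambda>s::real. s / 2) at_top at_top"
    by (rule filterlim_at_top_mult_tendsto_pos[OF tendsto_const _ filterlim_ident, of "1/2", simplified]) 
  have p: "((\<lambda>s::real. (s / 2) ^ k / exp (s / 2)) \<longlongrightarrow> 0) at_top" for k
    by (rule filterlim_compose[OF tendsto_power_div_exp_0 half])
  have "((\<lambda>s::real. A * ((s / 2) ^ 0 / exp (s / 2)) + 2 * B * ((s / 2) ^ 1 / exp (s / 2))) \<longlongrightarrow> A * 0 + 2 * B * 0) at_top"
    by (intro tendsto_intros p)
  then show ?thesis by (simp add: add_divide_distrib)
qed

lemma form_param_continuous:
  assumes "x \<in> sl_domain"
  shows "isCont (\<lambda>l. form \<kappa> (F1 l) (V1 l) x) l"
proof -
  have c: "isCont (\<lambda>l. F1 l x) l" "isCont (\<lambda>l. V1 l x) l"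
    using F_param_hol(1,3)[OF assms, of UNIV, THEN holomorphic_on_imp_continuous_on]
    by (simp_all add: continuous_on_eq_continuous_at)
  show ?thesis unfolding form_def by (intro continuous_intros isCont_Im isCont_cnj c)
qed

text \<open>Start value for the oblique ray at real \<tau>, by continuity in the parameter from the
  upper half-plane.\<close>

lemma form_nonneg_real_param:
  assumes \<tau>: "0 \<le> \<tau>" and t: "0 < t"
  shows "0 \<le> form 1 (F1 (of_real \<tau>)) (V1 (of_real \<tau>)) (of_real t)"
proof -
  have x: "complex_of_real t \<in> sl_domain" using t by (intro wedge_dom of_real_wedge)
  have "((\<lambda>e. Complex \<tau> e) \<longlongrightarrow> of_real \<tau>) (at_right 0)"
    by (auto intro!: tendsto_eq_intros simp: Complex_eq)
  from isCont_tendsto_compose[OF form_param_continuous[OF x] this, of 1]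
  have "((\<lambda>e. form 1 (F1 (Complex \<tau> e)) (V1 (Complex \<tau> e)) (of_real t)) \<longlongrightarrow>
     form 1 (F1 (of_real \<tau>)) (V1 (of_real \<tau>)) (of_real t)) (at_right 0)" .
  then show ?thesis
    by (rule tendsto_lowerbound) (auto intro!: eventually_at_right_pos real_form_nonneg(1) t)
qed

text \<open>\<open>quot_diff\<close> restarted at x + \<omega> s, where the form has gained e^(s/2)
  while the modulus of the point grew only linearly. The constant \<open>c\<close> in place of the
  form makes the bound uniform in l.\<close>

lemma quot_oblique_bound:
  assumes co: "\<And>x. x \<in> sector R \<Longrightarrow> coercive \<kappa> l \<omega> x"
    and x: "x \<in> sector R" and c: "0 < c" "c \<le> form \<kappa> (F1 l) (V1 l) x" and s: "0 \<le> s" "s \<le> t"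
  shows "c * exp (s / 2) \<le> form \<kappa> (F1 l) (V1 l) (x + \<omega> * of_real s)"
    and "cmod (quot l (x + \<omega> * of_real t) - quot l (x + \<omega> * of_real s)) \<le> 2 * (cmod x + 2 * s) / (c * exp (s / 2))"
proof -
  have "c * exp (s / 2) \<le> form \<kappa> (F1 l) (V1 l) x * exp (s / 2)"
    using c by (intro mult_right_mono) auto
  also have "\<dots> \<le> form \<kappa> (F1 l) (V1 l) (x + \<omega> * of_real s)"
    by (rule form_growth[OF is_pair_1 s(1)]) (intro co sector_oblique x)
  finally show g: "c * exp (s / 2) \<le> form \<kappa> (F1 l) (V1 l) (x + \<omega> * of_real s)" .
  have pos: "0 < c * exp (s / 2)" using c by simp
  have eq: "x + \<omega> * of_real s + \<omega> * of_real (t - s) = x + \<omega> * of_real t" by (simp add: algebra_simps)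
  have "cmod (quot l (x + \<omega> * of_real s + \<omega> * of_real (t - s)) - quot l (x + \<omega> * of_real s))
     \<le> 2 * cmod (x + \<omega> * of_real s) / form \<kappa> (F1 l) (V1 l) (x + \<omega> * of_real s)"
    by (rule quot_diff[where \<kappa> = \<kappa>]) (use s pos g in \<open>auto intro!: co sector_oblique x\<close>)
  then have "cmod (quot l (x + \<omega> * of_real t) - quot l (x + \<omega> * of_real s))
     \<le> 2 * cmod (x + \<omega> * of_real s) / form \<kappa> (F1 l) (V1 l) (x + \<omega> * of_real s)"
    unfolding eq .
  also have "\<dots> \<le> 2 * (cmod x + 2 * s) / (c * exp (s / 2))"
  proof (rule frac_le)
    have "cmod (x + \<omega> * of_real s) \<le> cmod x + cmod \<omega> * s"
      using norm_triangle_ineq[of x "\<omega> * of_real s"] s by (simp add: norm_mult)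
    also have "\<dots> \<le> cmod x + 2 * s" using norm_\<omega> s by (intro add_left_mono mult_right_mono) auto
    finally show "2 * cmod (x + \<omega> * of_real s) \<le> 2 * (cmod x + 2 * s)" by simp
  qed (use g pos s in auto)
  finally show "cmod (quot l (x + \<omega> * of_real t) - quot l (x + \<omega> * of_real s)) \<le> 2 * (cmod x + 2 * s) / (c * exp (s / 2))" .
qed

lemma affine_bound_tendsto:
  assumes "0 < c"
  shows "((\<lambda>s::real. 2 * (A + 2 * s) / (c * exp (s / 2))) \<longlongrightarrow> 0) at_top"
proof -
  have "((\<lambda>s::real. 2 / c * ((A + 2 * s) / exp (s / 2))) \<longlongrightarrow> 2 / c * 0) at_top"
    by (intro tendsto_intros affine_div_exp_tendsto)
  then show ?thesis by (simp add: mult_ac)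
qed

text \<open>Both r and R + \<omega> n lead to the corner r + \<omega> n, so two uses of
  \<open>quot_diff\<close> compare their quotients. Letting n tend to infinity leaves 2 r/\<phi>(r),
  which decays because the form also grows along the axis.\<close>

lemma quot_real_limit:
  assumes R: "1 \<le> R" and \<epsilon>: "0 < \<epsilon>"
    and co: "\<And>\<kappa> x. cmod (\<kappa> - 1) < \<epsilon> \<Longrightarrow> x \<in> sector R \<Longrightarrow> coercive \<kappa> l \<omega> x"
    and l: "0 < Re l" "0 < Im l"
    and L: "(\<lambda>n. quot l (of_real R + \<omega> * of_real (real n))) \<longlonglongrightarrow> L"
  shows "((\<lambda>t. quot l (of_real t)) \<longlongrightarrow> L) at_top"
proof -
  have l0: "0 < cmod l" using l by auto
  \<comment> \<open>\<epsilon>/2 keeps \<kappa> in the range of \<open>co\<close>; the other two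
    bounds are those of \<open>coercive_horizontal\<close>.\<close>
  define \<beta> where "\<beta> = min (\<epsilon> / 2) (min 1 (Im l / (4 * cmod l)))"
  have \<beta>: "0 < \<beta>" "\<beta> < \<epsilon>" "\<beta> \<le> 1" "\<beta> \<le> Im l / (4 * cmod l)"
    using \<epsilon> l l0 by (auto simp: \<beta>_def)
  define \<kappa> where "\<kappa> = Complex 1 (- \<beta>)"
  have "\<kappa> - 1 = Complex 0 (- \<beta>)" by (simp add: \<kappa>_def complex_eq_iff)
  then have k1: "cmod (\<kappa> - 1) < \<epsilon>" using \<beta> by (simp add: cmod_def)
  have "\<beta> * Re l \<le> Im l / (4 * cmod l) * cmod l"
    using \<beta> l complex_Re_le_cmod[of l] by (intro mult_mono) auto
  also have "\<dots> = Im l / 4" using l0 by simp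
  finally have Ik: "0 < Im (\<kappa> * l)" "Im \<kappa> < 0" using l \<beta> by (auto simp: \<kappa>_def)
  define \<phi> where "\<phi> = form \<kappa> (F1 l) (V1 l)"
  have pos: "0 < \<phi> (of_real t)" if "0 < t" for t
    unfolding \<phi>_def using Ik that by (intro real_form_nonneg(2)) auto
  obtain R1 where R1: "1 \<le> R1" and ch: "\<And>x. x \<in> sector R1 \<Longrightarrow> coercive \<kappa> l 1 x"
    using coercive_horizontal[OF l \<beta>(1,3,4)] unfolding \<kappa>_def by blast
  define R2 where "R2 = max R R1"
  have R2: "R \<le> R2" "R1 \<le> R2" "1 \<le> R2" using R by (auto simp: R2_def)
  have bound: "cmod (quot l (of_real r) - L) \<le> 2 * r / \<phi> (of_real r)" if r: "R2 \<le> r" for r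
  proof -
    let ?e = "\<lambda>s. 2 * (R + 2 * s) / (\<phi> (of_real R) * exp (s / 2))"
    have lim1: "(\<lambda>n. cmod (quot l (of_real r) - quot l (of_real R + \<omega> * of_real (real n)))) \<longlonglongrightarrow>
        cmod (quot l (of_real r) - L)"
      by (intro tendsto_intros L)
    have "(\<lambda>n. ?e (real n)) \<longlonglongrightarrow> 0"
      by (rule filterlim_compose[OF affine_bound_tendsto filterlim_real_sequentially]) (use pos R in simp)
    then have lim2: "(\<lambda>n. 2 * r / \<phi> (of_real r) + ?e (real n)) \<longlonglongrightarrow> 2 * r / \<phi> (of_real r) + 0"
      by (intro tendsto_intros)
    have "cmod (quot l (of_real r) - quot l (of_real R + \<omega> * of_real (real n))) \<le> 2 * r / \<phi> (of_real r) + ?e (real n)"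
      if n: "R2 \<le> real n" for n
    proof -
      let ?s = "real n" and ?x = "complex_of_real R + \<omega> * of_real (real n)"
      have xR: "?x \<in> sector R" by (intro sector_oblique of_real_sector R) auto
      \<comment> \<open>The real part is R + n, so R2 \<le> n carries the point past R1, where
        horizontal paths are coercive.\<close>
      then have xR1: "?x \<in> sector R1" using n R R2 by (auto simp: sector_def \<omega>_def)
      have a: "\<phi> (of_real R) * exp (?s / 2) \<le> \<phi> ?x"
        unfolding \<phi>_def
        by (rule quot_oblique_bound(1)[where t = ?s and R = R]) (use pos[of R] R in \<open>auto intro!: co k1 of_real_sector simp: \<phi>_def\<close>)
      have ppos: "0 < \<phi> (of_real R) * exp (?s / 2)" using pos R by simp
      have h: "cmod (quot l (?x + 1 * of_real (r - R)) - quot l ?x) \<le> 2 * cmod ?x / \<phi> ?x"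
        unfolding \<phi>_def
        by (rule quot_diff) (use r R2 a ppos in \<open>auto intro!: ch sector_horizontal[OF xR1, simplified] simp: \<phi>_def\<close>)
      also have "\<dots> \<le> ?e ?s"
      proof (rule frac_le)
        have "cmod ?x \<le> R + cmod \<omega> * ?s"
          using norm_triangle_ineq[of "of_real R" "\<omega> * of_real ?s"] R by (simp add: norm_mult)
        also have "\<dots> \<le> R + 2 * ?s" using norm_\<omega> by (intro add_left_mono mult_right_mono) auto
        finally show "2 * cmod ?x \<le> 2 * (R + 2 * ?s)" by simp
      qed (use a ppos R in auto)
      finally have h: "cmod (quot l (?x + 1 * of_real (r - R)) - quot l ?x) \<le> ?e ?s" .
      have eq: "?x + 1 * of_real (r - R) = of_real r + \<omega> * of_real ?s" by simp
      have v: "cmod (quot l (of_real r + \<omega> * of_real ?s) - quot l (of_real r)) \<le> 2 * cmod (of_real r :: complex) / \<phi> (of_real r)"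
        unfolding \<phi>_def
        by (rule quot_diff) (use r R2 R pos[of r] in \<open>auto intro!: co k1 sector_oblique of_real_sector simp: \<phi>_def\<close>)
      have "cmod (quot l (of_real r) - quot l ?x) \<le>
          cmod (quot l (of_real r + \<omega> * of_real ?s) - quot l (of_real r)) + cmod (quot l (of_real r + \<omega> * of_real ?s) - quot l ?x)"
        using norm_triangle_ineq4[of "quot l (of_real r + \<omega> * of_real ?s) - quot l ?x" "quot l (of_real r + \<omega> * of_real ?s) - quot l (of_real r)"]
        by simp
      then show ?thesis using v h R2 r unfolding eq by simp
    qed
    then have "\<forall>\<^sub>F n in sequentially. cmod (quot l (of_real r) - quot l (of_real R + \<omega> * of_real (real n))) \<le> 2 * r / \<phi> (of_real r) + ?e (real n)"
      using eventually_ge_at_top[of "nat \<lceil>R2\<rceil>"] by (auto elim!: eventually_mono simp: nat_ceiling_le_eq)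
    from tendsto_le[OF _ lim2 lim1 this] show ?thesis by simp
  qed
  define C where "C = \<phi> (of_real R2) / exp (R2 / 2)"
  have C: "0 < C" using pos[of R2] R2 by (simp add: C_def)
  have bound': "cmod (quot l (of_real r) - L) \<le> 2 * (0 + 2 * r) / (C * exp (r / 2))" if r: "R2 \<le> r" for r
  proof -
    have "\<phi> (of_real R2) * exp ((r - R2) / 2) \<le> \<phi> (of_real R2 + 1 * of_real (r - R2))"
      unfolding \<phi>_def
      by (rule form_growth[OF is_pair_1]) (use r R1 R2 in \<open>auto intro!: ch sector_horizontal[simplified] of_real_sector\<close>)
    also have "\<phi> (of_real R2) * exp ((r - R2) / 2) = C * exp (r / 2)"
      by (simp add: C_def exp_diff diff_divide_distrib)
    finally have g: "C * exp (r / 2) \<le> \<phi> (of_real r)" by simp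
    have "2 * r / \<phi> (of_real r) \<le> 2 * (0 + 2 * r) / (C * exp (r / 2))"
      using g C r R2 by (intro frac_le) auto
    then show ?thesis using bound[OF r] by linarith
  qed
  have "((\<lambda>t. quot l (of_real t) - L) \<longlongrightarrow> 0) at_top"
    by (rule Lim_null_comparison[OF _ affine_bound_tendsto[OF C, of 0]])
       (rule eventually_mono[OF eventually_ge_at_top[of R2] bound'])
  then show ?thesis by (simp add: LIM_zero_iff)
qed

text \<open>The quotients at x1 + \<omega> n are holomorphic in l and uniformly Cauchy on a ball
  around \<tau>, since a common positive start value makes all the forms grow together. For Im l > 0
  their limit is also the limit along the axis.\<close>

proposition weyl_m_continuation:
  assumes \<tau>: "0 < \<tau>"
  shows "\<exists>r>0. \<exists>M. M holomorphic_on ball (of_real \<tau>) r \<and> (\<forall>l\<in>ball (of_real \<tau>) r. 0 < Im l \<longrightarrow> weyl_m l = M l)"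
proof -
  obtain \<epsilon> R where \<epsilon>: "0 < \<epsilon>" and R: "1 \<le> R"
    and co: "\<And>\<kappa> l x. cmod (l - of_real \<tau>) < \<epsilon> \<Longrightarrow> cmod (\<kappa> - 1) < \<epsilon> \<Longrightarrow> x \<in> sector R \<Longrightarrow> coercive \<kappa> l \<omega> x"
    using coercive_oblique[OF \<tau>] by metis
  \<comment> \<open>One oblique step makes the form strictly positive at l = \<tau>, even from the
    value 0 on the axis.\<close>
  define x1 where "x1 = of_real R + \<omega> * of_real 1"
  have x1: "x1 \<in> sector R" unfolding x1_def by (intro sector_oblique of_real_sector R) auto
  define \<phi> where "\<phi> = (\<lambda>l. form 1 (F1 l) (V1 l) x1)"
  have "form 1 (F1 (of_real \<tau>)) (V1 (of_real \<tau>)) (of_real R) < \<phi> (of_real \<tau>)"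
    unfolding \<phi>_def x1_def by (rule form_strict) (use \<epsilon> R in \<open>auto intro!: co sector_oblique of_real_sector\<close>)
  moreover have "0 \<le> form 1 (F1 (of_real \<tau>)) (V1 (of_real \<tau>)) (of_real R)"
    by (rule form_nonneg_real_param) (use \<tau> R in auto)
  ultimately have \<phi>0: "0 < \<phi> (of_real \<tau>)" by linarith
  define c where "c = \<phi> (of_real \<tau>) / 2"
  have c: "0 < c" using \<phi>0 by (simp add: c_def)
  have "isCont \<phi> (of_real \<tau>)"
    unfolding \<phi>_def by (rule form_param_continuous[OF wedge_dom[OF sector_bounds(1)[OF x1 R]]])
  then have "(\<phi> \<longlongrightarrow> \<phi> (of_real \<tau>)) (nhds (of_real \<tau>))" by (simp add: isCont_def tendsto_nhds_iff)
  then have "\<forall>\<^sub>F l in nhds (of_real \<tau>). c < \<phi> l"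
    by (rule order_tendstoD) (use \<phi>0 in \<open>simp add: c_def\<close>)
  then obtain d where d: "0 < d" "\<And>l. dist l (of_real \<tau>) < d \<Longrightarrow> c < \<phi> l"
    unfolding eventually_nhds_metric by blast
  \<comment> \<open>\<tau> enters to keep Re l > 0, as \<open>quot_real_limit\<close>
    requires.\<close>
  define r where "r = min (min d \<epsilon>) \<tau>"
  have r: "0 < r" using d \<epsilon> \<tau> by (simp add: r_def)
  define B where "B = ball (complex_of_real \<tau>) r"
  have B: "cmod (l - of_real \<tau>) < \<epsilon>" "c \<le> \<phi> l" "0 < Re l" if "l \<in> B" for l
  proof -
    have dl: "dist l (of_real \<tau>) < r" using that by (simp add: B_def dist_commute)
    then show "cmod (l - of_real \<tau>) < \<epsilon>" "c \<le> \<phi> l" using d(2)[of l] by (auto simp: r_def dist_norm)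
    have "\<bar>Re l - \<tau>\<bar> \<le> dist l (of_real \<tau>)" using abs_Re_le_cmod[of "l - of_real \<tau>"] by (simp add: dist_norm)
    then show "0 < Re l" using dl unfolding r_def by linarith
  qed
  define f where "f = (\<lambda>(n::nat) l. quot l (x1 + \<omega> * of_real (real n)))"
  have co1: "coercive 1 l \<omega> x" if "l \<in> B" "x \<in> sector R" for l x
    by (rule co) (use B(1)[OF that(1)] \<epsilon> that(2) in auto)
  have fd: "cmod (f n l - f m l) \<le> 2 * (cmod x1 + 2 * real m) / (c * exp (real m / 2))" if "l \<in> B" "m \<le> n" for l m n
    unfolding f_def by (rule quot_oblique_bound(2)[where \<kappa> = 1 and R = R])
      (use that co1 x1 c B(2) in \<open>auto simp: \<phi>_def\<close>)
  have b0: "(\<lambda>m. 2 * (cmod x1 + 2 * real m) / (c * exp (real m / 2))) \<longlonglongrightarrow> 0"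
    by (rule filterlim_compose[OF affine_bound_tendsto[OF c] filterlim_real_sequentially])
  have "uniformly_Cauchy_on B f"
  proof (rule uniformly_Cauchy_onI')
    fix e :: real assume "0 < e"
    then have "\<forall>\<^sub>F m in sequentially. 2 * (cmod x1 + 2 * real m) / (c * exp (real m / 2)) < e"
      using order_tendstoD(2)[OF b0] by blast
    then obtain M where M: "\<And>m. M \<le> m \<Longrightarrow> 2 * (cmod x1 + 2 * real m) / (c * exp (real m / 2)) < e"
      by (auto simp: eventually_sequentially)
    have "dist (f m l) (f n l) < e" if "l \<in> B" "M \<le> m" "m < n" for l m n
      using fd[OF that(1), of m n] M[OF that(2)] that by (simp add: dist_norm norm_minus_commute)
    then show "\<exists>M. \<forall>l\<in>B. \<forall>m\<ge>M. \<forall>n>m. dist (f m l) (f n l) < e" by blast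
  qed
  then obtain M where M: "uniform_limit B f M sequentially"
    using Cauchy_uniformly_convergent uniformly_convergent_on_def by metis
  have hol: "M holomorphic_on B"
  proof (rule holomorphic_uniform_sequence)
    show "open B" by (simp add: B_def)
    show "f n holomorphic_on B" for n
    proof -
      have w: "x1 + \<omega> * of_real (real n) \<in> sl_domain"
        by (intro wedge_dom sector_bounds(1)[OF _ R] sector_oblique x1) simp
      have "F1 l (x1 + \<omega> * of_real (real n)) \<noteq> 0" if l: "l \<in> B" for l
      proof (rule form_pos_nonzero[of 1 "F1 l" "V1 l"])
        have "0 < c * exp (real n / 2)" using c by simp
        also have "\<dots> \<le> form 1 (F1 l) (V1 l) (x1 + \<omega> * of_real (real n))"
          by (rule quot_oblique_bound(1)[where R = R and t = "real n"])
             (use l co1 x1 c B(2) in \<open>auto simp: \<phi>_def\<close>)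
        finally show "0 < form 1 (F1 l) (V1 l) (x1 + \<omega> * of_real (real n))" .
      qed
      then show ?thesis unfolding f_def quot_def
        by (intro holomorphic_on_divide F_param_hol w) auto
    qed
    show "\<exists>d>0. cball l d \<subseteq> B \<and> uniform_limit (cball l d) f M sequentially" if "l \<in> B" for l
    proof -
      have "open B" by (simp add: B_def)
      then have "\<forall>l\<in>B. \<exists>d>0. cball l d \<subseteq> B" by (rule open_contains_cball[THEN iffD1])
      from bspec[OF this that] obtain d where "0 < d" "cball l d \<subseteq> B" by (elim exE conjE)
      then show ?thesis by (intro exI[of _ d] conjI uniform_limit_on_subset[OF M])
    qed
  qed
  have "weyl_m l = - M l" if l: "l \<in> B" "0 < Im l" for l
  proof -
    have "(\<lambda>n. f n l) \<longlonglongrightarrow> M l" by (rule tendsto_uniform_limitI[OF M l(1)])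
    \<comment> \<open>\<open>f\<close> starts at x1, one step after R, hence the shift by
      \<open>Suc\<close>.\<close>
    then have "(\<lambda>n. quot l (of_real R + \<omega> * of_real (real (Suc n)))) \<longlonglongrightarrow> M l"
      by (simp add: f_def x1_def algebra_simps)
    then have "(\<lambda>n. quot l (of_real R + \<omega> * of_real (real n))) \<longlonglongrightarrow> M l"
      by (rule LIMSEQ_imp_Suc)
    from quot_real_limit[OF R \<epsilon> co[OF B(1)[OF l(1)]] B(3)[OF l(1)] l(2) this]
    have q: "((\<lambda>t. quot l (of_real t)) \<longlongrightarrow> M l) at_top" by simp
    have "\<forall>\<^sub>F t in at_top. quot l (complex_of_real t) = u0 l t / u1 l t"
      using eventually_gt_at_top[of 0] by eventually_elim (simp add: u0_u1_quotient quot_def)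
    with q have "((\<lambda>t. u0 l t / u1 l t) \<longlongrightarrow> M l) at_top"
      by (rule Lim_transform_eventually)
    then show ?thesis unfolding weyl_m_def by (subst tendsto_Lim) auto
  qed
  then show ?thesis using r hol unfolding B_def
    by (intro exI[of _ r] conjI exI[of _ "\<lambda>l. - M l"] holomorphic_intros) auto
qed

text \<open>Discontinuities of a monotone function are countable, so continuity points are dense.
  Monotonicity squeezes \<rho> t between values of \<Phi> + c at continuity points on both sides of
  t, which excludes jumps.\<close>

lemma mono_determined_by_continuity_points:
  fixes \<rho> \<Phi> :: "real \<Rightarrow> real"
  assumes m: "mono \<rho>" and I: "open I" "connected I" and \<Phi>: "continuous_on I \<Phi>"
    and eq: "\<And>a b. a \<in> I \<Longrightarrow> b \<in> I \<Longrightarrow> a < b \<Longrightarrow> isCont \<rho> a \<Longrightarrow> isCont \<rho> b \<Longrightarrow> \<rho> b - \<rho> a = \<Phi> b - \<Phi> a"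
  shows "\<exists>c. \<forall>t\<in>I. \<rho> t = \<Phi> t + c"
proof (cases "I = {}")
  case False
  then obtain t0 d0 where t0: "t0 \<in> I" "0 < d0" "ball t0 d0 \<subseteq> I"
    using I(1) open_contains_ball by blast
  have dense: "\<exists>s. a < s \<and> s < b \<and> isCont \<rho> s" if "a < b" for a b
  proof (rule ccontr)
    assume "\<not> ?thesis"
    then have "{a<..<b} \<subseteq> {x. \<not> isCont \<rho> x}" by auto
    then have "countable {a<..<b}" using mono_ctble_discont[OF m] countable_subset by blast
    then show False using uncountable_open_interval[of a b] that by simp
  qed
  obtain s0 where s0: "s0 \<in> I" "isCont \<rho> s0"
    using dense[of t0 "t0 + d0"] t0 by (force simp: dist_real_def)
  define c where "c = \<rho> s0 - \<Phi> s0"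
  have at_cont: "\<rho> s = \<Phi> s + c" if "s \<in> I" "isCont \<rho> s" for s
    using eq[of s s0] eq[of s0 s] that s0 by (cases s s0 rule: linorder_cases) (auto simp: c_def)
  have "\<rho> t = \<Phi> t + c" if t: "t \<in> I" for t
  proof -
    have "\<bar>\<rho> t - (\<Phi> t + c)\<bar> \<le> 0 + e" if e: "0 < e" for e
    proof -
      have "isCont \<Phi> t" using \<Phi> I(1) t by (simp add: continuous_on_eq_continuous_at)
      then obtain d1 where d1: "0 < d1" "\<And>s. \<bar>s - t\<bar> < d1 \<Longrightarrow> \<bar>\<Phi> s - \<Phi> t\<bar> < e"
        using e unfolding continuous_at_eps_delta dist_real_def by blast
      obtain d2 where d2: "0 < d2" "ball t d2 \<subseteq> I" using I(1) t open_contains_ball by blast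
      define d where "d = min d1 d2"
      have d: "0 < d" using d1 d2 by (simp add: d_def)
      obtain s1 where s1: "t - d < s1" "s1 < t" "isCont \<rho> s1" using dense[of "t - d" t] d by auto
      obtain s2 where s2: "t < s2" "s2 < t + d" "isCont \<rho> s2" using dense[of t "t + d"] d by auto
      have "s1 \<in> I" "s2 \<in> I" using s1 s2 d2 by (auto simp: d_def dist_real_def subset_iff)
      then have "\<rho> s1 = \<Phi> s1 + c" "\<rho> s2 = \<Phi> s2 + c" using at_cont s1 s2 by auto
      moreover have "\<rho> s1 \<le> \<rho> t" "\<rho> t \<le> \<rho> s2" using m s1 s2 by (auto simp: mono_def)
      moreover have "\<bar>\<Phi> s1 - \<Phi> t\<bar> < e" "\<bar>\<Phi> s2 - \<Phi> t\<bar> < e"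
        using d1(2)[of s1] d1(2)[of s2] s1 s2 by (auto simp: d_def)
      ultimately show ?thesis by linarith
    qed
    then have "\<bar>\<rho> t - (\<Phi> t + c)\<bar> \<le> 0" by (rule field_le_epsilon)
    then show ?thesis by simp
  qed
  then show ?thesis by blast
qed auto

text \<open>With a primitive \<open>N\<close> of the continued m-function, the integrals at height e
  are exact differences of Im N, so letting e tend to 0 only uses continuity of
  \<open>N\<close>.\<close>

lemma spectral_function_local:
  assumes \<rho>: "is_spectral_function \<rho>" and \<tau>: "0 < \<tau>"
  shows "\<exists>r>0. \<exists>M. M holomorphic_on ball (of_real \<tau>) r \<and>
     (\<forall>t. \<bar>t - \<tau>\<bar> < r \<longrightarrow> (\<rho> has_real_derivative Im (M (of_real t)) / pi) (at t))"
proof -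
  obtain r M where r: "0 < r" and M: "M holomorphic_on ball (of_real \<tau>) r"
    and wM: "\<And>l. l \<in> ball (of_real \<tau>) r \<Longrightarrow> 0 < Im l \<Longrightarrow> weyl_m l = M l"
    using weyl_m_continuation[OF \<tau>] by metis
  obtain N where N: "\<And>l. l \<in> ball (of_real \<tau>) r \<Longrightarrow> (N has_field_derivative M l) (at l)"
    using holomorphic_convex_primitive'[OF convex_ball open_ball M] by (metis at_within_open open_ball)
  define \<Phi> where "\<Phi> = (\<lambda>t. Im (N (of_real t)) / pi)"
  have in_ball: "Complex t e \<in> ball (of_real \<tau>) r" if "\<bar>t - \<tau>\<bar> + \<bar>e\<bar> < r" for t e
  proof -
    have "dist (of_real \<tau>) (Complex t e) \<le> \<bar>t - \<tau>\<bar> + \<bar>e\<bar>"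
      using cmod_le[of "of_real \<tau> - Complex t e"] by (simp add: dist_norm abs_minus_commute)
    then show ?thesis using that by simp
  qed
  have line: "((\<lambda>t. Im (N (Complex t e))) has_vector_derivative Im (M (Complex t e))) (at t within A)"
    if "\<bar>t - \<tau>\<bar> + \<bar>e\<bar> < r" for t e A
  proof -
    have "((\<lambda>t. of_real t + \<i> * of_real e) has_vector_derivative 1) (at t)"
      by (auto intro!: derivative_eq_intros)
    moreover have "(N has_field_derivative M (Complex t e)) (at (of_real t + \<i> * of_real e))"
      using N[OF in_ball[OF that]] by (simp add: Complex_eq)
    ultimately have "((N \<circ> (\<lambda>t. of_real t + \<i> * of_real e)) has_vector_derivative 1 * M (Complex t e)) (at t)"
      by (rule field_vector_diff_chain_at)
    then have "((\<lambda>t. N (Complex t e)) has_vector_derivative M (Complex t e)) (at t)"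
      by (simp add: o_def Complex_eq)
    from bounded_linear.has_vector_derivative[OF bounded_linear_Im this]
    show ?thesis by (rule has_vector_derivative_at_within)
  qed
  have d\<Phi>: "(\<Phi> has_real_derivative Im (M (of_real t)) / pi) (at t)" if "\<bar>t - \<tau>\<bar> < r" for t
  proof -
    have "((\<lambda>t. Im (N (Complex t 0))) has_real_derivative Im (M (Complex t 0))) (at t)"
      using line[of t 0 UNIV] that by (simp add: has_real_derivative_iff_has_vector_derivative)
    from DERIV_cdivide[OF this, of pi] show ?thesis
      unfolding \<Phi>_def by (simp add: complex_of_real_def)
  qed
  define I where "I = {\<tau> - r<..<\<tau> + r}"
  have I: "t \<in> I \<longleftrightarrow> \<bar>t - \<tau>\<bar> < r" for t by (auto simp: I_def)
  have "\<rho> b - \<rho> a = \<Phi> b - \<Phi> a"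
    if ab: "a \<in> I" "b \<in> I" "a < b" and cont: "isCont \<rho> a" "isCont \<rho> b" for a b
  proof -
    \<comment> \<open>Below height d the whole segment over [a, b] still lies in the ball, by the
      sum-norm criterion \<open>in_ball\<close>.\<close>
    define d where "d = r - max \<bar>a - \<tau>\<bar> \<bar>b - \<tau>\<bar>"
    have d: "0 < d" using ab by (auto simp: d_def I)
    have near: "\<bar>t - \<tau>\<bar> + \<bar>e\<bar> < r" if "a \<le> t" "t \<le> b" "\<bar>e\<bar> < d" for t e
      using that by (auto simp: d_def)
    have int: "(LBINT t=ereal a..ereal b. Im (weyl_m (Complex t e))) = Im (N (Complex b e)) - Im (N (Complex a e))"
      if e: "0 < e" "e < d" for e
    proof -
      have "(LBINT t=ereal a..ereal b. Im (weyl_m (Complex t e))) = (LBINT t=ereal a..ereal b. Im (M (Complex t e)))"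
      proof (rule interval_integral_cong)
        fix t assume "t \<in> einterval (min (ereal a) (ereal b)) (max (ereal a) (ereal b))"
        then have "a \<le> t" "t \<le> b" using ab(3) by (auto simp: einterval_def)
        then have "Complex t e \<in> ball (of_real \<tau>) r" using e by (intro in_ball near) auto
        then show "Im (weyl_m (Complex t e)) = Im (M (Complex t e))" using wM e by simp
      qed
      also have "\<dots> = Im (N (Complex b e)) - Im (N (Complex a e))"
      proof (rule interval_integral_FTC_finite)
        have "continuous_on {a..b} (\<lambda>t. M (Complex t e))"
        proof (rule continuous_on_compose2[OF holomorphic_on_imp_continuous_on[OF M]])
          show "continuous_on {a..b} (\<lambda>t. Complex t e)"
            unfolding Complex_eq by (intro continuous_intros)
          have "Complex t e \<in> ball (of_real \<tau>) r" if "t \<in> {a..b}" for t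
            using e that by (intro in_ball near) auto
          then show "(\<lambda>t. Complex t e) ` {a..b} \<subseteq> ball (of_real \<tau>) r" by blast
        qed
        then show "continuous_on {min a b..max a b} (\<lambda>t. Im (M (Complex t e)))"
          using ab(3) by (auto intro!: continuous_intros simp: min_def max_def)
        show "((\<lambda>t. Im (N (Complex t e))) has_vector_derivative Im (M (Complex t e))) (at t within {min a b..max a b})"
          if "min a b \<le> t" "t \<le> max a b" for t
        proof (rule line)
          have "a \<le> t" "t \<le> b" "\<bar>e\<bar> < d" using that ab(3) e by (auto simp: min_def max_def)
          then show "\<bar>t - \<tau>\<bar> + \<bar>e\<bar> < r" by (rule near)
        qed
      qed
      finally show ?thesis .
    qed
    have lim: "((\<lambda>e. Im (N (Complex t e))) \<longlongrightarrow> Im (N (Complex t 0))) (at_right 0)" if "t \<in> I" for t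
    proof -
      have "isCont N (Complex t 0)"
        using N[OF in_ball[of t 0]] that by (simp add: I DERIV_isCont)
      moreover have "((\<lambda>e. Complex t e) \<longlongrightarrow> Complex t 0) (at_right 0)"
        unfolding Complex_eq by (auto intro!: tendsto_eq_intros)
      ultimately show ?thesis by (intro tendsto_intros) (rule isCont_tendsto_compose)
    qed
    have "((\<lambda>e. 1 / pi * (Im (N (Complex b e)) - Im (N (Complex a e)))) \<longlongrightarrow>
        1 / pi * (Im (N (Complex b 0)) - Im (N (Complex a 0)))) (at_right 0)"
      by (intro tendsto_mult_left tendsto_diff lim ab)
    moreover have "\<forall>\<^sub>F e in at_right 0. 1 / pi * (Im (N (Complex b e)) - Im (N (Complex a e))) =
        1 / pi * (LBINT t=ereal a..ereal b. Im (weyl_m (Complex t e)))"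
      unfolding eventually_at_right_field using d int by auto
    ultimately have "((\<lambda>e. 1 / pi * (LBINT t=ereal a..ereal b. Im (weyl_m (Complex t e)))) \<longlongrightarrow>
        1 / pi * (Im (N (Complex b 0)) - Im (N (Complex a 0)))) (at_right 0)"
      by (rule Lim_transform_eventually)
    moreover have "((\<lambda>e. 1 / pi * (LBINT t=ereal a..ereal b. Im (weyl_m (Complex t e)))) \<longlongrightarrow> \<rho> b - \<rho> a) (at_right 0)"
      using \<rho> ab(3) cont unfolding is_spectral_function_def by blast
    ultimately have "1 / pi * (Im (N (Complex b 0)) - Im (N (Complex a 0))) = \<rho> b - \<rho> a"
      using tendsto_unique trivial_limit_at_right_real by blast
    then show ?thesis by (simp add: \<Phi>_def complex_of_real_def diff_divide_distrib)
  qed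
  moreover have "continuous_on I \<Phi>"
    using d\<Phi> I by (auto intro!: continuous_at_imp_continuous_on DERIV_isCont)
  moreover have "mono \<rho>" using \<rho> by (simp add: is_spectral_function_def)
  ultimately obtain c where c: "\<And>t. t \<in> I \<Longrightarrow> \<rho> t = \<Phi> t + c"
    using mono_determined_by_continuity_points[of \<rho> I \<Phi>] by (auto simp: I_def)
  have "(\<rho> has_real_derivative Im (M (of_real t)) / pi) (at t)" if t: "\<bar>t - \<tau>\<bar> < r" for t
  proof -
    have "((\<lambda>t. \<Phi> t + c) has_real_derivative Im (M (of_real t)) / pi) (at t)"
      using d\<Phi>[OF t] by (auto intro!: derivative_eq_intros)
    then show ?thesis
      by (rule has_field_derivative_transform_within_open[of _ _ _ I]) (use t c I in \<open>auto simp: I_def\<close>)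
  qed
  then show ?thesis using r M by blast
qed

theorem mainTheorem1:
  fixes \<rho> :: "real \<Rightarrow> real"
  assumes "is_spectral_function \<rho>"
  shows "(\<forall>x>0. \<rho> differentiable (at x)) \<and> real_analytic_on (deriv \<rho>) {0<..}"
proof
  show "\<forall>x>0. \<rho> differentiable (at x)"
    using spectral_function_local[OF assms] by (metis abs_zero cancel_comm_monoid_add_class.diff_cancel real_differentiable_def)
  show "real_analytic_on (deriv \<rho>) {0<..}"
    unfolding real_analytic_on_def
  proof
    fix x0 :: real assume "x0 \<in> {0<..}"
    then obtain r M where r: "0 < r" and M: "M holomorphic_on ball (of_real x0) r"
      and d: "\<And>t. \<bar>t - x0\<bar> < r \<Longrightarrow> (\<rho> has_real_derivative Im (M (of_real t)) / pi) (at t)"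
      using spectral_function_local[OF assms] by (metis greaterThan_iff)
    \<comment> \<open>Taylor coefficients at a real centre: for real x the powers of x - x0 are
      real, so imaginary parts may be taken coefficient by coefficient.\<close>
    define a where "a = (\<lambda>n. (deriv ^^ n) M (of_real x0) / fact n)"
    have "(\<lambda>n. Im (a n) / pi * (x - x0) ^ n) sums deriv \<rho> x" if x: "\<bar>x - x0\<bar> < r" for x
    proof -
      have "of_real x \<in> ball (complex_of_real x0) r"
        using x by (simp add: dist_of_real dist_real_def abs_minus_commute)
      from sums_Im[OF holomorphic_power_series[OF M this]]
      have "(\<lambda>n. Im (a n * of_real ((x - x0) ^ n))) sums Im (M (of_real x))"
        by (simp add: a_def)
      then have "(\<lambda>n. Im (a n) * (x - x0) ^ n) sums Im (M (of_real x))"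
        by (simp only: Im_mult_real)
      from sums_divide[OF this, of pi] show ?thesis
        using DERIV_imp_deriv[OF d[OF x]] by simp
    qed
    then show "\<exists>r>0. \<exists>a. \<forall>x. \<bar>x - x0\<bar> < r \<longrightarrow> (\<lambda>n. a n * (x - x0) ^ n) sums deriv \<rho> x"
      using r by (intro exI[of _ r] conjI exI[of _ "\<lambda>n. Im (a n) / pi"]) auto
  qed
qed

end
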